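(* Let $\Omega\subset\mathbb R^2$ be compact and convex with nonempty interior, and let $w:\Omega\times\Omega\to[0,1]$ be measurable and symmetric. Then \[ \operatorname{Cr}_\Omega(w)\ \ge\ \frac{8}{9\pi^2}\,e_\Omega(w)^3 . \]
   Context: $\lambda$ denotes the uniform probability measure on $\Omega$ (Lebesgue measure restricted to $\Omega$ divided by its area). $e_\Omega(w)=\int_\Omega\int_\Omega w(y,z)\,\lambda(dy)\lambda(dz)$ and $\operatorname{Cr}_\Omega(w)=\int_{\Omega^4} w(x_1,x_2)w(x_3,x_4)\,\mathbf 1\{[x_1x_2]\text{ crosses }[x_3x_4]\}\prod_{i=1}^4\lambda(dx_i)$, where $[xy]$ is the line segment from $x$ to $y$ and crossing means the segments meet at a point interior to both (degenerate configurations are a null set and ignored). Equivalently, for independent uniform $x_1,\dots,x_4\in\Omega$, $\mathbb E[w(x_1,x_2)w(x_3,x_4)\mathbf 1\{[x_1x_2]\text{ crosses }[x_3x_4]\}]\ge\frac{8}{9\pi^2}\mathbb E[w(x_1,x_2)]^3$. *)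

theory Defs
  imports "HOL-Analysis.Analysis"
begin

text \<open>
  The underlying space of this measure is \<open>\<Omega>\<close> itself, so that the values outside \<open>\<Omega>\<close> of the
  (total) functions integrated below play no role.
\<close>

definition unif :: "(real^2) set \<Rightarrow> (real^2) measure" where
  "unif \<Omega> = uniform_measure (lebesgue_on \<Omega>) \<Omega>"

text \<open>
  The library's open segment is the closed segment without its endpoints, hence empty if
  \<open>a = b\<close>. Overlapping collinear segments count as crossing; such configurations form a null set.
\<close>

definition crosses :: "real^2 \<Rightarrow> real^2 \<Rightarrow> real^2 \<Rightarrow> real^2 \<Rightarrow> bool" where
  "crosses a b c d \<longleftrightarrow> (\<exists>p. p \<in> open_segment a b \<and> p \<in> open_segment c d)"

definition edge_density :: "(real^2) set \<Rightarrow> ((real^2) \<times> (real^2) \<Rightarrow> real) \<Rightarrow> real" where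
  "edge_density \<Omega> w = (\<integral>z. (\<integral>y. w (y, z) \<partial>unif \<Omega>) \<partial>unif \<Omega>)"

text \<open>
  The product measure is completed because \<open>w\<close> will only be assumed Lebesgue measurable on
  \<open>\<Omega> \<times> \<Omega>\<close>, which does not make it measurable for the uncompleted product sigma-algebra; the
  Bochner integral of a non-measurable function would be 0 by convention.
\<close>

definition crossing_density :: "(real^2) set \<Rightarrow> ((real^2) \<times> (real^2) \<Rightarrow> real) \<Rightarrow> real" where
  "crossing_density \<Omega> w =
     (\<integral>(x1, x2, x3, x4). w (x1, x2) * w (x3, x4) * of_bool (crosses x1 x2 x3 x4)
        \<partial>completion (unif \<Omega> \<Otimes>\<^sub>M unif \<Omega> \<Otimes>\<^sub>M unif \<Omega> \<Otimes>\<^sub>M unif \<Omega>))"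

end

theory Submission
  imports Defs "HOL-Probability.Sinc_Integral"
begin

text \<open>
  Writing a segment as \<open>[p - t u, p - t u + u]\<close> with a marked point \<open>p\<close> and \<open>0 < t < 1\<close>, the
  Jacobian of \<open>(p, t, s) \<mapsto> (p - t u, p - s v)\<close> is \<open>\<bar>det (u, v)\<bar>\<close>, so the crossing integral equals
  \<open>\<integral> dp \<integral>\<integral> \<bar>det (u, v)\<bar> f\<^sub>p(u) f\<^sub>p(v) du dv\<close> with \<open>f\<^sub>p(u) = \<integral>\<^sub>0\<^sup>1 w (p - t u, p - t u + u) dt \<in> [0, 1]\<close>,
  while the edge integral is \<open>\<integral>\<integral> f\<^sub>p(u) du dp\<close>. By convexity \<open>f\<^sub>p = 0\<close> for \<open>p \<notin> \<Omega>\<close>. It remains to show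
  the Busemann-type inequality \<open>\<integral>\<integral> \<bar>det (u, v)\<bar> f(u) f(v) du dv \<ge> 8 / (9 \<pi>\<^sup>2) (\<integral> f)\<^sup>3\<close> for
  \<open>0 \<le> f \<le> 1\<close>, with equality for discs centred at the origin, and to apply Jensen's inequality in \<open>p\<close>.

  For the latter inequality put \<open>N(v) = \<integral> \<bar>det (u, v)\<bar> f(u) du\<close>, a norm, and let \<open>T\<close> be the area of
  its unit ball. The bathtub principle bounds \<open>J = \<integral> N f\<close> below by \<open>2/3 (\<integral> f)\<^sup>3\<^sup>/\<^sup>2 T\<^sup>-\<^sup>1\<^sup>/\<^sup>2\<close>, and
  \<open>J T \<le> \<pi>\<^sup>2 / 2\<close> is a form of the planar Blaschke-Santalo inequality. The latter is proved by
  parametrising the boundary of the ball by area and comparing the resulting Hill equation with the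
  sine and the cosine by means of Picone's identity.
\<close>

section \<open>A planar Blaschke-Santalo inequality\<close>

text \<open>Why \<open>J T \<le> \<pi>^2 / 2\<close> is a Blaschke-Santalo inequality: in slope
  coordinates \<open>J\<close> becomes \<integral> h pot = 1/2 \<integral> pot pot'', and
  \<integral> pot pot'' is the area of the convex body with support function \<open>N\<close>, while
  \<open>T\<close> is the area of its polar. The constant comes from 4/9 (\<integral> f)^3 \<le> J^2
  T = J (J T) \<le> J \<pi>^2 / 2. Why both the sine and the cosine occur: with ds = dt / pot^2 the
  functions (a + b t) / pot are the solutions of the Hill equation y'' + 2 h pot^3 y = 0 on an
  interval of length \<open>T\<close>. A trial function that vanishes where such a solution vanishes
  controls only an integral of the coefficient weighted by the squared trial function. The weights
  cos^2 and sin^2 add up to 1 and recover 2 \<integral> h pot. A separate obstacle is measurability: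
  \<open>w\<close> is only Lebesgue measurable, so it is exchanged for a Borel function off a null
  set before Fubini arguments apply, and completeness of the measures carries the integrals back to
  \<open>w\<close>.\<close>

lemma integral_sgn_deriv_top:
  fixes F f :: "real \<Rightarrow> real"
  assumes S: "finite S" and cont: "continuous_on UNIV F"
    and der: "\<And>t. t \<notin> S \<Longrightarrow> (F has_real_derivative f t) (at t)"
    and int: "integrable lborel f" and lim: "(F \<longlongrightarrow> L) at_top"
  shows "(\<integral>t. indicator {c..} t * f t \<partial>lborel) = L - F c"
proof -
  have int': "integrable lborel (\<lambda>t. indicator {c..} t *\<^sub>R f t)"
    using int by (intro integrable_mult_indicator) auto
  have "((\<lambda>y. \<integral>t. indicator {..y} t *\<^sub>R (indicator {c..} t *\<^sub>R f t) \<partial>lborel) \<longlongrightarrow>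
      (\<integral>t. indicator {c..} t *\<^sub>R f t \<partial>lborel)) at_top"
    by (rule tendsto_integral_at_top[OF _ int']) simp
  moreover have "(\<integral>t. indicator {..y} t *\<^sub>R (indicator {c..} t *\<^sub>R f t) \<partial>lborel) = F y - F c" if "c \<le> y" for y
  proof -
    have si: "set_integrable lborel {c..y} f"
      unfolding set_integrable_def using int by (intro integrable_mult_indicator) auto
    have "(f has_integral (F y - F c)) {c..y}"
      using der that
      by (intro fundamental_theorem_of_calculus_interior_strong[OF S])
        (auto simp: has_real_derivative_iff_has_vector_derivative[symmetric] intro: continuous_on_subset[OF cont])
    then have "(LINT t:{c..y}|lborel. f t) = F y - F c"
      using set_borel_integral_eq_integral(2)[OF si] by (simp add: integral_unique)
    moreover have "(\<integral>t. indicator {..y} t *\<^sub>R (indicator {c..} t *\<^sub>R f t) \<partial>lborel) = (LINT t:{c..y}|lborel. f t)"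
      unfolding set_lebesgue_integral_def
      by (intro Bochner_Integration.integral_cong) (auto simp: indicator_def)
    ultimately show ?thesis by simp
  qed
  then have ev: "eventually (\<lambda>y. (\<integral>t. indicator {..y} t *\<^sub>R (indicator {c..} t *\<^sub>R f t) \<partial>lborel) = F y - F c) at_top"
    by (intro eventually_mono[OF eventually_ge_at_top[of c]])
  ultimately have "((\<lambda>y. F y - F c) \<longlongrightarrow> (\<integral>t. indicator {c..} t *\<^sub>R f t \<partial>lborel)) at_top"
    using tendsto_cong[OF ev] by simp
  moreover have "((\<lambda>y. F y - F c) \<longlongrightarrow> L - F c) at_top"
    by (intro tendsto_intros lim)
  ultimately show ?thesis
    using tendsto_unique[of "at_top :: real filter"] by fastforce
qed

text \<open>The distributional derivative of sgn is twice the Dirac mass, so integration against it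
  undoes a derivative. The two half-lines contribute \<open>L - F c\<close> and
  \<open>L + F c\<close> with opposite signs, and the opposite limits make \<open>L\<close> cancel.
  The finite set \<open>S\<close> leaves room for a point where \<open>F\<close> is merely
  continuous, namely the zero of \<psi> in \<open>picone\<close>.\<close>

lemma integral_sgn_deriv:
  fixes F f :: "real \<Rightarrow> real"
  assumes S: "finite S" and cont: "continuous_on UNIV F"
    and der: "\<And>t. t \<notin> S \<Longrightarrow> (F has_real_derivative f t) (at t)"
    and int: "integrable lborel f"
    and top: "(F \<longlongrightarrow> L) at_top" and bot: "(F \<longlongrightarrow> - L) at_bot"
  shows "(\<integral>t. sgn (t - c) * f t \<partial>lborel) = - 2 * F c"
proof -
  have fm[measurable]: "f \<in> borel_measurable borel" using int by auto
  have i1: "integrable lborel (\<lambda>t. indicator {c..} t * f t)"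
    using int integrable_mult_indicator[of "{c..}" lborel f] by simp
  have i2: "integrable lborel (\<lambda>t. indicator {..c} t * f t)"
    using int integrable_mult_indicator[of "{..c}" lborel f] by simp
  have A: "(\<integral>t. indicator {c..} t * f t \<partial>lborel) = L - F c"
    by (rule integral_sgn_deriv_top[OF S cont der int top])
  \<comment> \<open>The lower half-line is the upper half-line of the reflected function
    \<open>\<lambda>t. F (- t)\<close>, whose limit at the top is \<open>- L\<close>.\<close>
  have "(\<integral>t. indicator {-c..} t * (- f (- t)) \<partial>lborel) = (- L) - F (- (- c))"
  proof (rule integral_sgn_deriv_top)
    show "finite (uminus ` S)" using S by simp
    show "continuous_on UNIV (\<lambda>t. F (- t))"
      using continuous_on_compose2[OF cont, of UNIV uminus] by (simp add: continuous_on_minus)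
    show "((\<lambda>t. F (- t)) has_real_derivative - f (- t)) (at t)" if "t \<notin> uminus ` S" for t
    proof -
      have "- t \<notin> S" using that by (metis image_eqI minus_minus)
      from der[OF this] show ?thesis by (simp add: DERIV_mirror)
    qed
    show "integrable lborel (\<lambda>t. - f (- t))"
      using lborel_integrable_real_affine[OF int, of "-1" 0] by simp
    show "((\<lambda>t. F (- t)) \<longlongrightarrow> - L) at_top"
      using bot by (simp add: filterlim_at_bot_mirror)
  qed
  moreover have "(\<integral>t. indicator {..c} t * f t \<partial>lborel) = (\<integral>t. indicator {-c..} t * f (- t) \<partial>lborel)"
    by (subst lborel_integral_real_affine[of "-1" _ 0])
      (auto intro!: Bochner_Integration.integral_cong simp: indicator_def)
  ultimately have B: "(\<integral>t. indicator {..c} t * f t \<partial>lborel) = L + F c"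
    by simp
  have "(\<integral>t. sgn (t - c) * f t \<partial>lborel) = (\<integral>t. indicator {c..} t * f t - indicator {..c} t * f t \<partial>lborel)"
  proof (rule integral_cong_AE)
    show "AE t in lborel. sgn (t - c) * f t = indicator {c..} t * f t - indicator {..c} t * f t"
      using AE_lborel_singleton[of c] by eventually_elim (auto simp: indicator_def sgn_if)
  qed auto
  also have "\<dots> = (L - F c) - (L + F c)"
    using i1 i2 A B by simp
  finally show ?thesis by simp
qed

lemma integrable_product_pair:
  fixes f g :: "real \<Rightarrow> real"
  assumes f: "integrable lborel f" and g: "integrable lborel g"
  shows "integrable (lborel \<Otimes>\<^sub>M lborel) (\<lambda>(x, y). f x * g y)"
proof (rule lborel_pair.Fubini_integrable)
  have [measurable]: "f \<in> borel_measurable borel" "g \<in> borel_measurable borel" using f g by auto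
  show "(\<lambda>(x, y). f x * g y) \<in> borel_measurable (lborel \<Otimes>\<^sub>M lborel)" by measurable
  show "integrable lborel (\<lambda>x. \<integral>y. norm (case (x, y) of (x, y) \<Rightarrow> f x * g y) \<partial>lborel)"
    using f by (simp add: abs_mult)
  show "AE x in lborel. integrable lborel (\<lambda>y. case (x, y) of (x, y) \<Rightarrow> f x * g y)"
    using g by simp
qed

text \<open>Splitting off the constant leaves \<open>a + (b + a * c) / (t - c)\<close>. Since the
  filter may tend to infinity in either direction, one lemma serves both ends; the factor
  \<open>1 * t\<close> matches the shape of \<psi> in \<open>picone\<close> for
  \<open>b = 1\<close>.\<close>

lemma tendsto_linear_fraction:
  fixes a b c :: real
  assumes "filterlim (\<lambda>t. t) at_infinity F"
  shows "((\<lambda>t. (a * t + b) / (- c + 1 * t)) \<longlongrightarrow> a) F"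
proof -
  have inf: "filterlim (\<lambda>t. - c + 1 * t) at_infinity F"
    using tendsto_add_filterlim_at_infinity[OF tendsto_const assms, of "- c"] by simp
  have "((\<lambda>t. a + (b + a * c) / (- c + 1 * t)) \<longlongrightarrow> a + 0) F"
    by (intro tendsto_add tendsto_const tendsto_divide_0[OF tendsto_const inf])
  moreover have "eventually (\<lambda>t. a + (b + a * c) / (- c + 1 * t) = (a * t + b) / (- c + 1 * t)) F"
    using filterlim_at_infinity_imp_eventually_ne[OF inf, of 0]
    by eventually_elim (simp add: field_simps)
  ultimately show ?thesis by (simp add: Lim_transform_eventually)
qed

text \<open>
  In slope coordinates \<open>u = r (1, t)\<close> the norm \<open>N\<close> is determined by its values \<open>pot t\<close> at \<open>(1, t)\<close>, the area
  of its unit ball is \<open>\<integral> 1 / pot\<^sup>2\<close>, and \<open>pot'' = 2 h\<close> holds only in the weak sense, which the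
  lemma \<open>integral_sgn_deriv\<close> replaces by an application of Fubini's theorem.
\<close>

locale moment_weight =
  fixes h :: "real \<Rightarrow> real"
  assumes nonneg: "\<And>t. 0 \<le> h t"
    and int0: "integrable lborel h"
    and int1: "integrable lborel (\<lambda>t. t * h t)"
    and mass_pos: "0 < (\<integral>t. h t \<partial>lborel)"
begin

definition mass :: real where "mass = (\<integral>t. h t \<partial>lborel)"
definition pot :: "real \<Rightarrow> real" where "pot t = (\<integral>s. \<bar>t - s\<bar> * h s \<partial>lborel)"
definition pot' :: "real \<Rightarrow> real" where "pot' t = (\<integral>s. sgn (t - s) * h s \<partial>lborel)"

section \<open>Differentiability and growth of the potential\<close>

lemma h_measurable[measurable]: "h \<in> borel_measurable borel"
  using int0 by auto

lemma mass_gt0: "0 < mass" using mass_pos by (simp add: mass_def)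

lemma int_abs1: "integrable lborel (\<lambda>t. \<bar>t\<bar> * h t)"
  using integrable_abs[OF int1] nonneg by (simp add: abs_mult)

lemma int_pot: "integrable lborel (\<lambda>s. \<bar>t - s\<bar> * h s)"
proof (rule Bochner_Integration.integrable_bound)
  show "integrable lborel (\<lambda>s. \<bar>t\<bar> * h s + \<bar>s\<bar> * h s)"
    using int0 int_abs1 by auto
  show "AE s in lborel. norm (\<bar>t - s\<bar> * h s) \<le> norm (\<bar>t\<bar> * h s + \<bar>s\<bar> * h s)"
  proof (rule AE_I2)
    fix s
    have "\<bar>t - s\<bar> * h s \<le> (\<bar>t\<bar> + \<bar>s\<bar>) * h s" using nonneg[of s] by (intro mult_right_mono) auto
    then show "norm (\<bar>t - s\<bar> * h s) \<le> norm (\<bar>t\<bar> * h s + \<bar>s\<bar> * h s)"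
      using nonneg[of s] by (simp add: abs_mult algebra_simps)
  qed
qed simp

lemma int_sgn:
  assumes "integrable lborel f"
  shows "integrable lborel (\<lambda>s. sgn (t - s) * (f s :: real))"
proof (rule Bochner_Integration.integrable_bound[OF assms])
  have [measurable]: "f \<in> borel_measurable borel" using assms by auto
  show "(\<lambda>s. sgn (t - s) * f s) \<in> borel_measurable lborel" by measurable
  show "AE s in lborel. norm (sgn (t - s) * f s) \<le> norm (f s)"
    by (auto simp: abs_mult sgn_if)
qed

text \<open>The difference quotients of the absolute value are bounded by 1, so \<open>h\<close>
  itself dominates; the kink at \<open>s = t\<close> is a null set. Thus integrability of
  \<open>h\<close> suffices for a first derivative, although a second one exists only
  weakly.\<close>

lemma DERIV_pot: "(pot has_real_derivative pot' t) (at t)"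
  unfolding has_field_derivative_iff tendsto_at_iff_sequentially
proof (intro allI impI)
  fix X :: "nat \<Rightarrow> real" assume X: "\<forall>i. X i \<in> UNIV - {t}" and lim: "X \<longlonglongrightarrow> t"
  have eq: "(pot (X n) - pot t) / (X n - t) = (\<integral>s. (\<bar>X n - s\<bar> - \<bar>t - s\<bar>) / (X n - t) * h s \<partial>lborel)" for n
  proof -
    have "pot (X n) - pot t = (\<integral>s. \<bar>X n - s\<bar> * h s - \<bar>t - s\<bar> * h s \<partial>lborel)"
      unfolding pot_def using int_pot by (simp add: Bochner_Integration.integral_diff)
    then show ?thesis
      by (simp flip: integral_divide_zero) (simp add: field_simps diff_divide_distrib)
  qed
  have "(\<lambda>n. \<integral>s. (\<bar>X n - s\<bar> - \<bar>t - s\<bar>) / (X n - t) * h s \<partial>lborel) \<longlonglongrightarrow> pot' t"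
    unfolding pot'_def
  proof (rule integral_dominated_convergence)
    show "integrable lborel h" by (rule int0)
    show "AE s in lborel. norm ((\<bar>X n - s\<bar> - \<bar>t - s\<bar>) / (X n - t) * h s) \<le> h s" for n
    proof (rule AE_I2)
      fix s
      have "\<bar>(\<bar>X n - s\<bar> - \<bar>t - s\<bar>) / (X n - t)\<bar> \<le> 1"
        using X by (auto simp: abs_divide divide_le_eq)
      then show "norm ((\<bar>X n - s\<bar> - \<bar>t - s\<bar>) / (X n - t) * h s) \<le> h s"
        using mult_right_mono[of "\<bar>(\<bar>X n - s\<bar> - \<bar>t - s\<bar>) / (X n - t)\<bar>" 1 "h s"] nonneg[of s]
        by (simp only: real_norm_def abs_mult) simp
    qed
    show "AE s in lborel. (\<lambda>n. (\<bar>X n - s\<bar> - \<bar>t - s\<bar>) / (X n - t) * h s) \<longlonglongrightarrow> sgn (t - s) * h s"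
      using AE_lborel_singleton[of t]
    proof eventually_elim
      fix s assume "s \<noteq> t"
      have "((\<lambda>x. \<bar>x - s\<bar>) has_real_derivative sgn (t - s)) (at t)"
      proof (cases "s < t")
        case True
        have "((\<lambda>x. x - s) has_real_derivative 1) (at t)" by (auto intro!: derivative_eq_intros)
        then show ?thesis
          using has_field_derivative_transform_within_open[of "\<lambda>x. x - s" 1 t "{s<..}" "\<lambda>x. \<bar>x - s\<bar>"] True
          by simp
      next
        case False
        have "((\<lambda>x. s - x) has_real_derivative - 1) (at t)" by (auto intro!: derivative_eq_intros)
        then show ?thesis
          using has_field_derivative_transform_within_open[of "\<lambda>x. s - x" "- 1" t "{..<s}" "\<lambda>x. \<bar>x - s\<bar>"]
            False \<open>s \<noteq> t\<close>
          by simp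
      qed
      then have "(\<lambda>n. (\<bar>X n - s\<bar> - \<bar>t - s\<bar>) / (X n - t)) \<longlonglongrightarrow> sgn (t - s)"
        unfolding has_field_derivative_iff tendsto_at_iff_sequentially comp_def
        using X lim by blast
      then show "(\<lambda>n. (\<bar>X n - s\<bar> - \<bar>t - s\<bar>) / (X n - t) * h s) \<longlonglongrightarrow> sgn (t - s) * h s"
        by (intro tendsto_intros)
    qed
  qed auto
  then show "((\<lambda>y. (pot y - pot t) / (y - t)) \<circ> X) \<longlonglongrightarrow> pot' t"
    unfolding comp_def eq .
qed

lemma isCont_pot: "isCont pot t"
  using DERIV_pot DERIV_isCont by blast

lemma pot_measurable[measurable]: "pot \<in> borel_measurable borel"
  by (intro borel_measurable_continuous_onI continuous_at_imp_continuous_on ballI isCont_pot)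

lemma pot_lipschitz: "pot t \<le> pot s + mass * \<bar>t - s\<bar>"
proof -
  have "pot t \<le> (\<integral>r. \<bar>s - r\<bar> * h r + \<bar>t - s\<bar> * h r \<partial>lborel)"
    unfolding pot_def
  proof (intro integral_mono int_pot Bochner_Integration.integrable_add)
    show "integrable lborel (\<lambda>r. \<bar>t - s\<bar> * h r)" using int0 by simp
    fix r
    have "\<bar>t - r\<bar> * h r \<le> (\<bar>s - r\<bar> + \<bar>t - s\<bar>) * h r"
      using nonneg[of r] by (intro mult_right_mono) auto
    then show "\<bar>t - r\<bar> * h r \<le> \<bar>s - r\<bar> * h r + \<bar>t - s\<bar> * h r" by (simp add: algebra_simps)
  qed
  also have "\<dots> = pot s + mass * \<bar>t - s\<bar>"
    unfolding pot_def mass_def using int_pot int0 by simp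
  finally show ?thesis .
qed

text \<open>With the Lipschitz bound at 0 this pins the growth of \<open>pot\<close> to
  \<open>mass * \<bar>t\<bar>\<close> at both ends. Geometrically \<open>mass\<close> is the value
  of the norm \<open>N\<close> at the vertical unit vector, the direction that has no slope.\<close>

lemma pot_ge: "mass * \<bar>t\<bar> - pot 0 \<le> pot t"
proof -
  have "mass * \<bar>t\<bar> - pot 0 = (\<integral>r. \<bar>t\<bar> * h r - \<bar>0 - r\<bar> * h r \<partial>lborel)"
    unfolding pot_def mass_def using int_pot[of 0] int0 by simp
  also have "\<dots> \<le> pot t" unfolding pot_def
  proof (intro integral_mono int_pot Bochner_Integration.integrable_diff)
    show "integrable lborel (\<lambda>r. \<bar>t\<bar> * h r)" using int0 by simp
    fix r
    have "(\<bar>t\<bar> - \<bar>0 - r\<bar>) * h r \<le> \<bar>t - r\<bar> * h r"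
      using nonneg[of r] by (intro mult_right_mono) auto
    then show "\<bar>t\<bar> * h r - \<bar>0 - r\<bar> * h r \<le> \<bar>t - r\<bar> * h r" by (simp add: algebra_simps)
  qed
  finally show ?thesis .
qed

lemma pot_pos: "0 < pot t"
proof -
  have "0 \<le> pot t" unfolding pot_def using nonneg by (intro Bochner_Integration.integral_nonneg) auto
  moreover have "pot t \<noteq> 0"
  proof
    assume "pot t = 0"
    then have "AE s in lborel. \<bar>t - s\<bar> * h s = 0"
      unfolding pot_def using int_pot nonneg
      by (subst (asm) integral_nonneg_eq_0_iff_AE) auto
    then have "AE s in lborel. h s = 0"
      using AE_lborel_singleton[of t] by eventually_elim auto
    then have "mass = 0" unfolding mass_def by (intro integral_eq_zero_AE)
    then show False using mass_gt0 by simp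
  qed
  ultimately show ?thesis by simp
qed

text \<open>Comparison of \<open>N\<close> with the Euclidean norm, since (1, t) has squared length
  1 + t^2: compactness settles bounded slopes, linear growth the others. It bounds 1 / pot^2 by a
  multiple of the derivative of arctan, from which all later tail estimates follow.\<close>

lemma pot_ge_sqrt: obtains c where "0 < c" "\<And>t. c * (1 + t\<^sup>2) \<le> (pot t)\<^sup>2"
proof -
  \<comment> \<open>Beyond \<open>R\<close> the subtracted term in \<open>pot_ge\<close> is at most
    half of \<open>mass * \<bar>t\<bar>\<close>; the summand 1 makes room for strict
    positivity.\<close>
  define R where "R = 2 * pot 0 / mass + 1"
  have "R > 0" unfolding R_def using mass_gt0 pot_pos[of 0] by (simp add: add_nonneg_pos)
  have "continuous_on {-R..R} pot"
    using isCont_pot by (simp add: continuous_at_imp_continuous_on)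
  then obtain t0 where t0: "\<And>t. t \<in> {-R..R} \<Longrightarrow> pot t0 \<le> pot t"
    using continuous_attains_inf[of "{-R..R}" pot] \<open>R > 0\<close> by fastforce
  \<comment> \<open>The second entry works for large slopes because t^2 / (1 + t^2) is at least its
    value at \<open>R\<close>.\<close>
  define c where "c = min ((pot t0)\<^sup>2 / (1 + R\<^sup>2)) (mass\<^sup>2 / 4 * (R\<^sup>2 / (1 + R\<^sup>2)))"
  have "c > 0" unfolding c_def using pot_pos[of t0] mass_gt0 \<open>R > 0\<close>
    by (auto simp: add_pos_nonneg intro!: divide_pos_pos mult_pos_pos)
  moreover have "c * (1 + t\<^sup>2) \<le> (pot t)\<^sup>2" for t
  proof (cases "t \<in> {-R..R}")
    case True
    then have "\<bar>t\<bar> \<le> R" by auto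
    then have "t\<^sup>2 \<le> R\<^sup>2" using abs_le_square_iff[of t R] by simp
    have "c * (1 + t\<^sup>2) \<le> (pot t0)\<^sup>2 / (1 + R\<^sup>2) * (1 + R\<^sup>2)"
      using \<open>t\<^sup>2 \<le> R\<^sup>2\<close> \<open>c > 0\<close> by (intro mult_mono) (auto simp: c_def)
    also have "\<dots> = (pot t0)\<^sup>2" by (simp add: add_pos_nonneg less_imp_neq[THEN not_sym])
    also have "\<dots> \<le> (pot t)\<^sup>2" using t0[OF True] pot_pos[of t0] by (intro power_mono) auto
    finally show ?thesis .
  next
    case False
    then have tR: "\<bar>t\<bar> > R" by auto
    then have t2: "R\<^sup>2 \<le> t\<^sup>2" using abs_le_square_iff[of R t] \<open>R > 0\<close> by simp
    have "pot 0 \<le> mass * R / 2" using mass_gt0 by (simp add: R_def field_simps)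
    also have "\<dots> \<le> mass * \<bar>t\<bar> / 2" using tR mass_gt0 by (simp add: field_simps)
    finally have "mass * \<bar>t\<bar> / 2 \<le> pot t" using pot_ge[of t] by linarith
    then have "(mass * \<bar>t\<bar> / 2)\<^sup>2 \<le> (pot t)\<^sup>2" using mass_gt0 by (intro power_mono) auto
    then have *: "mass\<^sup>2 / 4 * t\<^sup>2 \<le> (pot t)\<^sup>2" by (simp add: power_mult_distrib power_divide)
    have "R\<^sup>2 / (1 + R\<^sup>2) * (1 + t\<^sup>2) \<le> t\<^sup>2"
      using t2 by (simp add: divide_simps add_pos_nonneg) (simp add: algebra_simps add_nonneg_eq_0_iff)
    then have "mass\<^sup>2 / 4 * (R\<^sup>2 / (1 + R\<^sup>2) * (1 + t\<^sup>2)) \<le> mass\<^sup>2 / 4 * t\<^sup>2"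
      by (intro mult_left_mono) auto
    moreover have "c * (1 + t\<^sup>2) \<le> mass\<^sup>2 / 4 * (R\<^sup>2 / (1 + R\<^sup>2)) * (1 + t\<^sup>2)"
      by (intro mult_right_mono) (auto simp: c_def)
    ultimately show ?thesis using * unfolding mult.assoc by linarith
  qed
  ultimately show ?thesis using that by blast
qed

lemma integrable_inverse_pot: "integrable lborel (\<lambda>t. 1 / (pot t)\<^sup>2)"
proof -
  obtain c where c: "0 < c" "\<And>t. c * (1 + t\<^sup>2) \<le> (pot t)\<^sup>2" using pot_ge_sqrt by blast
  have "integrable lborel (\<lambda>t::real. inverse (1 + t\<^sup>2))"
    using integrable_inverse_1_plus_square unfolding set_integrable_def by simp
  then have "integrable lborel (\<lambda>t::real. 1 / c * inverse (1 + t\<^sup>2))" by simp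
  then show ?thesis
  proof (rule Bochner_Integration.integrable_bound)
    show "AE t in lborel. norm (1 / (pot t)\<^sup>2) \<le> norm (1 / c * inverse (1 + t\<^sup>2))"
    proof (rule AE_I2)
      fix t
      have "1 / (pot t)\<^sup>2 \<le> 1 / (c * (1 + t\<^sup>2))"
        using c(1) c(2)[of t] pot_pos[of t]
        by (intro divide_left_mono) (auto simp: add_pos_nonneg intro!: mult_pos_pos)
      then show "norm (1 / (pot t)\<^sup>2) \<le> norm (1 / c * inverse (1 + t\<^sup>2))"
        using c(1) by (simp add: divide_inverse abs_mult)
    qed
  qed simp
qed

text \<open>
  With the Wronskian \<open>W = pot' \<psi> - pot \<psi>'\<close>, \<open>k = g pot / \<psi>\<close> and \<open>\<eta> = pot g\<^sup>2 / \<psi>\<close>, Picone's identity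
  reads \<open>- \<eta>' W = (pot g')\<^sup>2 - (pot g' + k W / pot)\<^sup>2\<close>. At the zero of \<open>\<psi>\<close> the junk value \<open>\<eta> = 0\<close>
  is the correct limit. The opposite limits of \<open>\<eta>\<close> make the boundary terms cancel.
\<close>

lemma picone:
  fixes a b \<alpha> K L :: real and g g' :: "real \<Rightarrow> real"
  defines "\<psi> \<equiv> \<lambda>t. a + b * t"
  assumes nz: "a \<noteq> 0 \<or> b \<noteq> 0"
    and dg: "\<And>t. (g has_real_derivative g' t) (at t)"
    and g'm[measurable]: "g' \<in> borel_measurable borel"
    and g1: "\<And>t. \<bar>g t\<bar> \<le> 1"
    and g'b: "\<And>t. \<bar>g' t\<bar> \<le> \<alpha> / (pot t)\<^sup>2"
    and kb: "\<And>t. \<bar>g t\<bar> * pot t \<le> K * \<bar>\<psi> t\<bar>"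
    and top: "((\<lambda>t. pot t * (g t)\<^sup>2 / \<psi> t) \<longlongrightarrow> L) at_top"
    and bot: "((\<lambda>t. pot t * (g t)\<^sup>2 / \<psi> t) \<longlongrightarrow> - L) at_bot"
  shows "integrable lborel (\<lambda>t. h t * pot t * (g t)\<^sup>2)"
    and "integrable lborel (\<lambda>t. (pot t)\<^sup>2 * (g' t)\<^sup>2)"
    and "2 * (\<integral>t. h t * pot t * (g t)\<^sup>2 \<partial>lborel) \<le> (\<integral>t. (pot t)\<^sup>2 * (g' t)\<^sup>2 \<partial>lborel)"
proof -
  note int_inv = integrable_inverse_pot
  have gcont: "isCont g t" for t using dg DERIV_isCont by blast
  have gm[measurable]: "g \<in> borel_measurable borel"
    by (intro borel_measurable_continuous_onI continuous_at_imp_continuous_on ballI gcont)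
  have \<psi>m[measurable]: "\<psi> \<in> borel_measurable borel" unfolding \<psi>_def by measurable
  have \<alpha>0: "0 \<le> \<alpha>" using g'b[of 0] pot_pos[of 0] abs_ge_zero[of "g' 0"]
    by (metis abs_ge_zero order_trans zero_le_divide_iff zero_less_power not_less zero_le_power2)
  have int\<psi>h: "integrable lborel (\<lambda>s. \<psi> s * h s)"
    using int0 int1 unfolding \<psi>_def by (simp add: distrib_right mult.assoc)
  \<comment> \<open>This is the Wronskian in integrated form: since \<psi> is affine, its derivative
    is formally pot'' \<psi> = 2 h \<psi>. The integral form is bounded and needs no derivative of
    \<open>pot'\<close>; \<open>W_eq\<close> identifies it with the usual expression.\<close>
  define W where "W t = (\<integral>s. sgn (t - s) * (\<psi> s * h s) \<partial>lborel)" for t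
  define B where "B = (\<integral>s. \<bar>\<psi> s * h s\<bar> \<partial>lborel)"
  have W_bound: "\<bar>W t\<bar> \<le> B" for t
  proof -
    have "\<bar>W t\<bar> \<le> (\<integral>s. \<bar>sgn (t - s) * (\<psi> s * h s)\<bar> \<partial>lborel)"
      unfolding W_def by (rule integral_abs_bound)
    also have "\<dots> \<le> B"
      unfolding B_def
      by (intro integral_mono[OF integrable_abs[OF int_sgn[OF int\<psi>h]] integrable_abs[OF int\<psi>h]])
        (auto simp: abs_mult sgn_if)
    finally show ?thesis .
  qed
  have W_eq: "W t = pot' t * \<psi> t - pot t * b" for t
  proof -
    have "sgn (t - s) * (\<psi> s * h s) = \<psi> t * (sgn (t - s) * h s) - b * (\<bar>t - s\<bar> * h s)" for s
      by (auto simp: sgn_if \<psi>_def algebra_simps)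
    then show ?thesis
      unfolding W_def pot_def pot'_def using int_sgn[OF int0, of t] int_pot[of t]
      by (simp add: mult.commute)
  qed
  have Wm[measurable]: "W \<in> borel_measurable borel"
    unfolding W_def by measurable
  \<comment> \<open>The hypothesis \<open>kb\<close> keeps this quotient bounded across the zero of
    \<psi>, where division by zero makes it 0. Factoring \<eta> as \<open>k t * g t\<close> then
    reduces its continuity there to that of \<open>g\<close>.\<close>
  define k where "k t = g t * pot t / \<psi> t" for t
  have km[measurable]: "k \<in> borel_measurable borel" unfolding k_def by measurable
  define K' where "K' = max K 0"
  have k_bound: "\<bar>k t\<bar> \<le> K'" for t
    using kb[of t] pot_pos[of t] by (cases "\<psi> t = 0") (auto simp: k_def K'_def abs_mult divide_le_eq le_max_iff_disj)
  have g0: "g t = 0" if "\<psi> t = 0" for t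
    using kb[of t] pot_pos[of t] that by (auto simp: mult_le_0_iff)
  define \<eta> where "\<eta> t = pot t * (g t)\<^sup>2 / \<psi> t" for t
  define \<eta>' where "\<eta>' t = 2 * k t * g' t + (k t)\<^sup>2 * W t / (pot t)\<^sup>2" for t
  have \<eta>'m[measurable]: "\<eta>' \<in> borel_measurable borel" unfolding \<eta>'_def by measurable
  have \<eta>_k: "\<eta> t = k t * g t" for t by (simp add: \<eta>_def k_def power2_eq_square)
  have d\<eta>: "(\<eta> has_real_derivative \<eta>' t) (at t)" if "\<psi> t \<noteq> 0" for t
  proof -
    have d\<psi>: "(\<psi> has_real_derivative b) (at t)"
      unfolding \<psi>_def by (auto intro!: derivative_eq_intros)
    have "(\<eta> has_real_derivative
       ((pot' t * (g t)\<^sup>2 + pot t * (2 * g t * g' t)) * \<psi> t - (pot t * (g t)\<^sup>2) * b) / (\<psi> t * \<psi> t)) (at t)"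
      unfolding \<eta>_def using that
      by (auto intro!: derivative_eq_intros DERIV_pot dg d\<psi> simp: algebra_simps)
    moreover have "((pot' t * (g t)\<^sup>2 + pot t * (2 * g t * g' t)) * \<psi> t - (pot t * (g t)\<^sup>2) * b) / (\<psi> t * \<psi> t) = \<eta>' t"
      unfolding \<eta>'_def k_def W_eq using that pot_pos[of t]
      by (simp add: field_simps power2_eq_square)
    ultimately show ?thesis by simp
  qed
  have fin: "finite {t. \<psi> t = 0}"
  proof (cases "b = 0")
    case True then show ?thesis using nz by (simp add: \<psi>_def)
  next
    case False
    then have "{t. \<psi> t = 0} \<subseteq> {- a / b}" by (auto simp: \<psi>_def field_simps)
    then show ?thesis using finite_subset by blast
  qed
  have \<eta>cont: "isCont \<eta> t" for t
  proof (cases "\<psi> t = 0")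
    case False then show ?thesis using d\<eta> DERIV_isCont by blast
  next
    case True
    have "((\<lambda>s. K' * \<bar>g s\<bar>) \<longlongrightarrow> K' * \<bar>g t\<bar>) (at t)"
      using gcont[of t] unfolding isCont_def by (intro tendsto_intros)
    then have "((\<lambda>s. K' * \<bar>g s\<bar>) \<longlongrightarrow> 0) (at t)" using g0[OF True] by simp
    moreover have "norm (\<eta> s) \<le> K' * \<bar>g s\<bar>" for s
      unfolding \<eta>_k using k_bound[of s] by (simp add: abs_mult mult_right_mono)
    ultimately have "(\<eta> \<longlongrightarrow> 0) (at t)"
      by (intro Lim_null_comparison[of \<eta> "\<lambda>s. K' * \<bar>g s\<bar>"]) auto
    then show ?thesis unfolding isCont_def using True by (simp add: \<eta>_def)
  qed
  have \<eta>'_bound: "\<bar>\<eta>' t\<bar> \<le> (2 * K' * \<alpha> + K'\<^sup>2 * B) * (1 / (pot t)\<^sup>2)" for t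
  proof -
    have "\<bar>2 * k t * g' t\<bar> \<le> 2 * K' * (\<alpha> / (pot t)\<^sup>2)"
      using mult_mono'[OF k_bound[of t] g'b[of t]] by (simp add: abs_mult)
    moreover have "\<bar>(k t)\<^sup>2 * W t / (pot t)\<^sup>2\<bar> \<le> K'\<^sup>2 * B / (pot t)\<^sup>2"
    proof -
      have "(k t)\<^sup>2 \<le> K'\<^sup>2" using k_bound[of t] by (simp add: abs_le_square_iff[symmetric] K'_def)
      then have "(k t)\<^sup>2 * \<bar>W t\<bar> \<le> K'\<^sup>2 * B" using W_bound[of t] by (intro mult_mono) auto
      then show ?thesis by (simp add: abs_mult divide_right_mono)
    qed
    ultimately have "\<bar>\<eta>' t\<bar> \<le> 2 * K' * (\<alpha> / (pot t)\<^sup>2) + K'\<^sup>2 * B / (pot t)\<^sup>2"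
      unfolding \<eta>'_def by linarith
    then show ?thesis by (simp add: add_divide_distrib)
  qed
  have int\<eta>': "integrable lborel \<eta>'"
  proof (rule Bochner_Integration.integrable_bound)
    show "integrable lborel (\<lambda>t. (2 * K' * \<alpha> + K'\<^sup>2 * B) * (1 / (pot t)\<^sup>2))"
      by (intro integrable_mult_right int_inv)
    show "AE t in lborel. norm (\<eta>' t) \<le> norm ((2 * K' * \<alpha> + K'\<^sup>2 * B) * (1 / (pot t)\<^sup>2))"
      using order_trans[OF \<eta>'_bound abs_ge_self] by (intro AE_I2) (simp only: real_norm_def)
  qed simp
  have key: "(\<integral>t. sgn (t - s) * \<eta>' t \<partial>lborel) = - 2 * \<eta> s" for s
  proof (rule integral_sgn_deriv[OF fin])
    show "continuous_on UNIV \<eta>" using \<eta>cont by (simp add: continuous_at_imp_continuous_on)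
    show "(\<eta> \<longlongrightarrow> L) at_top" "(\<eta> \<longlongrightarrow> - L) at_bot" using top bot unfolding \<eta>_def by auto
  qed (use d\<eta> int\<eta>' in auto)
  show inth: "integrable lborel (\<lambda>t. h t * pot t * (g t)\<^sup>2)"
  proof (rule Bochner_Integration.integrable_bound)
    show "integrable lborel (\<lambda>t. K' * \<bar>\<psi> t * h t\<bar>)" using int\<psi>h by simp
    show "AE t in lborel. norm (h t * pot t * (g t)\<^sup>2) \<le> norm (K' * \<bar>\<psi> t * h t\<bar>)"
    proof (rule AE_I2)
      fix t
      have "\<bar>g t\<bar> * (\<bar>g t\<bar> * pot t) \<le> 1 * (K' * \<bar>\<psi> t\<bar>)"
      proof (rule mult_mono[OF g1])
        show "\<bar>g t\<bar> * pot t \<le> K' * \<bar>\<psi> t\<bar>"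
          using kb[of t] by (rule order_trans) (simp add: K'_def mult_right_mono)
      qed (use pot_pos[of t] in auto)
      then have "pot t * (g t)\<^sup>2 \<le> K' * \<bar>\<psi> t\<bar>"
        by (simp add: power2_eq_square algebra_simps abs_mult_self_eq flip: abs_mult)
      then have "h t * (pot t * (g t)\<^sup>2) \<le> h t * (K' * \<bar>\<psi> t\<bar>)" using nonneg by (intro mult_left_mono)
      then show "norm (h t * pot t * (g t)\<^sup>2) \<le> norm (K' * \<bar>\<psi> t * h t\<bar>)"
        using nonneg[of t] pot_pos[of t] by (simp add: abs_mult K'_def algebra_simps)
    qed
  qed simp
  have int2: "integrable (lborel \<Otimes>\<^sub>M lborel) (\<lambda>(s, t). sgn (t - s) * \<eta>' t * (\<psi> s * h s))"
  proof (rule Bochner_Integration.integrable_bound[OF integrable_product_pair[OF int\<psi>h int\<eta>']])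
    show "AE x in lborel \<Otimes>\<^sub>M lborel. norm (case x of (s, t) \<Rightarrow> sgn (t - s) * \<eta>' t * (\<psi> s * h s))
       \<le> norm (case x of (s, t) \<Rightarrow> \<psi> s * h s * \<eta>' t)"
      by (auto simp: abs_mult sgn_if split: prod.splits)
  qed measurable
  show intg: "integrable lborel (\<lambda>t. (pot t)\<^sup>2 * (g' t)\<^sup>2)"
  proof (rule Bochner_Integration.integrable_bound)
    show "integrable lborel (\<lambda>t. \<alpha>\<^sup>2 * (1 / (pot t)\<^sup>2))" by (intro integrable_mult_right int_inv)
    show "AE t in lborel. norm ((pot t)\<^sup>2 * (g' t)\<^sup>2) \<le> norm (\<alpha>\<^sup>2 * (1 / (pot t)\<^sup>2))"
    proof (rule AE_I2)
      fix t
      have "(g' t)\<^sup>2 \<le> (\<alpha> / (pot t)\<^sup>2)\<^sup>2"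
        using g'b[of t] by (metis abs_ge_zero power2_abs power_mono)
      then have "(pot t)\<^sup>2 * (g' t)\<^sup>2 \<le> (pot t)\<^sup>2 * (\<alpha> / (pot t)\<^sup>2)\<^sup>2" by (intro mult_left_mono) auto
      also have "\<dots> = \<alpha>\<^sup>2 * (1 / (pot t)\<^sup>2)" using pot_pos[of t] by (simp add: field_simps power2_eq_square)
      finally show "norm ((pot t)\<^sup>2 * (g' t)\<^sup>2) \<le> norm (\<alpha>\<^sup>2 * (1 / (pot t)\<^sup>2))" by simp
    qed
  qed simp
  \<comment> \<open>This replaces integration by parts of \<eta> against W' = 2 \<psi> h. The
    integrand on the left is \<open>\<psi> s * h s * \<eta> s\<close>; \<open>key\<close> expresses
    \<eta> as an integral of \<eta>' against sgn, and exchanging the integrals moves the kernel onto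
    \<psi> h, which produces \<open>W\<close>.\<close>
  have "- 2 * (\<integral>t. h t * pot t * (g t)\<^sup>2 \<partial>lborel) = (\<integral>s. (\<integral>t. sgn (t - s) * \<eta>' t * (\<psi> s * h s) \<partial>lborel) \<partial>lborel)"
  proof -
    have "(\<integral>t. sgn (t - s) * \<eta>' t * (\<psi> s * h s) \<partial>lborel) = - 2 * (h s * pot s * (g s)\<^sup>2)" for s
      using key[of s] g0[of s] by (cases "\<psi> s = 0") (auto simp: \<eta>_def)
    then show ?thesis by simp
  qed
  also have "\<dots> = (\<integral>t. (\<integral>s. sgn (t - s) * \<eta>' t * (\<psi> s * h s) \<partial>lborel) \<partial>lborel)"
    using lborel_pair.Fubini_integral[OF int2] by simp
  also have "\<dots> = (\<integral>t. \<eta>' t * W t \<partial>lborel)"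
  proof (intro Bochner_Integration.integral_cong refl)
    fix t
    have "(\<lambda>s. sgn (t - s) * \<eta>' t * (\<psi> s * h s)) = (\<lambda>s. \<eta>' t * (sgn (t - s) * (\<psi> s * h s)))"
      by (simp add: fun_eq_iff)
    then show "(\<integral>s. sgn (t - s) * \<eta>' t * (\<psi> s * h s) \<partial>lborel) = \<eta>' t * W t"
      unfolding W_def by simp
  qed
  finally have eq: "2 * (\<integral>t. h t * pot t * (g t)\<^sup>2 \<partial>lborel) = (\<integral>t. - (\<eta>' t * W t) \<partial>lborel)"
    by simp
  also have "\<dots> \<le> (\<integral>t. (pot t)\<^sup>2 * (g' t)\<^sup>2 \<partial>lborel)"
  proof (rule integral_mono)
    show "integrable lborel (\<lambda>t. - (\<eta>' t * W t))"
    proof (rule Bochner_Integration.integrable_bound)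
      show "integrable lborel (\<lambda>t. B * \<eta>' t)" using int\<eta>' by simp
      show "AE t in lborel. norm (- (\<eta>' t * W t)) \<le> norm (B * \<eta>' t)"
      proof (rule AE_I2)
        fix t
        have "\<bar>W t\<bar> * \<bar>\<eta>' t\<bar> \<le> \<bar>B\<bar> * \<bar>\<eta>' t\<bar>"
          using order_trans[OF W_bound abs_ge_self] by (intro mult_right_mono) auto
        then show "norm (- (\<eta>' t * W t)) \<le> norm (B * \<eta>' t)"
          by (simp add: abs_mult mult.commute)
      qed
    qed simp
    show "integrable lborel (\<lambda>t. (pot t)\<^sup>2 * (g' t)\<^sup>2)" by (rule intg)
    fix t
    have "(pot t)\<^sup>2 * (g' t)\<^sup>2 - (pot t * g' t + k t * W t / pot t)\<^sup>2 = - (\<eta>' t * W t)"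
    proof -
      have "pot t * g' t * (k t * W t / pot t) = g' t * k t * W t" using pot_pos[of t] by simp
      then show ?thesis unfolding \<eta>'_def using pot_pos[of t]
        by (simp add: power2_sum power_mult_distrib power_divide distrib_right) (simp add: power2_eq_square)
    qed
    then show "- (\<eta>' t * W t) \<le> (pot t)\<^sup>2 * (g' t)\<^sup>2"
      using zero_le_power2[of "pot t * g' t + k t * W t / pot t"] by linarith
  qed
  finally show "2 * (\<integral>t. h t * pot t * (g t)\<^sup>2 \<partial>lborel) \<le> (\<integral>t. (pot t)\<^sup>2 * (g' t)\<^sup>2 \<partial>lborel)" .
qed

text \<open>\<open>picone\<close> is applied twice. The cosine of the rescaled area is compared with
  the solution 1 / pot, both vanishing at the infinite ends; the sine with (t - t1) / pot, both
  vanishing at the slope that halves the area. Adding the two results removes the trigonometric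
  weights on both sides and leaves 2 J \<le> \<alpha>^2 T with \<alpha> = \<pi> / T.\<close>

lemma santalo:
  shows "integrable lborel (\<lambda>t. h t * pot t)"
    and "0 < (\<integral>t. 1 / (pot t)\<^sup>2 \<partial>lborel)"
    and "(\<integral>t. h t * pot t \<partial>lborel) * (\<integral>t. 1 / (pot t)\<^sup>2 \<partial>lborel) \<le> pi\<^sup>2 / 2"
proof -
  define q where "q t = 1 / (pot t)\<^sup>2" for t
  define T where "T = (\<integral>t. q t \<partial>lborel)"
  \<comment> \<open>The area of the part of the unit ball whose points have slope at most
    \<open>t\<close>.\<close>
  define G where "G t = (\<integral>s. indicator {..t} s * q s \<partial>lborel)" for t
  have qpos: "0 < q t" for t using pot_pos[of t] by (simp add: q_def)
  have qint: "integrable lborel q" using integrable_inverse_pot unfolding q_def .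
  have qm[measurable]: "q \<in> borel_measurable borel" unfolding q_def by measurable
  have qcont: "isCont q t" for t
    unfolding q_def using pot_pos[of t] by (intro continuous_intros isCont_pot) auto
  have Tpos: "0 < T"
  proof -
    have "T \<noteq> 0"
    proof
      assume "T = 0"
      then have "AE t in lborel. q t = 0"
        unfolding T_def using qint qpos by (subst (asm) integral_nonneg_eq_0_iff_AE) (auto simp: less_imp_le)
      then have "AE t::real in lborel. False" using qpos by (simp add: less_imp_neq[THEN not_sym])
      then show False by (simp add: eventually_False ae_filter_eq_bot_iff)
    qed
    moreover have "0 \<le> T" unfolding T_def using qpos by (intro Bochner_Integration.integral_nonneg) (auto simp: less_imp_le)
    ultimately show ?thesis by simp
  qed
  then show "0 < (\<integral>t. 1 / (pot t)\<^sup>2 \<partial>lborel)" by (simp add: T_def q_def)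
  have qi: "integrable lborel (\<lambda>s. indicator A s * q s)" if "A \<in> sets borel" for A
    using integrable_mult_indicator[OF _ qint, of A] that by simp
  have Gdiff: "G y = G x + integral {x..y} q" if "x \<le> y" for x y
  proof -
    have si: "set_integrable lborel {x..y} q"
      unfolding set_integrable_def using qi[of "{x..y}"] by simp
    have "G y - G x = (\<integral>s. indicator {..y} s * q s - indicator {..x} s * q s \<partial>lborel)"
      unfolding G_def using qi by (simp add: Bochner_Integration.integral_diff)
    also have "\<dots> = (LINT s:{x..y}|lborel. q s)"
      unfolding set_lebesgue_integral_def
    proof (rule integral_cong_AE)
      show "AE s in lborel. indicator {..y} s * q s - indicator {..x} s * q s = indicator {x..y} s *\<^sub>R q s"
        using AE_lborel_singleton[of x] by eventually_elim (use that in \<open>auto simp: indicator_def\<close>)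
    qed auto
    finally show ?thesis using set_borel_integral_eq_integral(2)[OF si] by simp
  qed
  have dG: "(G has_real_derivative q t) (at t)" for t
  proof -
    have "((\<lambda>y. integral {t - 1..y} q) has_real_derivative q t) (at t within {t - 1..t + 1})"
      using qcont by (intro integral_has_real_derivative) (auto simp: continuous_at_imp_continuous_on)
    then have *: "((\<lambda>y. G (t - 1) + integral {t - 1..y} q) has_real_derivative q t) (at t)"
      by (subst (asm) at_within_Icc_at) (auto intro!: derivative_eq_intros)
    have "G (t - 1) + integral {t - 1..y} q = G y" if "y \<in> {t - 1<..}" for y
      using Gdiff[of "t - 1" y] that by simp
    then show ?thesis
      by (intro has_field_derivative_transform_within_open[OF *, of "{t - 1<..}"]) auto
  qed
  obtain c where c: "0 < c" "\<And>t. c * (1 + t\<^sup>2) \<le> (pot t)\<^sup>2" using pot_ge_sqrt by blast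
  have q_le: "q t \<le> 1 / c * inverse (1 + t\<^sup>2)" for t
  proof -
    have "0 < c * (1 + t\<^sup>2)" using c(1) by (intro mult_pos_pos add_pos_nonneg) auto
    then have "1 / (pot t)\<^sup>2 \<le> 1 / (c * (1 + t\<^sup>2))"
      using c(2)[of t] pot_pos[of t] by (intro divide_left_mono mult_pos_pos[of "(pot t)\<^sup>2"]) auto
    then show ?thesis by (simp add: q_def divide_inverse)
  qed
  \<comment> \<open>The limits of this monotone function at the two ends turn \<open>q_le\<close>
    into the tail bounds \<open>up\<close> and \<open>lo\<close> for the area.\<close>
  have arctan_mono': "arctan x / c - G x \<le> arctan y / c - G y" if "x \<le> y" for x y
  proof (rule DERIV_nonneg_imp_nondecreasing[OF that])
    fix t
    have "((\<lambda>t. arctan t / c - G t) has_real_derivative inverse (1 + t\<^sup>2) / c - q t) (at t)"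
      using c(1) by (auto intro!: derivative_eq_intros dG)
    then show "\<exists>l. ((\<lambda>t. arctan t / c - G t) has_real_derivative l) (at t) \<and> 0 \<le> l"
      using q_le[of t] by (intro exI[of _ "inverse (1 + t\<^sup>2) / c - q t"]) (auto simp: field_simps)
  qed
  have Gtop: "(G \<longlongrightarrow> T) at_top"
    using tendsto_integral_at_top[OF _ qint] unfolding G_def T_def by simp
  have Gbot: "(G \<longlongrightarrow> 0) at_bot"
  proof -
    have i: "integrable lborel (\<lambda>t. q (- t))"
      using lborel_integrable_real_affine[OF qint, of "-1" 0] by simp
    have "((\<lambda>y. \<integral>s. indicator {..y} s *\<^sub>R q (- s) \<partial>lborel) \<longlongrightarrow> (\<integral>s. q (- s) \<partial>lborel)) at_top"
      by (rule tendsto_integral_at_top[OF _ i]) simp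
    then have "((\<lambda>y. (\<integral>s. q (- s) \<partial>lborel) - (\<integral>s. indicator {..y} s *\<^sub>R q (- s) \<partial>lborel)) \<longlongrightarrow> 0) at_top"
      using tendsto_diff[OF tendsto_const[of "\<integral>s. q (- s) \<partial>lborel"]] by fastforce
    moreover have "(\<integral>s. q (- s) \<partial>lborel) - (\<integral>s. indicator {..y} s *\<^sub>R q (- s) \<partial>lborel) = G (- y)" for y
    proof -
      have "integrable lborel (\<lambda>s. indicator {..y} s *\<^sub>R q (- s))"
        by (rule integrable_mult_indicator[OF _ i]) simp
      then have "(\<integral>s. q (- s) \<partial>lborel) - (\<integral>s. indicator {..y} s *\<^sub>R q (- s) \<partial>lborel)
          = (\<integral>s. q (- s) - indicator {..y} s *\<^sub>R q (- s) \<partial>lborel)"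
        by (rule Bochner_Integration.integral_diff[OF i, symmetric])
      also have "\<dots> = (\<integral>s. indicator {..- y} (- s) * q (- s) \<partial>lborel)"
      proof (rule integral_cong_AE)
        show "AE s in lborel. q (- s) - indicator {..y} s *\<^sub>R q (- s) = indicator {..- y} (- s) * q (- s)"
          using AE_lborel_singleton[of y] by eventually_elim (auto simp: indicator_def)
      qed auto
      also have "\<dots> = G (- y)"
        unfolding G_def by (subst (2) lborel_integral_real_affine[of "-1" _ 0]) auto
      finally show ?thesis .
    qed
    ultimately show ?thesis by (simp add: filterlim_at_bot_mirror)
  qed
  have up: "T - G t \<le> (pi / 2 - arctan t) / c" for t
  proof -
    have "((\<lambda>y. arctan y / c - G y) \<longlongrightarrow> (pi / 2) / c - T) at_top"
      using c(1) by (intro tendsto_intros tendsto_arctan_at_top Gtop) auto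
    moreover have "eventually (\<lambda>y. arctan t / c - G t \<le> arctan y / c - G y) at_top"
      by (intro eventually_mono[OF eventually_ge_at_top[of t]] arctan_mono')
    ultimately have "arctan t / c - G t \<le> (pi / 2) / c - T"
      by (rule tendsto_lowerbound) simp
    then show ?thesis by (simp add: diff_divide_distrib)
  qed
  have lo: "G t \<le> (pi / 2 + arctan t) / c" for t
  proof -
    have "((\<lambda>y. arctan y / c - G y) \<longlongrightarrow> (- (pi / 2)) / c - 0) at_bot"
      using c(1) by (intro tendsto_intros tendsto_arctan_at_bot Gbot) auto
    moreover have "eventually (\<lambda>y. arctan y / c - G y \<le> arctan t / c - G t) at_bot"
      by (intro eventually_mono[OF eventually_le_at_bot[of t]] arctan_mono')
    ultimately have "(- (pi / 2)) / c - 0 \<le> arctan t / c - G t"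
      by (rule tendsto_upperbound) simp
    then show ?thesis by (simp add: add_divide_distrib)
  qed
  have G0: "0 \<le> G t" for t
    unfolding G_def using qpos by (intro Bochner_Integration.integral_nonneg) (auto simp: less_imp_le)
  have GT: "G t \<le> T" for t
    unfolding G_def T_def using qpos by (intro integral_mono qi qint) (auto simp: indicator_def less_imp_le)
  \<comment> \<open>The sine must vanish exactly where the affine function t - t1 does, so the zero
    is placed at the median of the area.\<close>
  obtain t1 where t1: "G t1 = T / 2"
  proof -
    have "eventually (\<lambda>t. G t > T / 2) at_top" using Gtop Tpos by (intro order_tendstoD) auto
    then obtain b where b: "\<And>t. t \<ge> b \<Longrightarrow> G t > T / 2" by (auto simp: eventually_at_top_linorder)
    have "eventually (\<lambda>t. G t < T / 2) at_bot" using Gbot Tpos by (intro order_tendstoD) auto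
    then obtain a where a: "\<And>t. t \<le> a \<Longrightarrow> G t < T / 2" by (auto simp: eventually_at_bot_linorder)
    have "\<exists>x\<ge>min a b. x \<le> b \<and> G x = T / 2"
      using a[of "min a b"] b[of b] dG by (intro IVT) (auto intro!: DERIV_isCont less_imp_le)
    then show ?thesis using that by blast
  qed
  define \<alpha> where "\<alpha> = pi / T"
  have \<alpha>pos: "0 < \<alpha>" using Tpos by (simp add: \<alpha>_def)
  \<comment> \<open>Rescaled area along the boundary of the unit ball; half of the ball corresponds to \<open>- \<pi>/2 \<le> \<sigma> \<le> \<pi>/2\<close>.\<close>
  define \<sigma> where "\<sigma> t = \<alpha> * (G t - T / 2)" for t
  have d\<sigma>: "(\<sigma> has_real_derivative \<alpha> * q t) (at t)" for t
    unfolding \<sigma>_def by (auto intro!: derivative_eq_intros dG)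
  have \<sigma>1: "pi / 2 - \<sigma> t = \<alpha> * (T - G t)" and \<sigma>2: "pi / 2 + \<sigma> t = \<alpha> * G t" for t
    using Tpos by (auto simp: \<sigma>_def \<alpha>_def field_simps)
  have \<sigma>ge: "- (pi / 2) \<le> \<sigma> t" and \<sigma>le: "\<sigma> t \<le> pi / 2" for t
  proof -
    have "0 \<le> \<alpha> * (T - G t)" "0 \<le> \<alpha> * G t" using \<alpha>pos G0[of t] GT[of t] by auto
    then show "- (pi / 2) \<le> \<sigma> t" "\<sigma> t \<le> pi / 2" using \<sigma>1[of t] \<sigma>2[of t] by linarith+
  qed
  have \<sigma>top: "(\<sigma> \<longlongrightarrow> pi / 2) at_top"
  proof -
    have "(\<sigma> \<longlongrightarrow> \<alpha> * (T - T / 2)) at_top" unfolding \<sigma>_def by (intro tendsto_intros Gtop)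
    then show ?thesis using Tpos by (simp add: \<alpha>_def field_simps)
  qed
  have \<sigma>bot: "(\<sigma> \<longlongrightarrow> - (pi / 2)) at_bot"
  proof -
    have "(\<sigma> \<longlongrightarrow> \<alpha> * (0 - T / 2)) at_bot" unfolding \<sigma>_def by (intro tendsto_intros Gbot)
    then show ?thesis using Tpos by (simp add: \<alpha>_def field_simps)
  qed
  have \<sigma>m[measurable]: "\<sigma> \<in> borel_measurable borel"
    using d\<sigma> by (intro borel_measurable_continuous_onI continuous_at_imp_continuous_on ballI) (auto intro: DERIV_isCont)
  have cos0: "0 \<le> cos (\<sigma> t)" for t using \<sigma>ge[of t] \<sigma>le[of t] by (intro cos_ge_zero) auto
  have arctan_le: "pi / 2 - arctan x \<le> 1 / x" if "x > 0" for x
    using arctan_inverse[of x] arctan_le_self[of "1 / x"] that by (simp add: inverse_eq_divide)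
  \<comment> \<open>The cosine is at most the distance of \<sigma> from the nearer end value, which
    is \<alpha> times the remaining area and hence of order 1 / \<bar>t\<bar>. This compensates the
    linear growth of \<open>pot\<close>, as the bound \<open>kb\<close> for the constant function
    \<psi> = 1 requires.\<close>
  have tcos: "\<bar>t\<bar> * cos (\<sigma> t) \<le> \<alpha> / c" for t
  proof (cases "t = 0")
    case False
    have "cos (\<sigma> t) \<le> \<alpha> * (1 / \<bar>t\<bar> / c)"
    proof (cases "t > 0")
      case True
      have "cos (\<sigma> t) = sin (pi / 2 - \<sigma> t)" by (simp add: sin_cos_eq)
      also have "\<dots> \<le> pi / 2 - \<sigma> t" using \<sigma>le[of t] by (intro sin_x_le_x) simp
      also have "\<dots> \<le> \<alpha> * ((pi / 2 - arctan t) / c)"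
        unfolding \<sigma>1 using up[of t] \<alpha>pos by (intro mult_left_mono) auto
      also have "\<dots> \<le> \<alpha> * (1 / \<bar>t\<bar> / c)"
        using arctan_le[OF True] \<alpha>pos c(1) True by (intro mult_left_mono divide_right_mono) auto
      finally show ?thesis .
    next
      case False
      then have t: "- t > 0" using \<open>t \<noteq> 0\<close> by simp
      have "cos (\<sigma> t) = sin (pi / 2 + \<sigma> t)" by (simp add: sin_add)
      also have "\<dots> \<le> pi / 2 + \<sigma> t" using \<sigma>ge[of t] by (intro sin_x_le_x) simp
      also have "\<dots> \<le> \<alpha> * ((pi / 2 + arctan t) / c)"
        unfolding \<sigma>2 using lo[of t] \<alpha>pos by (intro mult_left_mono) auto
      also have "\<dots> \<le> \<alpha> * (1 / \<bar>t\<bar> / c)"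
        using arctan_le[OF t] \<alpha>pos c(1) t by (intro mult_left_mono divide_right_mono) (auto simp: arctan_minus)
      finally show ?thesis .
    qed
    then have "\<bar>t\<bar> * cos (\<sigma> t) \<le> \<bar>t\<bar> * (\<alpha> * (1 / \<bar>t\<bar> / c))" by (intro mult_left_mono) auto
    then show ?thesis using False by simp
  qed (use \<alpha>pos c(1) in simp)
  have pot_le0: "pot t \<le> pot 0 + mass * \<bar>t\<bar>" for t using pot_lipschitz[of t 0] by simp
  define KA where "KA = pot 0 + mass * (\<alpha> / c)"
  have kA: "\<bar>cos (\<sigma> t)\<bar> * pot t \<le> KA" for t
  proof -
    have "cos (\<sigma> t) * pot t \<le> cos (\<sigma> t) * (pot 0 + mass * \<bar>t\<bar>)"
      using cos0 pot_le0 by (intro mult_left_mono)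
    also have "\<dots> = cos (\<sigma> t) * pot 0 + mass * (\<bar>t\<bar> * cos (\<sigma> t))" by (simp add: algebra_simps)
    also have "\<dots> \<le> 1 * pot 0 + mass * (\<alpha> / c)"
      using pot_pos[of 0] mass_gt0 tcos by (intro add_mono mult_mono mult_left_mono) (auto simp: less_imp_le)
    finally show ?thesis using cos0[of t] by (simp add: KA_def)
  qed
  have KA0: "0 \<le> KA" using kA[of 0] pot_pos[of 0] by (metis abs_ge_zero less_imp_le mult_nonneg_nonneg order_trans)
  \<comment> \<open>For the cosine both boundary values are 0: one cosine factor absorbs
    \<open>pot\<close>, the other tends to 0. The summand \<open>0 * t\<close> keeps the literal
    shape of \<psi> for \<open>a = 1\<close> and \<open>b = 0\<close>.\<close>
  have limA: "((\<lambda>t. pot t * (cos (\<sigma> t))\<^sup>2 / (1 + 0 * t)) \<longlongrightarrow> 0) F" if "((\<lambda>t. cos (\<sigma> t)) \<longlongrightarrow> 0) F" for F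
  proof (rule Lim_null_comparison)
    show "((\<lambda>t. KA * \<bar>cos (\<sigma> t)\<bar>) \<longlongrightarrow> 0) F"
      using tendsto_mult_right_zero[OF tendsto_rabs_zero[OF that]] .
    show "eventually (\<lambda>t. norm (pot t * (cos (\<sigma> t))\<^sup>2 / (1 + 0 * t)) \<le> KA * \<bar>cos (\<sigma> t)\<bar>) F"
    proof (rule always_eventually, rule allI)
      fix t
      have "\<bar>cos (\<sigma> t)\<bar> * pot t * \<bar>cos (\<sigma> t)\<bar> \<le> KA * \<bar>cos (\<sigma> t)\<bar>" using kA by (intro mult_right_mono) auto
      then show "norm (pot t * (cos (\<sigma> t))\<^sup>2 / (1 + 0 * t)) \<le> KA * \<bar>cos (\<sigma> t)\<bar>"
        using pot_pos[of t] by (simp add: abs_mult power2_eq_square algebra_simps)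
    qed
  qed
  have dA: "((\<lambda>t. cos (\<sigma> t)) has_real_derivative - sin (\<sigma> t) * (\<alpha> * q t)) (at t)" for t
    by (auto intro!: derivative_eq_intros d\<sigma>)
  have bA: "\<bar>- sin (\<sigma> t) * (\<alpha> * q t)\<bar> \<le> \<alpha> / (pot t)\<^sup>2" for t
  proof -
    have "\<bar>sin (\<sigma> t)\<bar> * (\<alpha> * q t) \<le> 1 * (\<alpha> * q t)"
      using \<alpha>pos qpos[of t] by (intro mult_right_mono) auto
    then show ?thesis using \<alpha>pos qpos[of t] by (simp add: abs_mult q_def)
  qed
  have KA1: "\<bar>cos (\<sigma> t)\<bar> * pot t \<le> KA * \<bar>1 + 0 * t\<bar>" for t using kA[of t] by simp
  have "((\<lambda>t. cos (\<sigma> t)) \<longlongrightarrow> cos (pi / 2)) at_top" by (intro tendsto_intros \<sigma>top)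
  then have topA: "((\<lambda>t. pot t * (cos (\<sigma> t))\<^sup>2 / (1 + 0 * t)) \<longlongrightarrow> 0) at_top" by (intro limA) simp
  have "((\<lambda>t. cos (\<sigma> t)) \<longlongrightarrow> cos (- (pi / 2))) at_bot" by (intro tendsto_intros \<sigma>bot)
  then have "((\<lambda>t. pot t * (cos (\<sigma> t))\<^sup>2 / (1 + 0 * t)) \<longlongrightarrow> 0) at_bot" by (intro limA) simp
  then have botA0: "((\<lambda>t. pot t * (cos (\<sigma> t))\<^sup>2 / (1 + 0 * t)) \<longlongrightarrow> - 0) at_bot" by simp
  have mA: "(\<lambda>t. - sin (\<sigma> t) * (\<alpha> * q t)) \<in> borel_measurable borel" by measurable
  have nzA: "(1::real) \<noteq> 0 \<or> (0::real) \<noteq> 0" and nzB: "- t1 \<noteq> 0 \<or> (1::real) \<noteq> 0" by simp_all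
  note A = picone[of 1 0 "\<lambda>t. cos (\<sigma> t)" "\<lambda>t. - sin (\<sigma> t) * (\<alpha> * q t)" \<alpha> KA 0,
      OF nzA dA mA abs_cos_le_one bA KA1 topA botA0]
  define KB where "KB = pot t1 * (\<alpha> / c) + mass"
  \<comment> \<open>As \<sigma> vanishes at \<open>t1\<close>, a bound on its derivative makes the
    sine vanish there at least linearly; this is \<open>kb\<close> near the zero of \<psi>.\<close>
  have \<sigma>_lip: "\<bar>\<sigma> t\<bar> \<le> \<alpha> / c * \<bar>t - t1\<bar>" for t
  proof -
    have "norm (\<sigma> t - \<sigma> t1) \<le> \<alpha> / c * norm (t - t1)"
    proof (rule field_differentiable_bound[of UNIV])
      show "(\<sigma> has_field_derivative \<alpha> * q z) (at z within UNIV)" for z using d\<sigma> by simp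
      show "norm (\<alpha> * q z) \<le> \<alpha> / c" for z
      proof -
        have "inverse (1 + z\<^sup>2) \<le> 1" by (simp add: inverse_le_1_iff)
        then have "q z \<le> 1 / c * 1" using q_le[of z] c(1)
          by (meson divide_nonneg_pos less_imp_le mult_left_mono order_trans zero_le_one)
        then show ?thesis using \<alpha>pos qpos[of z] mult_left_mono[of "q z" "1 / c" \<alpha>] by simp
      qed
    qed auto
    moreover have "\<sigma> t1 = 0" by (simp add: \<sigma>_def t1)
    ultimately show ?thesis by simp
  qed
  have kB: "\<bar>sin (\<sigma> t)\<bar> * pot t \<le> KB * \<bar>- t1 + 1 * t\<bar>" for t
  proof -
    have "\<bar>sin (\<sigma> t)\<bar> * pot t \<le> \<bar>sin (\<sigma> t)\<bar> * (pot t1 + mass * \<bar>t - t1\<bar>)"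
      using pot_lipschitz[of t t1] by (intro mult_left_mono) auto
    also have "\<dots> = \<bar>sin (\<sigma> t)\<bar> * pot t1 + \<bar>sin (\<sigma> t)\<bar> * (mass * \<bar>t - t1\<bar>)" by (simp add: algebra_simps)
    also have "\<dots> \<le> \<alpha> / c * \<bar>t - t1\<bar> * pot t1 + 1 * (mass * \<bar>t - t1\<bar>)"
      using \<sigma>_lip[of t] abs_sin_x_le_abs_x[of "\<sigma> t"] pot_pos[of t1] mass_gt0
      by (intro add_mono mult_right_mono) auto
    also have "\<dots> = KB * \<bar>- t1 + 1 * t\<bar>" by (simp add: KB_def algebra_simps)
    finally show ?thesis .
  qed
  have dB: "((\<lambda>t. sin (\<sigma> t)) has_real_derivative cos (\<sigma> t) * (\<alpha> * q t)) (at t)" for t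
    by (auto intro!: derivative_eq_intros d\<sigma>)
  have bB: "\<bar>cos (\<sigma> t) * (\<alpha> * q t)\<bar> \<le> \<alpha> / (pot t)\<^sup>2" for t
  proof -
    have "\<bar>cos (\<sigma> t)\<bar> * (\<alpha> * q t) \<le> 1 * (\<alpha> * q t)"
      using \<alpha>pos qpos[of t] by (intro mult_right_mono) auto
    then show ?thesis using \<alpha>pos qpos[of t] by (simp add: abs_mult q_def)
  qed
  have KB1: "\<bar>sin (\<sigma> t)\<bar> * pot t \<le> KB * \<bar>- t1 + 1 * t\<bar>" for t by (rule kB)
  \<comment> \<open>For the sine the boundary values do not vanish. They are \<open>mass\<close> and
    \<open>- mass\<close>, because \<open>pot\<close> grows alike at both ends while t - t1 changes
    sign; this is the case for which opposite limits are allowed in \<open>picone\<close>.\<close>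
  have pt: "((\<lambda>t. pot t / (- t1 + 1 * t)) \<longlongrightarrow> mass) at_top"
  proof (rule tendsto_sandwich[where f = "\<lambda>t. (mass * t - pot 0) / (- t1 + 1 * t)"
        and h = "\<lambda>t. (pot 0 + mass * t) / (- t1 + 1 * t)"])
    have inf: "filterlim (\<lambda>t::real. t) at_infinity at_top"
      by (simp add: filterlim_def filtermap_ident at_top_le_at_infinity)
    show "((\<lambda>t. (mass * t - pot 0) / (- t1 + 1 * t)) \<longlongrightarrow> mass) at_top"
      using tendsto_linear_fraction[OF inf, of mass "- pot 0" t1] by simp
    show "((\<lambda>t. (pot 0 + mass * t) / (- t1 + 1 * t)) \<longlongrightarrow> mass) at_top"
      using tendsto_linear_fraction[OF inf, of mass "pot 0" t1] by (simp add: add.commute)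
    show "eventually (\<lambda>t. (mass * t - pot 0) / (- t1 + 1 * t) \<le> pot t / (- t1 + 1 * t)) at_top"
      using eventually_gt_at_top[of "max 0 t1"]
    proof eventually_elim
      fix t assume "max 0 t1 < t"
      then show "(mass * t - pot 0) / (- t1 + 1 * t) \<le> pot t / (- t1 + 1 * t)"
        using pot_ge[of t] by (intro divide_right_mono) auto
    qed
    show "eventually (\<lambda>t. pot t / (- t1 + 1 * t) \<le> (pot 0 + mass * t) / (- t1 + 1 * t)) at_top"
      using eventually_gt_at_top[of "max 0 t1"]
    proof eventually_elim
      fix t assume "max 0 t1 < t"
      then show "pot t / (- t1 + 1 * t) \<le> (pot 0 + mass * t) / (- t1 + 1 * t)"
        using pot_le0[of t] by (intro divide_right_mono) auto
    qed
  qed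
  have pb: "((\<lambda>t. pot t / (- t1 + 1 * t)) \<longlongrightarrow> - mass) at_bot"
  proof (rule tendsto_sandwich[where f = "\<lambda>t. (pot 0 + mass * (- t)) / (- t1 + 1 * t)"
        and h = "\<lambda>t. (mass * (- t) - pot 0) / (- t1 + 1 * t)"])
    have inf: "filterlim (\<lambda>t::real. t) at_infinity at_bot"
      by (simp add: filterlim_def filtermap_ident at_bot_le_at_infinity)
    show "((\<lambda>t. (mass * (- t) - pot 0) / (- t1 + 1 * t)) \<longlongrightarrow> - mass) at_bot"
      using tendsto_linear_fraction[OF inf, of "- mass" "- pot 0" t1] by simp
    show "((\<lambda>t. (pot 0 + mass * (- t)) / (- t1 + 1 * t)) \<longlongrightarrow> - mass) at_bot"
      using tendsto_linear_fraction[OF inf, of "- mass" "pot 0" t1] by (simp add: add.commute)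
    show "eventually (\<lambda>t. pot t / (- t1 + 1 * t) \<le> (mass * (- t) - pot 0) / (- t1 + 1 * t)) at_bot"
      using eventually_gt_at_bot[of "min 0 t1"]
    proof eventually_elim
      fix t assume "t < min 0 t1"
      then show "pot t / (- t1 + 1 * t) \<le> (mass * (- t) - pot 0) / (- t1 + 1 * t)"
        using pot_ge[of t] by (intro divide_right_mono_neg) auto
    qed
    show "eventually (\<lambda>t. (pot 0 + mass * (- t)) / (- t1 + 1 * t) \<le> pot t / (- t1 + 1 * t)) at_bot"
      using eventually_gt_at_bot[of "min 0 t1"]
    proof eventually_elim
      fix t assume "t < min 0 t1"
      then show "(pot 0 + mass * (- t)) / (- t1 + 1 * t) \<le> pot t / (- t1 + 1 * t)"
        using pot_le0[of t] by (intro divide_right_mono_neg) auto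
    qed
  qed
  have "((\<lambda>t. pot t / (- t1 + 1 * t) * (sin (\<sigma> t))\<^sup>2) \<longlongrightarrow> mass * (sin (pi / 2))\<^sup>2) at_top"
    by (intro tendsto_intros pt \<sigma>top)
  then have topB: "((\<lambda>t. pot t * (sin (\<sigma> t))\<^sup>2 / (- t1 + 1 * t)) \<longlongrightarrow> mass) at_top" by simp
  have "((\<lambda>t. pot t / (- t1 + 1 * t) * (sin (\<sigma> t))\<^sup>2) \<longlongrightarrow> - mass * (sin (- (pi / 2)))\<^sup>2) at_bot"
    by (intro tendsto_intros pb \<sigma>bot)
  then have botB: "((\<lambda>t. pot t * (sin (\<sigma> t))\<^sup>2 / (- t1 + 1 * t)) \<longlongrightarrow> - mass) at_bot" by simp
  have mB: "(\<lambda>t. cos (\<sigma> t) * (\<alpha> * q t)) \<in> borel_measurable borel" by measurable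
  note B = picone[of "- t1" 1 "\<lambda>t. sin (\<sigma> t)" "\<lambda>t. cos (\<sigma> t) * (\<alpha> * q t)" \<alpha> KB mass,
      OF nzB dB mB abs_sin_le_one bB KB1 topB botB]
  have eqJ: "h t * pot t * (cos (\<sigma> t))\<^sup>2 + h t * pot t * (sin (\<sigma> t))\<^sup>2 = h t * pot t" for t
    by (simp flip: distrib_left)
  show int: "integrable lborel (\<lambda>t. h t * pot t)"
    using Bochner_Integration.integrable_add[OF A(1) B(1)] unfolding eqJ .
  define J where "J = (\<integral>t. h t * pot t \<partial>lborel)"
  have "J = (\<integral>t. h t * pot t * (cos (\<sigma> t))\<^sup>2 \<partial>lborel) + (\<integral>t. h t * pot t * (sin (\<sigma> t))\<^sup>2 \<partial>lborel)"
    unfolding J_def using Bochner_Integration.integral_add[OF A(1) B(1)] unfolding eqJ by simp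
  moreover have "(\<integral>t. (pot t)\<^sup>2 * (- sin (\<sigma> t) * (\<alpha> * q t))\<^sup>2 \<partial>lborel) + (\<integral>t. (pot t)\<^sup>2 * (cos (\<sigma> t) * (\<alpha> * q t))\<^sup>2 \<partial>lborel)
      = \<alpha>\<^sup>2 * T"
  proof -
    have "(pot t)\<^sup>2 * (- sin (\<sigma> t) * (\<alpha> * q t))\<^sup>2 + (pot t)\<^sup>2 * (cos (\<sigma> t) * (\<alpha> * q t))\<^sup>2 = \<alpha>\<^sup>2 * q t" for t
    proof -
      have "(pot t)\<^sup>2 * (- sin (\<sigma> t) * (\<alpha> * q t))\<^sup>2 + (pot t)\<^sup>2 * (cos (\<sigma> t) * (\<alpha> * q t))\<^sup>2
        = (pot t)\<^sup>2 * (\<alpha> * q t)\<^sup>2 * ((sin (\<sigma> t))\<^sup>2 + (cos (\<sigma> t))\<^sup>2)"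
        by (simp only: power_mult_distrib power2_minus) (simp only: algebra_simps)
      also have "\<dots> = \<alpha>\<^sup>2 * q t"
        unfolding sin_cos_squared_add q_def using pot_pos[of t] by (simp add: field_simps power2_eq_square)
      finally show ?thesis .
    qed
    then show ?thesis
      using Bochner_Integration.integral_add[OF A(2) B(2)] by (simp add: T_def)
  qed
  ultimately have "2 * J \<le> \<alpha>\<^sup>2 * T" using A(3) B(3) by linarith
  then have "J * T \<le> (\<alpha>\<^sup>2 * T / 2) * T" using Tpos by (intro mult_right_mono) auto
  also have "\<dots> = pi\<^sup>2 / 2" using Tpos by (simp add: \<alpha>_def field_simps power2_eq_square)
  finally show "(\<integral>t. h t * pot t \<partial>lborel) * (\<integral>t. 1 / (pot t)\<^sup>2 \<partial>lborel) \<le> pi\<^sup>2 / 2"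
    unfolding J_def T_def q_def .
qed

end

section \<open>A Busemann inequality for densities bounded by one\<close>

definition det2 :: "real^2 \<Rightarrow> real^2 \<Rightarrow> real" where
  "det2 u v = u $ 1 * v $ 2 - u $ 2 * v $ 1"

definition vec2 :: "real \<Rightarrow> real \<Rightarrow> real^2" where
  "vec2 a b = (\<chi> i. if i = 1 then a else b)"

lemma vec2_nth[simp]: "vec2 a b $ 1 = a" "vec2 a b $ 2 = b"
  by (simp_all add: vec2_def)

lemma vec2_eq_iff: "(x :: real^2) = y \<longleftrightarrow> x $ 1 = y $ 1 \<and> x $ 2 = y $ 2"
  by (simp add: vec_eq_iff forall_2)

lemma vec_nth_measurable[measurable]: "(\<lambda>x :: real^2. x $ i) \<in> borel_measurable borel"
  by (intro borel_measurable_continuous_onI continuous_intros)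

lemma continuous_vec2: "continuous_on UNIV (\<lambda>p. vec2 (fst p) (snd p))"
  unfolding vec2_def
proof (rule continuous_on_vec_lambda)
  show "continuous_on UNIV (\<lambda>p. if i = 1 then fst p else snd p)" for i :: 2
    by (cases "i = 1") (auto intro!: continuous_intros)
qed

lemma vec2_measurable[measurable]:
  "(\<lambda>p. vec2 (fst p) (snd p)) \<in> borel_measurable (borel \<Otimes>\<^sub>M borel)"
  using borel_measurable_continuous_onI[OF continuous_vec2] by (simp add: borel_prod)

lemma measurable_vec2[measurable (raw)]:
  assumes "f \<in> borel_measurable M" "g \<in> borel_measurable M"
  shows "(\<lambda>x. vec2 (f x) (g x)) \<in> borel_measurable M"
  using measurable_compose[OF measurable_Pair[OF assms] vec2_measurable] by simp

lemma measurable_det2[measurable (raw)]: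
  assumes [measurable]: "f \<in> borel_measurable M" "g \<in> borel_measurable M"
  shows "(\<lambda>x. det2 (f x) (g x)) \<in> borel_measurable M"
  unfolding det2_def using measurable_compose[OF assms(1) vec_nth_measurable]
    measurable_compose[OF assms(2) vec_nth_measurable]
  by (intro borel_measurable_diff borel_measurable_times)

text \<open>Lebesgue measure is determined by its values on boxes, and a box pulls back to a product
  of two intervals. This reduces plane integrals to iterated line integrals, where affine
  substitutions are available.\<close>

lemma lborel_vec2: "(lborel :: (real^2) measure) = distr (lborel \<Otimes>\<^sub>M lborel) borel (\<lambda>p. vec2 (fst p) (snd p))"
proof (rule lborel_eqI)
  fix l u :: "real^2" assume le: "\<And>b. b \<in> Basis \<Longrightarrow> l \<bullet> b \<le> u \<bullet> b"
  have B: "Basis = {axis 1 1, axis 2 1 :: real^2}"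
    by (auto simp: Basis_vec_def UNIV_2)
  have ne: "axis 1 1 \<noteq> (axis 2 1 :: real^2)" by (simp add: axis_eq_axis)
  have le1: "l $ 1 \<le> u $ 1" and le2: "l $ 2 \<le> u $ 2"
    using le[of "axis 1 1"] le[of "axis 2 1"] by (auto simp: B inner_axis)
  have pre: "(\<lambda>p. vec2 (fst p) (snd p)) -` box l u \<inter> space (lborel \<Otimes>\<^sub>M lborel) =
      {l $ 1<..<u $ 1} \<times> {l $ 2<..<u $ 2}"
    by (auto simp: mem_box B inner_axis space_pair_measure)
  have "emeasure (distr (lborel \<Otimes>\<^sub>M lborel) borel (\<lambda>p. vec2 (fst p) (snd p))) (box l u)
      = emeasure (lborel \<Otimes>\<^sub>M lborel) ({l $ 1<..<u $ 1} \<times> {l $ 2<..<u $ 2})"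
    by (subst emeasure_distr) (auto simp: pre)
  also have "\<dots> = ennreal (u $ 1 - l $ 1) * ennreal (u $ 2 - l $ 2)"
    using le1 le2 by (subst lborel.emeasure_pair_measure_Times) auto
  also have "\<dots> = ennreal (\<Prod>b\<in>Basis. (u - l) \<bullet> b)"
    using le1 le2 ne by (simp add: B inner_axis ennreal_mult)
  finally show "emeasure (distr (lborel \<Otimes>\<^sub>M lborel) borel (\<lambda>p. vec2 (fst p) (snd p))) (box l u)
    = (\<Prod>b\<in>Basis. (u - l) \<bullet> b)" .
qed simp

lemma nn_integral_vec2:
  assumes [measurable]: "G \<in> borel_measurable borel"
  shows "(\<integral>\<^sup>+u. G u \<partial>(lborel :: (real^2) measure)) = (\<integral>\<^sup>+a. (\<integral>\<^sup>+b. G (vec2 a b) \<partial>lborel) \<partial>lborel)"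
proof -
  have "(\<integral>\<^sup>+u. G u \<partial>(lborel :: (real^2) measure)) = (\<integral>\<^sup>+p. G (vec2 (fst p) (snd p)) \<partial>(lborel \<Otimes>\<^sub>M lborel))"
    by (subst lborel_vec2) (simp add: nn_integral_distr)
  also have "\<dots> = (\<integral>\<^sup>+a. (\<integral>\<^sup>+b. G (vec2 a b) \<partial>lborel) \<partial>lborel)"
    by (subst lborel.nn_integral_fst[symmetric]) auto
  finally show ?thesis .
qed

text \<open>Coordinates \<open>u = r (1, t)\<close>: every line through the origin except the vertical one has a slope.\<close>

lemma nn_integral_slope:
  assumes [measurable]: "G \<in> borel_measurable borel"
  shows "(\<integral>\<^sup>+u. G u \<partial>(lborel :: (real^2) measure)) =
    (\<integral>\<^sup>+t. (\<integral>\<^sup>+r. ennreal \<bar>r\<bar> * G (r *\<^sub>R vec2 1 t) \<partial>lborel) \<partial>lborel)"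
proof -
  have sc: "r *\<^sub>R vec2 1 t = vec2 r (r * t)" for r t by (simp add: vec2_eq_iff)
  have "(\<integral>\<^sup>+u. G u \<partial>(lborel :: (real^2) measure)) = (\<integral>\<^sup>+a. (\<integral>\<^sup>+b. G (vec2 a b) \<partial>lborel) \<partial>lborel)"
    by (rule nn_integral_vec2) simp
  also have "\<dots> = (\<integral>\<^sup>+a. (\<integral>\<^sup>+t. ennreal \<bar>a\<bar> * G (vec2 a (a * t)) \<partial>lborel) \<partial>lborel)"
  proof (rule nn_integral_cong_AE)
    show "AE a in lborel. (\<integral>\<^sup>+b. G (vec2 a b) \<partial>lborel) = (\<integral>\<^sup>+t. ennreal \<bar>a\<bar> * G (vec2 a (a * t)) \<partial>lborel)"
      using AE_lborel_singleton[of 0]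
    proof eventually_elim
      fix a :: real assume "a \<noteq> 0"
      then show "(\<integral>\<^sup>+b. G (vec2 a b) \<partial>lborel) = (\<integral>\<^sup>+t. ennreal \<bar>a\<bar> * G (vec2 a (a * t)) \<partial>lborel)"
        by (subst nn_integral_real_affine[of _ a 0]) (auto simp: nn_integral_cmult)
    qed
  qed
  also have "\<dots> = (\<integral>\<^sup>+t. (\<integral>\<^sup>+a. ennreal \<bar>a\<bar> * G (vec2 a (a * t)) \<partial>lborel) \<partial>lborel)"
    by (rule lborel_pair.Fubini'[symmetric]) measurable
  finally show ?thesis unfolding sc .
qed

text \<open>The bathtub principle on one line through the origin: for 0 \<le> f \<le> 1 the integral
  of \<open>(l * \<bar>r\<bar> - N * r\<^sup>2) * f\<close> is at most that of the positive part,
  which lives on \<bar>r\<bar> \<le> l / N and contributes l^3 / (6 N^2) on either side. Here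
  \<open>l\<close> acts as a Lagrange multiplier for the mass.\<close>

lemma bathtub_integral:
  assumes "0 < N" "0 < l"
  shows "(\<integral>\<^sup>+r. ennreal (max 0 (l * \<bar>r\<bar> - N * r\<^sup>2)) \<partial>lborel) \<le> ennreal (l ^ 3 / (3 * N\<^sup>2))"
proof -
  define \<rho> where "\<rho> = l / N"
  have \<rho>: "0 < \<rho>" "N * \<rho> = l" using assms by (auto simp: \<rho>_def)
  have "(\<integral>\<^sup>+r. ennreal (max 0 (l * \<bar>r\<bar> - N * r\<^sup>2)) \<partial>lborel) \<le>
    (\<integral>\<^sup>+r. ennreal (- l * r - N * r\<^sup>2) * indicator {- \<rho>..0} r + ennreal (l * r - N * r\<^sup>2) * indicator {0..\<rho>} r \<partial>lborel)"
  proof (rule nn_integral_mono)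
    fix r :: real
    have "max 0 (l * \<bar>r\<bar> - N * r\<^sup>2) = 0" if "\<not> \<bar>r\<bar> \<le> \<rho>"
    proof -
      have "N * \<rho> * \<bar>r\<bar> \<le> N * \<bar>r\<bar> * \<bar>r\<bar>" using that assms by (intro mult_right_mono mult_left_mono) auto
      then show ?thesis using \<rho>(2) by (simp add: power2_eq_square mult.assoc)
    qed
    then show "ennreal (max 0 (l * \<bar>r\<bar> - N * r\<^sup>2)) \<le>
      ennreal (- l * r - N * r\<^sup>2) * indicator {- \<rho>..0} r + ennreal (l * r - N * r\<^sup>2) * indicator {0..\<rho>} r"
      by (cases "\<bar>r\<bar> \<le> \<rho>"; cases "0 \<le> r") (auto simp: indicator_def max_def ennreal_neg)
  qed
  also have "\<dots> = (\<integral>\<^sup>+r. ennreal (- l * r - N * r\<^sup>2) * indicator {- \<rho>..0} r \<partial>lborel) +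
      (\<integral>\<^sup>+r. ennreal (l * r - N * r\<^sup>2) * indicator {0..\<rho>} r \<partial>lborel)"
    by (rule nn_integral_add) auto
  also have "(\<integral>\<^sup>+r. ennreal (- l * r - N * r\<^sup>2) * indicator {- \<rho>..0} r \<partial>lborel) =
      ennreal ((- l * 0\<^sup>2 / 2 - N * 0 ^ 3 / 3) - (- l * (- \<rho>)\<^sup>2 / 2 - N * (- \<rho>) ^ 3 / 3))"
  proof (rule nn_integral_FTC_Icc)
    fix r assume r: "r \<in> {- \<rho>..0}"
    show "((\<lambda>r. - l * r\<^sup>2 / 2 - N * r ^ 3 / 3) has_real_derivative - l * r - N * r\<^sup>2) (at r)"
      by (auto intro!: derivative_eq_intros simp: field_simps power2_eq_square)
    have "0 \<le> N * ((- r) * (\<rho> + r))" using r assms by (intro mult_nonneg_nonneg) auto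
    then show "0 \<le> - l * r - N * r\<^sup>2" unfolding \<rho>(2)[symmetric] by (simp add: algebra_simps power2_eq_square)
  qed (use \<rho> in auto)
  also have "(\<integral>\<^sup>+r. ennreal (l * r - N * r\<^sup>2) * indicator {0..\<rho>} r \<partial>lborel) =
      ennreal ((l * \<rho>\<^sup>2 / 2 - N * \<rho> ^ 3 / 3) - (l * 0\<^sup>2 / 2 - N * 0 ^ 3 / 3))"
  proof (rule nn_integral_FTC_Icc)
    fix r assume r: "r \<in> {0..\<rho>}"
    show "((\<lambda>r. l * r\<^sup>2 / 2 - N * r ^ 3 / 3) has_real_derivative l * r - N * r\<^sup>2) (at r)"
      by (auto intro!: derivative_eq_intros simp: field_simps power2_eq_square)
    have "0 \<le> N * (r * (\<rho> - r))" using r assms by (intro mult_nonneg_nonneg) auto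
    then show "0 \<le> l * r - N * r\<^sup>2" unfolding \<rho>(2)[symmetric] by (simp add: algebra_simps power2_eq_square)
  qed (use \<rho> in auto)
  also have "ennreal ((- l * 0\<^sup>2 / 2 - N * 0 ^ 3 / 3) - (- l * (- \<rho>)\<^sup>2 / 2 - N * (- \<rho>) ^ 3 / 3)) +
      ennreal ((l * \<rho>\<^sup>2 / 2 - N * \<rho> ^ 3 / 3) - (l * 0\<^sup>2 / 2 - N * 0 ^ 3 / 3)) = ennreal (l ^ 3 / (3 * N\<^sup>2))"
  proof -
    have e: "l * \<rho>\<^sup>2 / 2 - N * \<rho> ^ 3 / 3 = l ^ 3 / (6 * N\<^sup>2)"
      using assms by (simp add: \<rho>_def field_simps power2_eq_square power3_eq_cube)
    have "ennreal (l ^ 3 / (6 * N\<^sup>2)) + ennreal (l ^ 3 / (6 * N\<^sup>2)) = ennreal (l ^ 3 / (6 * N\<^sup>2) + l ^ 3 / (6 * N\<^sup>2))"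
      using assms by (intro ennreal_plus[symmetric]) auto
    also have "l ^ 3 / (6 * N\<^sup>2) + l ^ 3 / (6 * N\<^sup>2) = l ^ 3 / (3 * N\<^sup>2)"
      using assms by (simp add: field_simps)
    finally show ?thesis using e by simp
  qed
  finally show ?thesis .
qed

text \<open>The multiplier sqrt (m / T) maximises l m - l^3 T / 3 and yields J \<ge> 2/3 m^(3/2)
  T^(-1/2). After squaring and multiplying by \<open>T\<close>, one factor \<open>J\<close> is
  traded for the bound on \<open>J * T\<close>, so that \<open>T\<close> disappears.\<close>

lemma cubic_bound_of_linear_bounds:
  fixes m J T :: real
  assumes m: "0 \<le> m" and T: "0 < T" and J: "0 \<le> J"
    and lin: "\<And>l. 0 < l \<Longrightarrow> l * m \<le> J + l ^ 3 / 3 * T"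
    and JT: "J * T \<le> pi\<^sup>2 / 2"
  shows "8 / (9 * pi\<^sup>2) * m ^ 3 \<le> J"
proof (cases "m = 0")
  case False
  then have m: "0 < m" using m by simp
  define l where "l = sqrt (m / T)"
  have l: "0 < l" "l\<^sup>2 * T = m" using m T by (auto simp: l_def)
  have "l ^ 3 / 3 * T = l * (l\<^sup>2 * T) / 3" by (simp add: power2_eq_square power3_eq_cube)
  then have "l * m \<le> J + l * m / 3" using lin[OF l(1)] l(2) by simp
  moreover have "2 / 3 * m * l = 2 / 3 * (l * m)" by simp
  ultimately have "2 / 3 * m * l \<le> J" by linarith
  then have "(2 / 3 * m * l)\<^sup>2 \<le> J\<^sup>2" using m l by (intro power_mono) auto
  then have "(2 / 3 * m * l)\<^sup>2 * T \<le> J\<^sup>2 * T" using T by (intro mult_right_mono) auto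
  moreover have "(2 / 3 * m * l)\<^sup>2 * T = 4 / 9 * m\<^sup>2 * (l\<^sup>2 * T)" by (simp add: power_mult_distrib power_divide)
  then have "(2 / 3 * m * l)\<^sup>2 * T = 4 / 9 * m ^ 3" unfolding l(2) by (simp add: power2_eq_square power3_eq_cube)
  ultimately have "4 / 9 * m ^ 3 \<le> J\<^sup>2 * T" by linarith
  also have "\<dots> = J * (J * T)" by (simp add: power2_eq_square)
  also have "\<dots> \<le> J * (pi\<^sup>2 / 2)" using JT J by (intro mult_left_mono)
  finally show ?thesis by (simp add: field_simps)
qed (use J in simp)

text \<open>The vectors r (1, t) and q (1, s) have determinant r q (s - t), so the double integral
  depends on \<open>f\<close> only through the second moments h(t) = \<integral> r^2 f(r (1, t)) dr
  along lines and equals \<integral> h pot. The support bound \<open>D\<close> makes the moments of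
  \<open>h\<close> finite, as \<open>moment_weight\<close> demands.\<close>

theorem functional_busemann:
  fixes f :: "real^2 \<Rightarrow> real"
  assumes fm[measurable]: "f \<in> borel_measurable borel"
    and f0: "\<And>u. 0 \<le> f u" and f1: "\<And>u. f u \<le> 1"
    and supp: "\<And>u. D < norm u \<Longrightarrow> f u = 0"
  shows "ennreal (8 / (9 * pi\<^sup>2)) * (\<integral>\<^sup>+u. ennreal (f u) \<partial>lborel) ^ 3 \<le>
    (\<integral>\<^sup>+u. (\<integral>\<^sup>+v. ennreal (\<bar>det2 u v\<bar> * f u * f v) \<partial>lborel) \<partial>lborel)"
proof -
  define e where "e t = vec2 1 t" for t
  have em[measurable]: "e \<in> borel_measurable borel" unfolding e_def by measurable
  define H where "H t = (\<integral>\<^sup>+r. ennreal (r\<^sup>2 * f (r *\<^sub>R e t)) \<partial>lborel)" for t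
  have Hm[measurable]: "H \<in> borel_measurable borel" unfolding H_def by measurable
  define h where "h t = enn2real (H t)" for t
  have hm[measurable]: "h \<in> borel_measurable borel" unfolding h_def by measurable
  have r_le: "\<bar>r\<bar> \<le> norm (r *\<^sub>R e t)" for r t
    using component_le_norm_cart[of "r *\<^sub>R e t" 1] by (simp add: e_def)
  have H_fin: "H t < \<infinity>" for t
  proof -
    have "H t \<le> (\<integral>\<^sup>+r. ennreal (D\<^sup>2) * indicator {- \<bar>D\<bar>..\<bar>D\<bar>} r \<partial>lborel)"
      unfolding H_def
    proof (rule nn_integral_mono)
      fix r :: real
      show "ennreal (r\<^sup>2 * f (r *\<^sub>R e t)) \<le> ennreal (D\<^sup>2) * indicator {- \<bar>D\<bar>..\<bar>D\<bar>} r"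
      proof (cases "\<bar>r\<bar> \<le> \<bar>D\<bar>")
        case True
        then have "r\<^sup>2 * f (r *\<^sub>R e t) \<le> D\<^sup>2 * 1"
          using f0 f1 by (intro mult_mono) (auto simp: abs_le_square_iff)
        then show ?thesis using True by (auto simp: indicator_def intro!: ennreal_leI)
      next
        case False
        then have "D < norm (r *\<^sub>R e t)" using r_le[of r t] by linarith
        then show ?thesis using supp by simp
      qed
    qed
    also have "\<dots> < \<infinity>" by (subst nn_integral_cmult) (auto simp: ennreal_mult_less_top)
    finally show ?thesis .
  qed
  have hH: "ennreal (h t) = H t" for t
    unfolding h_def using H_fin[of t] by simp
  have h0: "0 \<le> h t" for t by (simp add: h_def)
  have cb[measurable]: "cball (0 :: real^2) D \<in> sets borel" by simp
  have cb_fin: "emeasure lborel (cball (0 :: real^2) D) < \<infinity>" by (rule emeasure_compact_finite[OF compact_cball])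
  \<comment> \<open>Since u = r (1, t) has the coordinates r and r t, the cases i = 1 and i = 2
    become the moments of \<open>h\<close> of order 0 and 1.\<close>
  have fin: "(\<integral>\<^sup>+u. ennreal (\<bar>u $ i\<bar> * f u) \<partial>lborel) < \<infinity>" for i
  proof -
    have "(\<integral>\<^sup>+u. ennreal (\<bar>u $ i\<bar> * f u) \<partial>lborel) \<le> (\<integral>\<^sup>+u. ennreal \<bar>D\<bar> * indicator (cball 0 D :: (real^2) set) u \<partial>lborel)"
    proof (rule nn_integral_mono)
      fix u :: "real^2"
      show "ennreal (\<bar>u $ i\<bar> * f u) \<le> ennreal \<bar>D\<bar> * indicator (cball 0 D) u"
      proof (cases "norm u \<le> D")
        case True
        then have "\<bar>u $ i\<bar> \<le> \<bar>D\<bar>" using component_le_norm_cart[of u i] by linarith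
        then have "\<bar>u $ i\<bar> * f u \<le> \<bar>D\<bar> * 1" using f0 f1 by (intro mult_mono) auto
        then show ?thesis using True by (auto simp: indicator_def intro!: ennreal_leI)
      qed (use supp in auto)
    qed
    also have "\<dots> < \<infinity>"
      by (subst nn_integral_cmult) (use cb_fin in \<open>auto simp: ennreal_mult_less_top\<close>)
    finally show ?thesis .
  qed
  have slope1: "(\<integral>\<^sup>+u. ennreal (\<bar>u $ 1\<bar> * f u) \<partial>lborel) = (\<integral>\<^sup>+t. H t \<partial>lborel)"
  proof -
    have "(\<integral>\<^sup>+u. ennreal (\<bar>u $ 1\<bar> * f u) \<partial>lborel) =
      (\<integral>\<^sup>+t. (\<integral>\<^sup>+r. ennreal \<bar>r\<bar> * ennreal (\<bar>(r *\<^sub>R vec2 1 t) $ 1\<bar> * f (r *\<^sub>R vec2 1 t)) \<partial>lborel) \<partial>lborel)"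
      by (rule nn_integral_slope) measurable
    also have "\<dots> = (\<integral>\<^sup>+t. H t \<partial>lborel)"
      unfolding H_def e_def
      by (intro nn_integral_cong) (simp add: ennreal_mult[symmetric] f0 power2_eq_square abs_mult_self_eq flip: mult.assoc)
    finally show ?thesis .
  qed
  have slope2: "(\<integral>\<^sup>+u. ennreal (\<bar>u $ 2\<bar> * f u) \<partial>lborel) = (\<integral>\<^sup>+t. ennreal \<bar>t\<bar> * H t \<partial>lborel)"
  proof -
    have "(\<integral>\<^sup>+u. ennreal (\<bar>u $ 2\<bar> * f u) \<partial>lborel) =
      (\<integral>\<^sup>+t. (\<integral>\<^sup>+r. ennreal \<bar>r\<bar> * ennreal (\<bar>(r *\<^sub>R vec2 1 t) $ 2\<bar> * f (r *\<^sub>R vec2 1 t)) \<partial>lborel) \<partial>lborel)"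
      by (rule nn_integral_slope) measurable
    also have "\<dots> = (\<integral>\<^sup>+t. (\<integral>\<^sup>+r. ennreal \<bar>t\<bar> * ennreal (r\<^sup>2 * f (r *\<^sub>R e t)) \<partial>lborel) \<partial>lborel)"
      unfolding e_def
    proof (intro nn_integral_cong)
      fix t r :: real
      have "\<bar>r\<bar> * (\<bar>r * t\<bar> * f (r *\<^sub>R vec2 1 t)) = \<bar>t\<bar> * (r\<^sup>2 * f (r *\<^sub>R vec2 1 t))"
      proof -
        have "\<bar>r\<bar> * \<bar>r\<bar> = r\<^sup>2" by (simp add: power2_eq_square)
        moreover have "\<bar>r\<bar> * (\<bar>r * t\<bar> * f (r *\<^sub>R vec2 1 t)) = \<bar>t\<bar> * ((\<bar>r\<bar> * \<bar>r\<bar>) * f (r *\<^sub>R vec2 1 t))"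
          by (simp only: abs_mult mult_ac)
        ultimately show ?thesis by simp
      qed
      then show "ennreal \<bar>r\<bar> * ennreal (\<bar>(r *\<^sub>R vec2 1 t) $ 2\<bar> * f (r *\<^sub>R vec2 1 t)) = ennreal \<bar>t\<bar> * ennreal (r\<^sup>2 * f (r *\<^sub>R vec2 1 t))"
        by (simp add: f0 flip: ennreal_mult)
    qed
    also have "\<dots> = (\<integral>\<^sup>+t. ennreal \<bar>t\<bar> * H t \<partial>lborel)"
      unfolding H_def by (intro nn_integral_cong nn_integral_cmult) measurable
    finally show ?thesis .
  qed
  have slope0: "(\<integral>\<^sup>+u. ennreal (f u) \<partial>lborel) = (\<integral>\<^sup>+t. (\<integral>\<^sup>+r. ennreal (\<bar>r\<bar> * f (r *\<^sub>R e t)) \<partial>lborel) \<partial>lborel)"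
  proof -
    have "(\<integral>\<^sup>+u. ennreal (f u) \<partial>lborel) = (\<integral>\<^sup>+t. (\<integral>\<^sup>+r. ennreal \<bar>r\<bar> * ennreal (f (r *\<^sub>R vec2 1 t)) \<partial>lborel) \<partial>lborel)"
      by (rule nn_integral_slope) measurable
    then show ?thesis by (simp add: e_def f0 ennreal_mult)
  qed
  define M where "M = (\<integral>\<^sup>+u. ennreal (f u) \<partial>lborel)"
  have M_fin: "M < \<infinity>"
  proof -
    have "M \<le> (\<integral>\<^sup>+u. indicator (cball 0 D :: (real^2) set) u \<partial>lborel)"
      unfolding M_def
    proof (rule nn_integral_mono)
      fix u :: "real^2"
      show "ennreal (f u) \<le> indicator (cball 0 D) u"
        using f1[of u] supp[of u] by (cases "norm u \<le> D") (auto simp: indicator_def)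
    qed
    also have "\<dots> < \<infinity>" using cb_fin by simp
    finally show ?thesis .
  qed
  have int0: "integrable lborel h"
    using fin[of 1] unfolding slope1 by (intro integrableI_nonneg) (auto simp: hH h0)
  have "integrable lborel (\<lambda>t. \<bar>t\<bar> * h t)"
    using fin[of 2] unfolding slope2 by (intro integrableI_nonneg) (auto simp: hH h0 ennreal_mult)
  then have int1: "integrable lborel (\<lambda>t. t * h t)"
    by (rule Bochner_Integration.integrable_bound) (auto simp: abs_mult)
  define JJ where "JJ = (\<integral>\<^sup>+u. (\<integral>\<^sup>+v. ennreal (\<bar>det2 u v\<bar> * f u * f v) \<partial>lborel) \<partial>lborel)"
  have JJ: "JJ = (\<integral>\<^sup>+t. H t * (\<integral>\<^sup>+s. ennreal \<bar>t - s\<bar> * H s \<partial>lborel) \<partial>lborel)"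
  proof -
    have inner: "(\<integral>\<^sup>+v. ennreal (\<bar>det2 (r *\<^sub>R e t) v\<bar> * f (r *\<^sub>R e t) * f v) \<partial>lborel) =
        ennreal (\<bar>r\<bar> * f (r *\<^sub>R e t)) * (\<integral>\<^sup>+s. ennreal \<bar>t - s\<bar> * H s \<partial>lborel)" for r t
    proof -
      have "(\<integral>\<^sup>+v. ennreal (\<bar>det2 (r *\<^sub>R e t) v\<bar> * f (r *\<^sub>R e t) * f v) \<partial>lborel) =
        (\<integral>\<^sup>+s. (\<integral>\<^sup>+q. ennreal \<bar>q\<bar> * ennreal (\<bar>det2 (r *\<^sub>R e t) (q *\<^sub>R vec2 1 s)\<bar> * f (r *\<^sub>R e t) * f (q *\<^sub>R vec2 1 s)) \<partial>lborel) \<partial>lborel)"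
        by (rule nn_integral_slope) measurable
      also have "\<dots> = (\<integral>\<^sup>+s. (\<integral>\<^sup>+q. ennreal (\<bar>r\<bar> * f (r *\<^sub>R e t)) * (ennreal \<bar>t - s\<bar> * ennreal (q\<^sup>2 * f (q *\<^sub>R e s))) \<partial>lborel) \<partial>lborel)"
      proof (intro nn_integral_cong)
        fix s q :: real
        have "det2 (r *\<^sub>R e t) (q *\<^sub>R vec2 1 s) = r * q * (s - t)"
          by (simp add: det2_def e_def algebra_simps)
        then have "\<bar>q\<bar> * (\<bar>det2 (r *\<^sub>R e t) (q *\<^sub>R vec2 1 s)\<bar> * f (r *\<^sub>R e t) * f (q *\<^sub>R vec2 1 s))
          = \<bar>r\<bar> * f (r *\<^sub>R e t) * (\<bar>t - s\<bar> * ((\<bar>q\<bar> * \<bar>q\<bar>) * f (q *\<^sub>R e s)))"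
          by (simp only: abs_mult abs_minus_commute[of s t] e_def mult_ac)
        moreover have "\<bar>q\<bar> * \<bar>q\<bar> = q\<^sup>2" by (simp add: power2_eq_square)
        ultimately have "\<bar>q\<bar> * (\<bar>det2 (r *\<^sub>R e t) (q *\<^sub>R vec2 1 s)\<bar> * f (r *\<^sub>R e t) * f (q *\<^sub>R vec2 1 s))
          = \<bar>r\<bar> * f (r *\<^sub>R e t) * (\<bar>t - s\<bar> * (q\<^sup>2 * f (q *\<^sub>R e s)))" by (simp only:)
        then show "ennreal \<bar>q\<bar> * ennreal (\<bar>det2 (r *\<^sub>R e t) (q *\<^sub>R vec2 1 s)\<bar> * f (r *\<^sub>R e t) * f (q *\<^sub>R vec2 1 s))
          = ennreal (\<bar>r\<bar> * f (r *\<^sub>R e t)) * (ennreal \<bar>t - s\<bar> * ennreal (q\<^sup>2 * f (q *\<^sub>R e s)))"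
          by (simp add: f0 flip: ennreal_mult)
      qed
      also have "\<dots> = (\<integral>\<^sup>+s. ennreal (\<bar>r\<bar> * f (r *\<^sub>R e t)) * (ennreal \<bar>t - s\<bar> * H s) \<partial>lborel)"
      proof (rule nn_integral_cong)
        fix s
        have [measurable]: "(\<lambda>q. ennreal (q\<^sup>2 * f (q *\<^sub>R e s))) \<in> borel_measurable lborel" by measurable
        show "(\<integral>\<^sup>+q. ennreal (\<bar>r\<bar> * f (r *\<^sub>R e t)) * (ennreal \<bar>t - s\<bar> * ennreal (q\<^sup>2 * f (q *\<^sub>R e s))) \<partial>lborel) =
          ennreal (\<bar>r\<bar> * f (r *\<^sub>R e t)) * (ennreal \<bar>t - s\<bar> * H s)"
          unfolding H_def by (simp add: nn_integral_cmult)
      qed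
      also have "\<dots> = ennreal (\<bar>r\<bar> * f (r *\<^sub>R e t)) * (\<integral>\<^sup>+s. ennreal \<bar>t - s\<bar> * H s \<partial>lborel)"
        by (rule nn_integral_cmult) measurable
      finally show ?thesis .
    qed
    have "JJ = (\<integral>\<^sup>+t. (\<integral>\<^sup>+r. ennreal \<bar>r\<bar> * (\<integral>\<^sup>+v. ennreal (\<bar>det2 (r *\<^sub>R vec2 1 t) v\<bar> * f (r *\<^sub>R vec2 1 t) * f v) \<partial>lborel) \<partial>lborel) \<partial>lborel)"
      unfolding JJ_def by (rule nn_integral_slope) measurable
    also have "\<dots> = (\<integral>\<^sup>+t. (\<integral>\<^sup>+r. ennreal (r\<^sup>2 * f (r *\<^sub>R e t)) * (\<integral>\<^sup>+s. ennreal \<bar>t - s\<bar> * H s \<partial>lborel) \<partial>lborel) \<partial>lborel)"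
    proof (intro nn_integral_cong)
      fix t r :: real
      have "ennreal \<bar>r\<bar> * ennreal (\<bar>r\<bar> * f (r *\<^sub>R e t)) = ennreal (r\<^sup>2 * f (r *\<^sub>R e t))"
        by (simp add: f0 power2_eq_square flip: ennreal_mult mult.assoc)
      then show "ennreal \<bar>r\<bar> * (\<integral>\<^sup>+v. ennreal (\<bar>det2 (r *\<^sub>R vec2 1 t) v\<bar> * f (r *\<^sub>R vec2 1 t) * f v) \<partial>lborel) =
        ennreal (r\<^sup>2 * f (r *\<^sub>R e t)) * (\<integral>\<^sup>+s. ennreal \<bar>t - s\<bar> * H s \<partial>lborel)"
        unfolding e_def[symmetric] inner by (simp add: mult.assoc[symmetric])
    qed
    also have "\<dots> = (\<integral>\<^sup>+t. H t * (\<integral>\<^sup>+s. ennreal \<bar>t - s\<bar> * H s \<partial>lborel) \<partial>lborel)"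
      unfolding H_def by (intro nn_integral_cong nn_integral_multc) measurable
    finally show ?thesis .
  qed
  show ?thesis
  proof (cases "(\<integral>t. h t \<partial>lborel) = 0")
    \<comment> \<open>Outside the range of \<open>moment_weight\<close>: here r^2 f vanishes almost
      everywhere on almost every line, hence so does \<bar>r\<bar> f, and the mass of
      \<open>f\<close> is 0.\<close>
    case True
    then have "AE t in lborel. h t = 0"
      using int0 h0 by (subst (asm) integral_nonneg_eq_0_iff_AE) auto
    then have "AE t in lborel. (\<integral>\<^sup>+r. ennreal (\<bar>r\<bar> * f (r *\<^sub>R e t)) \<partial>lborel) = 0"
    proof eventually_elim
      fix t assume "h t = 0"
      then have "H t = 0" using hH[of t] by simp
      then have "AE r in lborel. ennreal (r\<^sup>2 * f (r *\<^sub>R e t)) = 0"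
        unfolding H_def by (subst (asm) nn_integral_0_iff_AE) auto
      then have "AE r in lborel. ennreal (\<bar>r\<bar> * f (r *\<^sub>R e t)) = 0"
      proof eventually_elim
        fix r assume "ennreal (r\<^sup>2 * f (r *\<^sub>R e t)) = 0"
        then have "r\<^sup>2 * f (r *\<^sub>R e t) \<le> 0" by (simp add: ennreal_eq_0_iff)
        then have "r = 0 \<or> f (r *\<^sub>R e t) = 0" using f0[of "r *\<^sub>R e t"] by (auto simp: mult_le_0_iff)
        then show "ennreal (\<bar>r\<bar> * f (r *\<^sub>R e t)) = 0" by auto
      qed
      then show "(\<integral>\<^sup>+r. ennreal (\<bar>r\<bar> * f (r *\<^sub>R e t)) \<partial>lborel) = 0"
        by (subst nn_integral_0_iff_AE) auto
    qed
    then have "(\<integral>\<^sup>+u. ennreal (f u) \<partial>lborel) = 0"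
      unfolding slope0 by (subst nn_integral_0_iff_AE) auto
    then show ?thesis by simp
  next
    case False
    moreover have "0 \<le> (\<integral>t. h t \<partial>lborel)" using h0 by (intro Bochner_Integration.integral_nonneg) auto
    ultimately have "0 < (\<integral>t. h t \<partial>lborel)" by linarith
    then interpret W: moment_weight h
      using h0 int0 int1 by unfold_locales auto
    define J where "J = (\<integral>t. h t * W.pot t \<partial>lborel)"
    define T where "T = (\<integral>t. 1 / (W.pot t)\<^sup>2 \<partial>lborel)"
    note sant = W.santalo[folded J_def T_def]
    have pot_nn: "(\<integral>\<^sup>+s. ennreal \<bar>t - s\<bar> * H s \<partial>lborel) = ennreal (W.pot t)" for t
    proof -
      have "(\<integral>\<^sup>+s. ennreal \<bar>t - s\<bar> * H s \<partial>lborel) = (\<integral>\<^sup>+s. ennreal (\<bar>t - s\<bar> * h s) \<partial>lborel)"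
        by (intro nn_integral_cong) (simp add: ennreal_mult h0 hH)
      also have "\<dots> = ennreal (W.pot t)"
        unfolding W.pot_def using W.int_pot[of t] h0 by (intro nn_integral_eq_integral) auto
      finally show ?thesis .
    qed
    have hpot: "H t * ennreal (W.pot t) = ennreal (h t * W.pot t)" for t
      using W.pot_pos[of t] by (simp add: ennreal_mult h0 hH)
    have hp0: "0 \<le> h t * W.pot t" for t using W.pot_pos[of t] h0[of t] by simp
    have JJ_J: "JJ = ennreal J"
      unfolding JJ pot_nn hpot J_def using sant(1) hp0 by (intro nn_integral_eq_integral) auto
    have J0: "0 \<le> J" unfolding J_def using hp0 by (intro Bochner_Integration.integral_nonneg) auto
    define m where "m = enn2real M"
    have mM: "M = ennreal m" using M_fin by (simp add: m_def)
    have m0: "0 \<le> m" by (simp add: m_def)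
    \<comment> \<open>On each line, l \<bar>r\<bar> f is split as N r^2 f + (l \<bar>r\<bar> - N
      r^2) f. The first part integrates to \<open>J\<close>; the bound f \<le> 1 and
      \<open>bathtub_integral\<close> handle the second. The same \<open>l\<close> is used for all
      slopes.\<close>
    have lin: "l * m \<le> J + l ^ 3 / 3 * T" if l: "0 < l" for l
    proof -
      have T_nn: "(\<integral>\<^sup>+t. ennreal (l ^ 3 / (3 * (W.pot t)\<^sup>2)) \<partial>lborel) = ennreal (l ^ 3 / 3 * T)"
      proof -
        have "(\<integral>\<^sup>+t. ennreal (l ^ 3 / 3 * (1 / (W.pot t)\<^sup>2)) \<partial>lborel) = ennreal (\<integral>t. l ^ 3 / 3 * (1 / (W.pot t)\<^sup>2) \<partial>lborel)"
          using W.integrable_inverse_pot l by (intro nn_integral_eq_integral integrable_mult_right) auto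
        also have "(\<integral>t. l ^ 3 / 3 * (1 / (W.pot t)\<^sup>2) \<partial>lborel) = l ^ 3 / 3 * T"
          unfolding T_def by (rule integral_mult_right_zero)
        finally show ?thesis by (simp only: times_divide_times_eq mult_1_right)
      qed
      have "ennreal (l * m) = ennreal l * M" using l m0 by (simp add: mM ennreal_mult)
      also have "\<dots> = (\<integral>\<^sup>+t. ennreal l * (\<integral>\<^sup>+r. ennreal (\<bar>r\<bar> * f (r *\<^sub>R e t)) \<partial>lborel) \<partial>lborel)"
        unfolding M_def slope0 by (rule nn_integral_cmult[symmetric]) measurable
      also have "\<dots> \<le> (\<integral>\<^sup>+t. ennreal (h t * W.pot t) + ennreal (l ^ 3 / (3 * (W.pot t)\<^sup>2)) \<partial>lborel)"
      proof (rule nn_integral_mono)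
        fix t
        let ?N = "W.pot t"
        have "ennreal l * (\<integral>\<^sup>+r. ennreal (\<bar>r\<bar> * f (r *\<^sub>R e t)) \<partial>lborel) = (\<integral>\<^sup>+r. ennreal l * ennreal (\<bar>r\<bar> * f (r *\<^sub>R e t)) \<partial>lborel)"
          by (rule nn_integral_cmult[symmetric]) measurable
        also have "\<dots> \<le> (\<integral>\<^sup>+r. ennreal (r\<^sup>2 * f (r *\<^sub>R e t)) * ennreal ?N + ennreal (max 0 (l * \<bar>r\<bar> - ?N * r\<^sup>2)) \<partial>lborel)"
        proof (rule nn_integral_mono)
          fix r :: real
          let ?f = "f (r *\<^sub>R e t)"
          have "(l * \<bar>r\<bar> - ?N * r\<^sup>2) * ?f \<le> max 0 (l * \<bar>r\<bar> - ?N * r\<^sup>2) * ?f"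
            using f0 by (intro mult_right_mono) auto
          also have "\<dots> \<le> max 0 (l * \<bar>r\<bar> - ?N * r\<^sup>2) * 1"
            using f1 by (intro mult_left_mono) auto
          finally have "l * (\<bar>r\<bar> * ?f) \<le> r\<^sup>2 * ?f * ?N + max 0 (l * \<bar>r\<bar> - ?N * r\<^sup>2)"
            by (simp add: algebra_simps)
          then have "ennreal (l * (\<bar>r\<bar> * ?f)) \<le> ennreal (r\<^sup>2 * ?f * ?N + max 0 (l * \<bar>r\<bar> - ?N * r\<^sup>2))"
            by (rule ennreal_leI)
          also have "\<dots> = ennreal (r\<^sup>2 * ?f) * ennreal ?N + ennreal (max 0 (l * \<bar>r\<bar> - ?N * r\<^sup>2))"
            using f0[of "r *\<^sub>R e t"] W.pot_pos[of t] by (simp add: ennreal_mult ennreal_plus)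
          finally show "ennreal l * ennreal (\<bar>r\<bar> * ?f) \<le> ennreal (r\<^sup>2 * ?f) * ennreal ?N + ennreal (max 0 (l * \<bar>r\<bar> - ?N * r\<^sup>2))"
            using l f0 by (simp add: ennreal_mult)
        qed
        also have "\<dots> = (\<integral>\<^sup>+r. ennreal (r\<^sup>2 * f (r *\<^sub>R e t)) * ennreal ?N \<partial>lborel) + (\<integral>\<^sup>+r. ennreal (max 0 (l * \<bar>r\<bar> - ?N * r\<^sup>2)) \<partial>lborel)"
          by (rule nn_integral_add) measurable
        also have "(\<integral>\<^sup>+r. ennreal (r\<^sup>2 * f (r *\<^sub>R e t)) * ennreal ?N \<partial>lborel) = H t * ennreal ?N"
          unfolding H_def by (rule nn_integral_multc) measurable
        also have "H t * ennreal ?N + (\<integral>\<^sup>+r. ennreal (max 0 (l * \<bar>r\<bar> - ?N * r\<^sup>2)) \<partial>lborel)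
            \<le> ennreal (h t * ?N) + ennreal (l ^ 3 / (3 * ?N\<^sup>2))"
          unfolding hpot by (intro add_left_mono bathtub_integral W.pot_pos l)
        finally show "ennreal l * (\<integral>\<^sup>+r. ennreal (\<bar>r\<bar> * f (r *\<^sub>R e t)) \<partial>lborel) \<le> ennreal (h t * ?N) + ennreal (l ^ 3 / (3 * ?N\<^sup>2))" .
      qed
      also have "\<dots> = (\<integral>\<^sup>+t. ennreal (h t * W.pot t) \<partial>lborel) + (\<integral>\<^sup>+t. ennreal (l ^ 3 / (3 * (W.pot t)\<^sup>2)) \<partial>lborel)"
        by (rule nn_integral_add) measurable
      also have "(\<integral>\<^sup>+t. ennreal (h t * W.pot t) \<partial>lborel) = ennreal J"
        using JJ_J unfolding JJ pot_nn hpot .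
      also have "ennreal J + (\<integral>\<^sup>+t. ennreal (l ^ 3 / (3 * (W.pot t)\<^sup>2)) \<partial>lborel) = ennreal (J + l ^ 3 / 3 * T)"
        unfolding T_nn using J0 l sant(2) by (intro ennreal_plus[symmetric]) auto
      finally show ?thesis
        using J0 l sant(2) by (subst (asm) ennreal_le_iff) (auto intro!: add_nonneg_nonneg)
    qed
    have "8 / (9 * pi\<^sup>2) * m ^ 3 \<le> J"
      by (rule cubic_bound_of_linear_bounds[OF m0 sant(2) J0 lin sant(3)])
    then have "ennreal (8 / (9 * pi\<^sup>2) * m ^ 3) \<le> JJ" unfolding JJ_J by (rule ennreal_leI)
    moreover have "ennreal (8 / (9 * pi\<^sup>2) * m ^ 3) = ennreal (8 / (9 * pi\<^sup>2)) * ennreal m ^ 3"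
      unfolding ennreal_power[OF m0] by (rule ennreal_mult) (use m0 in auto)
    ultimately show ?thesis
      unfolding JJ_def[symmetric] M_def[symmetric] mM by simp
  qed
qed

section \<open>The crossing integral\<close>

lemma nn_integral_shift:
  fixes G :: "'a::euclidean_space \<Rightarrow> ennreal"
  assumes "G \<in> borel_measurable borel"
  shows "(\<integral>\<^sup>+x. G x \<partial>lborel) = (\<integral>\<^sup>+x. G (c + x) \<partial>lborel)"
  by (subst lborel_distr_plus[symmetric, of c]) (simp add: nn_integral_distr assms)

text \<open>The substitution x = c + t u - s v is carried out one variable at a time: first the
  second coordinate is replaced by \<open>s\<close> at fixed first coordinate, then the first by
  \<open>t\<close> at fixed \<open>s\<close>. The second step divides by
  \<open>u $ 1\<close>.\<close>

lemma nn_integral_linear_aux: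
  fixes G :: "real^2 \<Rightarrow> ennreal"
  assumes Gm[measurable]: "G \<in> borel_measurable borel" and det: "det2 u v \<noteq> 0" and u1: "u $ 1 \<noteq> 0"
  shows "(\<integral>\<^sup>+x. G x \<partial>lborel) =
    ennreal \<bar>det2 u v\<bar> * (\<integral>\<^sup>+t. (\<integral>\<^sup>+s. G (c + t *\<^sub>R u - s *\<^sub>R v) \<partial>lborel) \<partial>lborel)"
proof -
  define \<kappa> where "\<kappa> = - det2 u v / u $ 1"
  have \<kappa>: "\<kappa> \<noteq> 0" "\<bar>u $ 1\<bar> * \<bar>\<kappa>\<bar> = \<bar>det2 u v\<bar>" using det u1 by (auto simp: \<kappa>_def abs_divide)
  \<comment> \<open>The second coordinate of c + t u - s v once \<open>t\<close> has been eliminated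
    through the first coordinate \<open>a\<close>; \<kappa> is the resulting coefficient of
    \<open>s\<close>.\<close>
  define y where "y a s = c $ 2 + u $ 2 * (a - c $ 1) / u $ 1 + \<kappa> * s" for a s
  have ym[measurable]: "case_prod y \<in> borel_measurable (borel \<Otimes>\<^sub>M borel)"
    unfolding y_def by measurable
  have "(\<integral>\<^sup>+x. G x \<partial>lborel) = (\<integral>\<^sup>+a. (\<integral>\<^sup>+b. G (vec2 a b) \<partial>lborel) \<partial>lborel)"
    by (rule nn_integral_vec2) simp
  also have "\<dots> = (\<integral>\<^sup>+a. ennreal \<bar>\<kappa>\<bar> * (\<integral>\<^sup>+s. G (vec2 a (y a s)) \<partial>lborel) \<partial>lborel)"
  proof (rule nn_integral_cong)
    fix a
    show "(\<integral>\<^sup>+b. G (vec2 a b) \<partial>lborel) = ennreal \<bar>\<kappa>\<bar> * (\<integral>\<^sup>+s. G (vec2 a (y a s)) \<partial>lborel)"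
      unfolding y_def by (rule nn_integral_real_affine[OF _ \<kappa>(1)]) measurable
  qed
  also have "\<dots> = ennreal \<bar>\<kappa>\<bar> * (\<integral>\<^sup>+a. (\<integral>\<^sup>+s. G (vec2 a (y a s)) \<partial>lborel) \<partial>lborel)"
    by (rule nn_integral_cmult) measurable
  also have "(\<integral>\<^sup>+a. (\<integral>\<^sup>+s. G (vec2 a (y a s)) \<partial>lborel) \<partial>lborel) = (\<integral>\<^sup>+s. (\<integral>\<^sup>+a. G (vec2 a (y a s)) \<partial>lborel) \<partial>lborel)"
    by (rule lborel_pair.Fubini'[symmetric]) measurable
  also have "\<dots> = (\<integral>\<^sup>+s. ennreal \<bar>u $ 1\<bar> * (\<integral>\<^sup>+t. G (c + t *\<^sub>R u - s *\<^sub>R v) \<partial>lborel) \<partial>lborel)"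
  proof (rule nn_integral_cong)
    fix s
    have e: "vec2 ((c $ 1 - s * v $ 1) + u $ 1 * t) (y ((c $ 1 - s * v $ 1) + u $ 1 * t) s) = c + t *\<^sub>R u - s *\<^sub>R v" for t
      using u1 by (simp add: vec2_eq_iff y_def \<kappa>_def det2_def field_simps)
    have "(\<integral>\<^sup>+a. G (vec2 a (y a s)) \<partial>lborel) =
      ennreal \<bar>u $ 1\<bar> * (\<integral>\<^sup>+t. G (vec2 ((c $ 1 - s * v $ 1) + u $ 1 * t) (y ((c $ 1 - s * v $ 1) + u $ 1 * t) s)) \<partial>lborel)"
      by (rule nn_integral_real_affine[OF _ u1]) measurable
    then show "(\<integral>\<^sup>+a. G (vec2 a (y a s)) \<partial>lborel) = ennreal \<bar>u $ 1\<bar> * (\<integral>\<^sup>+t. G (c + t *\<^sub>R u - s *\<^sub>R v) \<partial>lborel)"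
      unfolding e .
  qed
  also have "\<dots> = ennreal \<bar>u $ 1\<bar> * (\<integral>\<^sup>+s. (\<integral>\<^sup>+t. G (c + t *\<^sub>R u - s *\<^sub>R v) \<partial>lborel) \<partial>lborel)"
    by (rule nn_integral_cmult) measurable
  also have "(\<integral>\<^sup>+s. (\<integral>\<^sup>+t. G (c + t *\<^sub>R u - s *\<^sub>R v) \<partial>lborel) \<partial>lborel) = (\<integral>\<^sup>+t. (\<integral>\<^sup>+s. G (c + t *\<^sub>R u - s *\<^sub>R v) \<partial>lborel) \<partial>lborel)"
    by (rule lborel_pair.Fubini') measurable
  finally show ?thesis
    by (simp add: \<kappa>(2)[symmetric] ennreal_mult mult_ac)
qed

text \<open>If \<open>u\<close> is vertical, the nonzero determinant forces \<open>v $ 1\<close> to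
  be nonzero, and the pair (- v, - u) parametrises the same points with the two parameters
  interchanged.\<close>

lemma nn_integral_linear:
  fixes G :: "real^2 \<Rightarrow> ennreal"
  assumes Gm[measurable]: "G \<in> borel_measurable borel" and det: "det2 u v \<noteq> 0"
  shows "(\<integral>\<^sup>+x. G x \<partial>lborel) =
    ennreal \<bar>det2 u v\<bar> * (\<integral>\<^sup>+t. (\<integral>\<^sup>+s. G (c + t *\<^sub>R u - s *\<^sub>R v) \<partial>lborel) \<partial>lborel)"
proof (cases "u $ 1 = 0")
  case False
  then show ?thesis by (rule nn_integral_linear_aux[OF Gm det])
next
  case True
  then have "(- v) $ 1 \<noteq> 0" "det2 (- v) (- u) \<noteq> 0" using det by (auto simp: det2_def)
  from nn_integral_linear_aux[OF Gm this(2) this(1), of c]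
  have "(\<integral>\<^sup>+x. G x \<partial>lborel) =
    ennreal \<bar>det2 (- v) (- u)\<bar> * (\<integral>\<^sup>+s. (\<integral>\<^sup>+t. G (c + s *\<^sub>R (- v) - t *\<^sub>R (- u)) \<partial>lborel) \<partial>lborel)" .
  also have "\<bar>det2 (- v) (- u)\<bar> = \<bar>det2 u v\<bar>" by (simp add: det2_def abs_minus_commute mult.commute)
  also have "(\<lambda>s t. G (c + s *\<^sub>R (- v) - t *\<^sub>R (- u))) = (\<lambda>s t. G (c + t *\<^sub>R u - s *\<^sub>R v))"
    by (simp add: fun_eq_iff algebra_simps)
  also have "(\<integral>\<^sup>+s. (\<integral>\<^sup>+t. G (c + t *\<^sub>R u - s *\<^sub>R v) \<partial>lborel) \<partial>lborel) = (\<integral>\<^sup>+t. (\<integral>\<^sup>+s. G (c + t *\<^sub>R u - s *\<^sub>R v) \<partial>lborel) \<partial>lborel)"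
    by (rule lborel_pair.Fubini') measurable
  finally show ?thesis .
qed

text \<open>Open segments give no closed condition directly. Exhausting the parameter square by
  compact squares makes each piece the projection of a closed set along a compact factor, hence
  closed; the distinctness of the endpoints is an open condition.\<close>

lemma crosses_borel: "{(a, b, c, d). crosses a b c d} \<in> sets borel"
proof -
  define P :: "((real \<times> real) \<times> (real^2) \<times> (real^2) \<times> (real^2) \<times> (real^2)) set"
    where "P = {x. (1 - fst (fst x)) *\<^sub>R fst (snd x) + fst (fst x) *\<^sub>R fst (snd (snd x)) =
      (1 - snd (fst x)) *\<^sub>R fst (snd (snd (snd x))) + snd (fst x) *\<^sub>R snd (snd (snd (snd x)))}"
  have "closed P" unfolding P_def by (intro closed_Collect_eq continuous_intros)
  \<comment> \<open>The shift by 2 makes every interval nonempty, starting with the single point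
    1/2.\<close>
  define I where "I n = {1 / real (n + 2)..1 - 1 / real (n + 2)}" for n
  define Q where "Q n = {y. \<exists>x. x \<in> I n \<times> I n \<and> (x, y) \<in> P}" for n
  have Q: "closed (Q n)" for n
    unfolding Q_def I_def by (intro closed_compact_projection \<open>closed P\<close> compact_Times compact_Icc)
  have "{(a, b, c, d). crosses a b c d} = (\<Union>n. Q n) \<inter> {x. fst x \<noteq> fst (snd x)} \<inter> {x. fst (snd (snd x)) \<noteq> snd (snd (snd x))}"
    (is "?L = ?R")
  proof (intro set_eqI iffI)
    fix x assume "x \<in> ?L"
    then obtain a b c d where x: "x = (a, b, c, d)" and "crosses a b c d" by auto
    then obtain s t where ne: "a \<noteq> b" "c \<noteq> d" and st: "0 < s" "s < 1" "0 < t" "t < 1"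
      and eq: "(1 - s) *\<^sub>R a + s *\<^sub>R b = (1 - t) *\<^sub>R c + t *\<^sub>R d"
      unfolding crosses_def in_segment by metis
    define \<mu> where "\<mu> = min (min s (1 - s)) (min t (1 - t))"
    have "0 < \<mu>" using st by (simp add: \<mu>_def)
    then obtain n where n: "1 / \<mu> < real n" using reals_Archimedean2 by blast
    then have "1 / real (n + 2) \<le> \<mu>" using \<open>0 < \<mu>\<close> by (simp add: field_simps) 
    then have "(s, t) \<in> I n \<times> I n" by (auto simp: I_def \<mu>_def)
    then have "x \<in> Q n" using eq unfolding Q_def P_def x by (intro CollectI exI[of _ "(s, t)"]) simp
    then show "x \<in> ?R" using ne x by auto
  next
    fix x assume x: "x \<in> ?R"
    obtain a b c d where abcd: "x = (a, b, c, d)" by (metis surj_pair)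
    from x obtain n s t where st: "s \<in> I n" "t \<in> I n"
      and eq: "(1 - s) *\<^sub>R a + s *\<^sub>R b = (1 - t) *\<^sub>R c + t *\<^sub>R d"
      unfolding abcd Q_def P_def by auto
    have "0 < 1 / real (n + 2)" by simp
    then have "0 < s" "s < 1" "0 < t" "t < 1" using st unfolding I_def atLeastAtMost_iff by linarith+
    then have "crosses a b c d"
      unfolding crosses_def in_segment using eq x abcd
      by (intro exI[of _ "(1 - s) *\<^sub>R a + s *\<^sub>R b"]) auto
    then show "x \<in> ?L" using abcd by simp
  qed
  also have "\<dots> \<in> sets borel"
    using Q by (intro sets.Int sets.countable_UN borel_open open_Collect_neq continuous_intros) auto
  finally show ?thesis .
qed

lemma crosses_measurable:
  "(\<lambda>(a, b, c, d). of_bool (crosses a b c d) :: real) \<in>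
    borel_measurable (borel \<Otimes>\<^sub>M borel \<Otimes>\<^sub>M borel \<Otimes>\<^sub>M borel)"
proof -
  have "(\<lambda>(a, b, c, d). of_bool (crosses a b c d) :: real) = indicator {(a, b, c, d). crosses a b c d}"
    by (auto simp: fun_eq_iff indicator_def)
  then show ?thesis using crosses_borel by (simp add: borel_prod)
qed

text \<open>The common point is x + t u. A nonzero determinant makes both segments nondegenerate, as
  a nonempty open segment requires.\<close>

lemma crosses_parallelogram:
  assumes "det2 u v \<noteq> 0" "0 < t" "t < 1" "0 < s" "s < 1"
  shows "crosses x (x + u) (x + t *\<^sub>R u - s *\<^sub>R v) (x + t *\<^sub>R u - s *\<^sub>R v + v)"
proof -
  have "u \<noteq> 0" "v \<noteq> 0" using assms(1) by (auto simp: det2_def)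
  then have "x + t *\<^sub>R u \<in> open_segment x (x + u)"
    "x + t *\<^sub>R u \<in> open_segment (x + t *\<^sub>R u - s *\<^sub>R v) (x + t *\<^sub>R u - s *\<^sub>R v + v)"
    unfolding in_segment using assms
    by (auto intro!: exI[of _ t] exI[of _ s] simp: algebra_simps)
  then show ?thesis unfolding crosses_def by blast
qed

text \<open>Jensen's inequality for the cube, through the tangent at the mean a = E / A: m^3 + 2 a^3
  - 3 a^2 m = (m - a)^2 (m + 2 a) \<ge> 0, integrated over the support \<open>S\<close>.\<close>

lemma nn_integral_cube_ge:
  fixes M :: "'a \<Rightarrow> ennreal"
  assumes Mm[measurable]: "M \<in> borel_measurable N" and S[measurable]: "S \<in> sets N"
    and supp: "\<And>x. x \<in> space N \<Longrightarrow> x \<notin> S \<Longrightarrow> M x = 0"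
    and A: "emeasure N S = ennreal A" "0 < A"
    and fin: "(\<integral>\<^sup>+x. M x \<partial>N) < \<infinity>"
  shows "(\<integral>\<^sup>+x. M x \<partial>N) ^ 3 \<le> ennreal (A\<^sup>2) * (\<integral>\<^sup>+x. M x ^ 3 \<partial>N)"
proof (cases "(\<integral>\<^sup>+x. M x ^ 3 \<partial>N) = \<infinity>")
  case True
  then show ?thesis using A(2) by (simp add: ennreal_mult_top)
next
  case False
  then obtain K where K: "(\<integral>\<^sup>+x. M x ^ 3 \<partial>N) = ennreal K" "0 \<le> K"
    by (cases "\<integral>\<^sup>+x. M x ^ 3 \<partial>N") auto
  obtain E where E: "(\<integral>\<^sup>+x. M x \<partial>N) = ennreal E" "0 \<le> E"
    using fin by (cases "\<integral>\<^sup>+x. M x \<partial>N") auto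
  define a where "a = E / A"
  have a: "0 \<le> a" using E(2) A(2) by (simp add: a_def)
  have "ennreal (3 * a\<^sup>2) * ennreal E = (\<integral>\<^sup>+x. ennreal (3 * a\<^sup>2) * M x \<partial>N)"
    unfolding E(1)[symmetric] by (rule nn_integral_cmult[symmetric]) measurable
  also have "\<dots> \<le> (\<integral>\<^sup>+x. M x ^ 3 + ennreal (2 * a ^ 3) * indicator S x \<partial>N)"
  proof (rule nn_integral_mono)
    fix x assume x: "x \<in> space N"
    show "ennreal (3 * a\<^sup>2) * M x \<le> M x ^ 3 + ennreal (2 * a ^ 3) * indicator S x"
    proof (cases "x \<in> S")
      case True
      show ?thesis
      proof (cases "M x")
        case (real m)
        have "0 \<le> (m - a)\<^sup>2 * (m + 2 * a)" using real a by (intro mult_nonneg_nonneg) auto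
        then have "3 * a\<^sup>2 * m \<le> m ^ 3 + 2 * a ^ 3"
          by (simp add: power2_eq_square power3_eq_cube algebra_simps)
        then have "ennreal (3 * a\<^sup>2 * m) \<le> ennreal (m ^ 3 + 2 * a ^ 3)" by (rule ennreal_leI)
        then show ?thesis using real a True by (simp add: ennreal_mult ennreal_power)
      qed (simp add: top_power_ennreal)
    qed (use supp[OF x] in simp)
  qed
  also have "\<dots> = (\<integral>\<^sup>+x. M x ^ 3 \<partial>N) + (\<integral>\<^sup>+x. ennreal (2 * a ^ 3) * indicator S x \<partial>N)"
    by (rule nn_integral_add) measurable
  also have "(\<integral>\<^sup>+x. ennreal (2 * a ^ 3) * indicator S x \<partial>N) = ennreal (2 * a ^ 3) * ennreal A"
    by (subst nn_integral_cmult_indicator) (auto simp: A)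
  also have "(\<integral>\<^sup>+x. M x ^ 3 \<partial>N) + ennreal (2 * a ^ 3) * ennreal A = ennreal (K + 2 * a ^ 3 * A)"
    using K a A(2) by (simp add: ennreal_mult)
  finally have "ennreal (3 * a\<^sup>2 * E) \<le> ennreal (K + 2 * a ^ 3 * A)"
    using E(2) a by (subst ennreal_mult) auto
  then have "3 * a\<^sup>2 * E \<le> K + 2 * a ^ 3 * A"
    using a K(2) A(2) by (subst (asm) ennreal_le_iff) (auto intro!: add_nonneg_nonneg)
  then have "A\<^sup>2 * (3 * a\<^sup>2 * E) \<le> A\<^sup>2 * (K + 2 * a ^ 3 * A)" by (intro mult_left_mono) auto
  moreover have "A\<^sup>2 * (3 * a\<^sup>2 * E) = 3 * E ^ 3" "A\<^sup>2 * (2 * a ^ 3 * A) = 2 * E ^ 3"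
    using A(2) by (auto simp: a_def field_simps power2_eq_square power3_eq_cube)
  ultimately have "E ^ 3 \<le> A\<^sup>2 * K" by (simp add: distrib_left)
  then have "ennreal (E ^ 3) \<le> ennreal (A\<^sup>2 * K)" by (rule ennreal_leI)
  then show ?thesis using E K by (simp add: ennreal_mult ennreal_power)
qed

text \<open>Of the identity through marked points only an inequality is proved: marked pairs sharing
  a point do cross, and parallel directions have determinant 0. Nonnegative extended integrals allow
  every exchange of integrals on grounds of measurability alone.\<close>

theorem crossing_integral_bound:
  fixes w :: "(real^2) \<times> (real^2) \<Rightarrow> real" and \<Omega> :: "(real^2) set"
  assumes wm: "w \<in> borel_measurable borel"
    and w0: "\<And>z. 0 \<le> w z" and w1: "\<And>z. w z \<le> 1"
    and supp: "\<And>x y. x \<notin> \<Omega> \<or> y \<notin> \<Omega> \<Longrightarrow> w (x, y) = 0"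
    and comp: "compact \<Omega>" and conv: "convex \<Omega>"
    and A: "emeasure lborel \<Omega> = ennreal A" "0 < A"
  shows "ennreal (8 / (9 * pi\<^sup>2)) * (\<integral>\<^sup>+x. (\<integral>\<^sup>+y. ennreal (w (x, y)) \<partial>lborel) \<partial>lborel) ^ 3 \<le> ennreal (A\<^sup>2) *
    (\<integral>\<^sup>+x1. (\<integral>\<^sup>+x2. (\<integral>\<^sup>+x3. (\<integral>\<^sup>+x4. ennreal (w (x1, x2) * w (x3, x4) * of_bool (crosses x1 x2 x3 x4))
      \<partial>lborel) \<partial>lborel) \<partial>lborel) \<partial>lborel)"
proof -
  have wm'[measurable]: "w \<in> borel_measurable (borel \<Otimes>\<^sub>M borel)" using wm by (simp add: borel_prod)
  have \<Omega>m[measurable]: "\<Omega> \<in> sets borel" using comp by (simp add: borel_compact)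
  define CR :: "(real^2) \<times> (real^2) \<times> (real^2) \<times> (real^2) \<Rightarrow> real"
    where "CR = (\<lambda>(a, b, c, d). of_bool (crosses a b c d))"
  have CRm[measurable]: "CR \<in> borel_measurable (borel \<Otimes>\<^sub>M borel \<Otimes>\<^sub>M borel \<Otimes>\<^sub>M borel)"
    unfolding CR_def by (rule crosses_measurable)
  have CR: "of_bool (crosses a b c d) = CR (a, b, c, d)" for a b c d by (simp add: CR_def)
  have CR0: "0 \<le> CR z" for z by (auto simp: CR_def split: prod.splits)
  define g :: "(real^2) \<times> (real^2) \<times> real \<Rightarrow> real"
    where "g = (\<lambda>(p, u, t). indicator {0<..<1} t * w (p - t *\<^sub>R u, p - t *\<^sub>R u + u))"
  have gm[measurable]: "g \<in> borel_measurable (borel \<Otimes>\<^sub>M borel \<Otimes>\<^sub>M borel)"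
    unfolding g_def by measurable
  have g0: "0 \<le> g (p, u, t)" for p u t using w0 by (simp add: g_def)
  define F where "F = (\<lambda>(p, u). \<integral>\<^sup>+t. ennreal (g (p, u, t)) \<partial>lborel)"
  have Fm[measurable]: "F \<in> borel_measurable (borel \<Otimes>\<^sub>M borel)"
    unfolding F_def by measurable
  have F1: "F (p, u) \<le> 1" for p u
  proof -
    have "F (p, u) \<le> (\<integral>\<^sup>+t. indicator {0<..<1::real} t \<partial>lborel)"
      unfolding F_def g_def prod.case by (intro nn_integral_mono) (auto simp: indicator_def w1)
    then show ?thesis by simp
  qed
  have F_out: "F (p, u) = 0" if "p \<notin> \<Omega>" for p u
  proof -
    have "g (p, u, t) = 0" for t
    proof (rule ccontr)
      assume "g (p, u, t) \<noteq> 0"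
      then have t: "0 < t" "t < 1" and "w (p - t *\<^sub>R u, p - t *\<^sub>R u + u) \<noteq> 0"
        by (auto simp: g_def indicator_def split: if_splits)
      then have "p - t *\<^sub>R u \<in> \<Omega>" "p - t *\<^sub>R u + u \<in> \<Omega>" using supp by blast+
      then have "(1 - t) *\<^sub>R (p - t *\<^sub>R u) + t *\<^sub>R (p - t *\<^sub>R u + u) \<in> \<Omega>"
        using conv t by (intro convexD) auto
      moreover have "(1 - t) *\<^sub>R (p - t *\<^sub>R u) + t *\<^sub>R (p - t *\<^sub>R u + u) = p" by (simp add: algebra_simps)
      ultimately show False using that by simp
    qed
    then show ?thesis by (simp add: F_def)
  qed
  \<comment> \<open>No chord is longer than the diameter, which supplies the support radius for
    \<open>functional_busemann\<close>, uniformly in \<open>p\<close>.\<close>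
  define D where "D = diameter \<Omega>"
  have F_far: "F (p, u) = 0" if "D < norm u" for p u
  proof -
    have "g (p, u, t) = 0" for t
    proof (rule ccontr)
      assume "g (p, u, t) \<noteq> 0"
      then have "w (p - t *\<^sub>R u, p - t *\<^sub>R u + u) \<noteq> 0" by (auto simp: g_def)
      then have "p - t *\<^sub>R u \<in> \<Omega>" "p - t *\<^sub>R u + u \<in> \<Omega>" using supp by blast+
      then have "dist (p - t *\<^sub>R u) (p - t *\<^sub>R u + u) \<le> D"
        unfolding D_def using comp by (intro diameter_bounded_bound compact_imp_bounded)
      then show False using that by (simp add: dist_norm)
    qed
    then show ?thesis by (simp add: F_def)
  qed
  define M where "M p = (\<integral>\<^sup>+u. F (p, u) \<partial>lborel)" for p
  have Mm[measurable]: "M \<in> borel_measurable borel" unfolding M_def by measurable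
  define E where "E = (\<integral>\<^sup>+x. (\<integral>\<^sup>+y. ennreal (w (x, y)) \<partial>lborel) \<partial>lborel)"
  define X where "X = (\<integral>\<^sup>+x1. (\<integral>\<^sup>+x2. (\<integral>\<^sup>+x3. (\<integral>\<^sup>+x4. ennreal (w (x1, x2) * w (x3, x4) * CR (x1, x2, x3, x4))
      \<partial>lborel) \<partial>lborel) \<partial>lborel) \<partial>lborel)"
  \<comment> \<open>For fixed \<open>u\<close> and \<open>t\<close>, translating \<open>p\<close> by
    t u removes \<open>t\<close> from the weight, and the unit interval of marks has length
    1.\<close>
  have E_M: "E = (\<integral>\<^sup>+p. M p \<partial>lborel)"
  proof -
    have "(\<integral>\<^sup>+p. M p \<partial>lborel) = (\<integral>\<^sup>+u. (\<integral>\<^sup>+p. (\<integral>\<^sup>+t. ennreal (g (p, u, t)) \<partial>lborel) \<partial>lborel) \<partial>lborel)"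
      unfolding M_def F_def prod.case by (rule lborel_pair.Fubini') measurable
    also have "\<dots> = (\<integral>\<^sup>+u. (\<integral>\<^sup>+t. (\<integral>\<^sup>+p. ennreal (g (p, u, t)) \<partial>lborel) \<partial>lborel) \<partial>lborel)"
      by (intro nn_integral_cong lborel_pair.Fubini') measurable
    also have "\<dots> = (\<integral>\<^sup>+u. (\<integral>\<^sup>+t. indicator {0<..<1::real} t * (\<integral>\<^sup>+p. ennreal (w (p, p + u)) \<partial>lborel) \<partial>lborel) \<partial>lborel)"
    proof (intro nn_integral_cong)
      fix u :: "real^2" and t :: real
      have "(\<integral>\<^sup>+p. ennreal (g (p, u, t)) \<partial>lborel) = (\<integral>\<^sup>+p. ennreal (g (t *\<^sub>R u + p, u, t)) \<partial>lborel)"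
        by (rule nn_integral_shift) measurable
      also have "\<dots> = (\<integral>\<^sup>+p. indicator {0<..<1} t * ennreal (w (p, p + u)) \<partial>lborel)"
        by (intro nn_integral_cong) (auto simp: g_def indicator_def)
      also have "\<dots> = indicator {0<..<1} t * (\<integral>\<^sup>+p. ennreal (w (p, p + u)) \<partial>lborel)"
        by (rule nn_integral_cmult) measurable
      finally show "(\<integral>\<^sup>+p. ennreal (g (p, u, t)) \<partial>lborel) = indicator {0<..<1} t * (\<integral>\<^sup>+p. ennreal (w (p, p + u)) \<partial>lborel)" .
    qed
    also have "\<dots> = (\<integral>\<^sup>+u. (\<integral>\<^sup>+p. ennreal (w (p, p + u)) \<partial>lborel) \<partial>lborel)"
      by (intro nn_integral_cong) (simp add: nn_integral_multc)
    also have "\<dots> = (\<integral>\<^sup>+p. (\<integral>\<^sup>+u. ennreal (w (p, p + u)) \<partial>lborel) \<partial>lborel)"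
      by (rule lborel_pair.Fubini') measurable
    also have "\<dots> = E"
      unfolding E_def by (intro nn_integral_cong nn_integral_shift[symmetric]) measurable
    finally show ?thesis ..
  qed
  have E_fin: "E < \<infinity>"
  proof -
    have "E \<le> (\<integral>\<^sup>+x. (\<integral>\<^sup>+y. indicator \<Omega> x * indicator \<Omega> y \<partial>lborel) \<partial>lborel)"
      unfolding E_def using supp w1
      by (intro nn_integral_mono) (auto simp: indicator_def)
    also have "\<dots> = (\<integral>\<^sup>+x. indicator \<Omega> x * ennreal A \<partial>lborel)"
      by (intro nn_integral_cong) (simp add: nn_integral_cmult A)
    also have "\<dots> = ennreal A * ennreal A" by (simp add: nn_integral_multc A)
    also have "\<dots> < \<infinity>" by (simp add: ennreal_mult_less_top)
    finally show ?thesis .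
  qed
  \<comment> \<open>The crossing integrand in terms of starting points \<open>x\<close>,
    \<open>y\<close> and edge vectors \<open>u\<close>, \<open>v\<close>.\<close>
  define \<Phi> where "\<Phi> = (\<lambda>(x, u, y, v). w (x, x + u) * w (y, y + v) * CR (x, x + u, y, y + v))"
  have \<Phi>m[measurable]: "\<Phi> \<in> borel_measurable (borel \<Otimes>\<^sub>M borel \<Otimes>\<^sub>M borel \<Otimes>\<^sub>M borel)"
    unfolding \<Phi>_def by measurable
  \<comment> \<open>At fixed edge vectors a common marked point means x + t u = y + s v. So y = x +
    t u - s v replaces the two marks at fixed \<open>x\<close>, with the determinant as
    Jacobian.\<close>
  have key: "ennreal \<bar>det2 u v\<bar> * (\<integral>\<^sup>+p. F (p, u) * F (p, v) \<partial>lborel) \<le> (\<integral>\<^sup>+x. (\<integral>\<^sup>+y. ennreal (\<Phi> (x, u, y, v)) \<partial>lborel) \<partial>lborel)" for u v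
  proof (cases "det2 u v = 0")
    case False
    define \<Psi> where "\<Psi> = (\<lambda>(x, t, s). g (x + t *\<^sub>R u, u, t) * g (x + t *\<^sub>R u, v, s))"
    have \<Psi>m[measurable]: "\<Psi> \<in> borel_measurable (borel \<Otimes>\<^sub>M borel \<Otimes>\<^sub>M borel)"
      unfolding \<Psi>_def by measurable
    have le: "\<Psi> (x, t, s) \<le> \<Phi> (x, u, x + t *\<^sub>R u - s *\<^sub>R v, v)" for x t s
    proof (cases "t \<in> {0<..<1} \<and> s \<in> {0<..<1}")
      case True
      then have "crosses x (x + u) (x + t *\<^sub>R u - s *\<^sub>R v) (x + t *\<^sub>R u - s *\<^sub>R v + v)"
        using crosses_parallelogram[OF False] by auto
      then show ?thesis using True by (simp add: \<Psi>_def \<Phi>_def g_def CR_def)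
    next
      case False
      then have "\<Psi> (x, t, s) = 0" by (auto simp: \<Psi>_def g_def)
      then show ?thesis unfolding \<Phi>_def prod.case using w0 CR0 by simp
    qed
    have "(\<integral>\<^sup>+p. F (p, u) * F (p, v) \<partial>lborel) = (\<integral>\<^sup>+p. (\<integral>\<^sup>+t. (\<integral>\<^sup>+s. ennreal (g (p, u, t) * g (p, v, s)) \<partial>lborel) \<partial>lborel) \<partial>lborel)"
    proof (rule nn_integral_cong)
      fix p
      have "(\<integral>\<^sup>+t. (\<integral>\<^sup>+s. ennreal (g (p, u, t) * g (p, v, s)) \<partial>lborel) \<partial>lborel) = (\<integral>\<^sup>+t. ennreal (g (p, u, t)) * F (p, v) \<partial>lborel)"
        unfolding F_def prod.case by (intro nn_integral_cong) (simp add: ennreal_mult g0 nn_integral_cmult)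
      then show "F (p, u) * F (p, v) = (\<integral>\<^sup>+t. (\<integral>\<^sup>+s. ennreal (g (p, u, t) * g (p, v, s)) \<partial>lborel) \<partial>lborel)"
        unfolding F_def prod.case by (simp add: nn_integral_multc)
    qed
    also have "\<dots> = (\<integral>\<^sup>+t. (\<integral>\<^sup>+p. (\<integral>\<^sup>+s. ennreal (g (p, u, t) * g (p, v, s)) \<partial>lborel) \<partial>lborel) \<partial>lborel)"
      by (rule lborel_pair.Fubini') measurable
    also have "\<dots> = (\<integral>\<^sup>+t. (\<integral>\<^sup>+x. (\<integral>\<^sup>+s. ennreal (\<Psi> (x, t, s)) \<partial>lborel) \<partial>lborel) \<partial>lborel)"
    proof (rule nn_integral_cong)
      fix t
      have "(\<integral>\<^sup>+p. (\<integral>\<^sup>+s. ennreal (g (p, u, t) * g (p, v, s)) \<partial>lborel) \<partial>lborel) =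
        (\<integral>\<^sup>+x. (\<integral>\<^sup>+s. ennreal (g (t *\<^sub>R u + x, u, t) * g (t *\<^sub>R u + x, v, s)) \<partial>lborel) \<partial>lborel)"
        by (rule nn_integral_shift) measurable
      then show "(\<integral>\<^sup>+p. (\<integral>\<^sup>+s. ennreal (g (p, u, t) * g (p, v, s)) \<partial>lborel) \<partial>lborel) = (\<integral>\<^sup>+x. (\<integral>\<^sup>+s. ennreal (\<Psi> (x, t, s)) \<partial>lborel) \<partial>lborel)"
        by (simp add: \<Psi>_def add.commute)
    qed
    also have "\<dots> = (\<integral>\<^sup>+x. (\<integral>\<^sup>+t. (\<integral>\<^sup>+s. ennreal (\<Psi> (x, t, s)) \<partial>lborel) \<partial>lborel) \<partial>lborel)"
      by (rule lborel_pair.Fubini') measurable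
    finally have "ennreal \<bar>det2 u v\<bar> * (\<integral>\<^sup>+p. F (p, u) * F (p, v) \<partial>lborel) =
       ennreal \<bar>det2 u v\<bar> * (\<integral>\<^sup>+x. (\<integral>\<^sup>+t. (\<integral>\<^sup>+s. ennreal (\<Psi> (x, t, s)) \<partial>lborel) \<partial>lborel) \<partial>lborel)" by simp
    also have "\<dots> = (\<integral>\<^sup>+x. ennreal \<bar>det2 u v\<bar> * (\<integral>\<^sup>+t. (\<integral>\<^sup>+s. ennreal (\<Psi> (x, t, s)) \<partial>lborel) \<partial>lborel) \<partial>lborel)"
      by (rule nn_integral_cmult[symmetric]) measurable
    also have "\<dots> \<le> (\<integral>\<^sup>+x. ennreal \<bar>det2 u v\<bar> * (\<integral>\<^sup>+t. (\<integral>\<^sup>+s. ennreal (\<Phi> (x, u, x + t *\<^sub>R u - s *\<^sub>R v, v)) \<partial>lborel) \<partial>lborel) \<partial>lborel)"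
      by (intro nn_integral_mono mult_left_mono ennreal_leI le) auto
    also have "\<dots> = (\<integral>\<^sup>+x. (\<integral>\<^sup>+y. ennreal (\<Phi> (x, u, y, v)) \<partial>lborel) \<partial>lborel)"
      by (intro nn_integral_cong nn_integral_linear[OF _ False, symmetric]) measurable
    finally show ?thesis .
  qed simp
  have "ennreal (8 / (9 * pi\<^sup>2)) * (\<integral>\<^sup>+p. M p ^ 3 \<partial>lborel) = (\<integral>\<^sup>+p. ennreal (8 / (9 * pi\<^sup>2)) * M p ^ 3 \<partial>lborel)"
    by (rule nn_integral_cmult[symmetric]) measurable
  also have "\<dots> \<le> (\<integral>\<^sup>+p. (\<integral>\<^sup>+u. (\<integral>\<^sup>+v. ennreal \<bar>det2 u v\<bar> * (F (p, u) * F (p, v)) \<partial>lborel) \<partial>lborel) \<partial>lborel)"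
  proof (rule nn_integral_mono)
    fix p
    \<comment> \<open>The bound \<open>F1\<close> excludes the infinite value, so passing to reals
      loses nothing.\<close>
    define f where "f u = enn2real (F (p, u))" for u
    have fF: "ennreal (f u) = F (p, u)" for u
      unfolding f_def using F1[of p u] by (intro ennreal_enn2real) (auto simp: less_top[symmetric] top_unique)
    have fm: "f \<in> borel_measurable borel" unfolding f_def by measurable
    have f0: "0 \<le> f u" for u by (simp add: f_def)
    have f1: "f u \<le> 1" for u
      using F1[of p u] f0[of u] by (simp flip: fF)
    have "ennreal (8 / (9 * pi\<^sup>2)) * (\<integral>\<^sup>+u. ennreal (f u) \<partial>lborel) ^ 3 \<le>
      (\<integral>\<^sup>+u. (\<integral>\<^sup>+v. ennreal (\<bar>det2 u v\<bar> * f u * f v) \<partial>lborel) \<partial>lborel)"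
      by (rule functional_busemann[OF fm f0 f1, of D]) (simp add: f_def F_far)
    also have "\<dots> = (\<integral>\<^sup>+u. (\<integral>\<^sup>+v. ennreal \<bar>det2 u v\<bar> * (F (p, u) * F (p, v)) \<partial>lborel) \<partial>lborel)"
      by (intro nn_integral_cong) (simp add: ennreal_mult f0 mult.assoc flip: fF)
    finally show "ennreal (8 / (9 * pi\<^sup>2)) * M p ^ 3 \<le> (\<integral>\<^sup>+u. (\<integral>\<^sup>+v. ennreal \<bar>det2 u v\<bar> * (F (p, u) * F (p, v)) \<partial>lborel) \<partial>lborel)"
      unfolding M_def fF .
  qed
  also have "\<dots> = (\<integral>\<^sup>+u. (\<integral>\<^sup>+p. (\<integral>\<^sup>+v. ennreal \<bar>det2 u v\<bar> * (F (p, u) * F (p, v)) \<partial>lborel) \<partial>lborel) \<partial>lborel)"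
    by (rule lborel_pair.Fubini') measurable
  also have "\<dots> = (\<integral>\<^sup>+u. (\<integral>\<^sup>+v. (\<integral>\<^sup>+p. ennreal \<bar>det2 u v\<bar> * (F (p, u) * F (p, v)) \<partial>lborel) \<partial>lborel) \<partial>lborel)"
    by (intro nn_integral_cong lborel_pair.Fubini') measurable
  also have "\<dots> = (\<integral>\<^sup>+u. (\<integral>\<^sup>+v. ennreal \<bar>det2 u v\<bar> * (\<integral>\<^sup>+p. F (p, u) * F (p, v) \<partial>lborel) \<partial>lborel) \<partial>lborel)"
    by (intro nn_integral_cong nn_integral_cmult) measurable
  also have "\<dots> \<le> (\<integral>\<^sup>+u. (\<integral>\<^sup>+v. (\<integral>\<^sup>+x. (\<integral>\<^sup>+y. ennreal (\<Phi> (x, u, y, v)) \<partial>lborel) \<partial>lborel) \<partial>lborel) \<partial>lborel)"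
    by (intro nn_integral_mono key)
  also have "\<dots> = (\<integral>\<^sup>+u. (\<integral>\<^sup>+x. (\<integral>\<^sup>+v. (\<integral>\<^sup>+y. ennreal (\<Phi> (x, u, y, v)) \<partial>lborel) \<partial>lborel) \<partial>lborel) \<partial>lborel)"
    by (intro nn_integral_cong lborel_pair.Fubini') measurable
  also have "\<dots> = (\<integral>\<^sup>+x. (\<integral>\<^sup>+u. (\<integral>\<^sup>+v. (\<integral>\<^sup>+y. ennreal (\<Phi> (x, u, y, v)) \<partial>lborel) \<partial>lborel) \<partial>lborel) \<partial>lborel)"
    by (rule lborel_pair.Fubini') measurable
  also have "\<dots> = (\<integral>\<^sup>+x. (\<integral>\<^sup>+u. (\<integral>\<^sup>+y. (\<integral>\<^sup>+v. ennreal (\<Phi> (x, u, y, v)) \<partial>lborel) \<partial>lborel) \<partial>lborel) \<partial>lborel)"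
    by (intro nn_integral_cong lborel_pair.Fubini') measurable
  also have "\<dots> = X"
    unfolding X_def
  proof (rule nn_integral_cong)
    fix x1
    have "(\<integral>\<^sup>+u. (\<integral>\<^sup>+y. (\<integral>\<^sup>+v. ennreal (\<Phi> (x1, u, y, v)) \<partial>lborel) \<partial>lborel) \<partial>lborel) =
      (\<integral>\<^sup>+u. (\<integral>\<^sup>+y. (\<integral>\<^sup>+x4. ennreal (w (x1, x1 + u) * w (y, x4) * CR (x1, x1 + u, y, x4)) \<partial>lborel) \<partial>lborel) \<partial>lborel)"
      unfolding \<Phi>_def prod.case by (intro nn_integral_cong nn_integral_shift[symmetric]) measurable
    also have "\<dots> = (\<integral>\<^sup>+x2. (\<integral>\<^sup>+y. (\<integral>\<^sup>+x4. ennreal (w (x1, x2) * w (y, x4) * CR (x1, x2, y, x4)) \<partial>lborel) \<partial>lborel) \<partial>lborel)"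
      by (rule nn_integral_shift[symmetric]) measurable
    finally show "(\<integral>\<^sup>+u. (\<integral>\<^sup>+y. (\<integral>\<^sup>+v. ennreal (\<Phi> (x1, u, y, v)) \<partial>lborel) \<partial>lborel) \<partial>lborel) =
      (\<integral>\<^sup>+x2. (\<integral>\<^sup>+y. (\<integral>\<^sup>+x4. ennreal (w (x1, x2) * w (y, x4) * CR (x1, x2, y, x4)) \<partial>lborel) \<partial>lborel) \<partial>lborel)" .
  qed
  finally have 1: "ennreal (8 / (9 * pi\<^sup>2)) * (\<integral>\<^sup>+p. M p ^ 3 \<partial>lborel) \<le> X" .
  have 2: "E ^ 3 \<le> ennreal (A\<^sup>2) * (\<integral>\<^sup>+p. M p ^ 3 \<partial>lborel)"
    unfolding E_M
    by (rule nn_integral_cube_ge[where S = \<Omega>]) (use E_fin A in \<open>auto simp: M_def F_out E_M\<close>)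
  have "ennreal (8 / (9 * pi\<^sup>2)) * E ^ 3 \<le> ennreal (8 / (9 * pi\<^sup>2)) * (ennreal (A\<^sup>2) * (\<integral>\<^sup>+p. M p ^ 3 \<partial>lborel))"
    using 2 by (intro mult_left_mono) auto
  also have "\<dots> = ennreal (A\<^sup>2) * (ennreal (8 / (9 * pi\<^sup>2)) * (\<integral>\<^sup>+p. M p ^ 3 \<partial>lborel))" by (simp add: mult_ac)
  also have "\<dots> \<le> ennreal (A\<^sup>2) * X" using 1 by (intro mult_left_mono) auto
  finally show ?thesis unfolding E_def X_def CR .
qed

section \<open>Normalisation\<close>

text \<open>Equality almost everywhere preserves a Bochner integral only between measurable
  functions, the integral of a nonmeasurable one being 0 by convention. Completeness transfers
  measurability as well, as the unmodified weight requires.\<close>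

lemma (in complete_measure) borel_measurable_AE_eq:
  fixes f f' :: "'a \<Rightarrow> 'b::topological_space"
  assumes f': "f' \<in> borel_measurable M" and ae: "AE x in M. f x = f' x"
  shows "f \<in> borel_measurable M"
proof (rule measurableI)
  fix S :: "'b set" assume "S \<in> sets borel"
  then have m: "f' -` S \<inter> space M \<in> sets M" using f' by (rule measurable_sets[rotated])
  have e: "AE x in M. x \<in> f' -` S \<inter> space M \<longleftrightarrow> x \<in> f -` S \<inter> space M"
    using ae by eventually_elim (simp only: Int_iff vimage_eq)
  show "f -` S \<inter> space M \<in> sets M" by (rule in_sets_AE[OF e m]) auto
qed simp

lemma (in complete_measure) integral_AE_eq:
  fixes f f' :: "'a \<Rightarrow> real"
  assumes f': "f' \<in> borel_measurable M" and ae: "AE x in M. f x = f' x"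
  shows "integral\<^sup>L M f = integral\<^sup>L M f'"
  by (rule integral_cong_AE[OF borel_measurable_AE_eq[OF f' ae] f' ae])

section \<open>The uniform measure on a compact set of positive area\<close>

locale plane_body =
  fixes \<Omega> :: "(real^2) set" and A :: real
  assumes comp: "compact \<Omega>" and area: "emeasure lborel \<Omega> = ennreal A" and area_pos: "0 < A"
begin

abbreviation U where "U \<equiv> unif \<Omega>"

lemma \<Omega>_borel[measurable]: "\<Omega> \<in> sets borel" using comp by (rule borel_compact)

lemma \<Omega>_lebesgue: "\<Omega> \<in> sets lebesgue" by (simp add: sets_completionI_sets)

lemma sets_U: "sets U = sets (lebesgue_on \<Omega>)" by (simp add: unif_def)

lemma space_U[simp]: "space U = \<Omega>" by (simp add: unif_def space_restrict_space)

lemma emeasure_on: "emeasure (lebesgue_on \<Omega>) \<Omega> = ennreal A"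
  using \<Omega>_lebesgue by (simp add: emeasure_restrict_space area)

lemma id_U[measurable]: "(\<lambda>x. x) \<in> U \<rightarrow>\<^sub>M borel"
proof -
  have "(\<lambda>x. x) \<in> lebesgue_on \<Omega> \<rightarrow>\<^sub>M (borel :: (real^2) measure)"
    by (intro measurable_restrict_space1 measurable_completion) simp
  then show ?thesis using measurable_cong_sets[OF sets_U refl] by blast
qed

lemma finite_U: "finite_measure U"
proof
  show "emeasure U (space U) \<noteq> \<infinity>"
  proof -
    have "emeasure U \<Omega> = 1"
      unfolding unif_def using emeasure_on area_pos by (intro emeasure_uniform_measure_1) auto
    then show ?thesis by simp
  qed
qed

text \<open>Functions vanishing off \<Omega> may be integrated over the whole plane, where
  translations and linear substitutions are available. Each variable costs a factor 1 / A.\<close>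

lemma nn_integral_U:
  assumes Gm[measurable]: "G \<in> borel_measurable borel" and G0: "\<And>x. x \<notin> \<Omega> \<Longrightarrow> G x = 0"
  shows "(\<integral>\<^sup>+x. G x \<partial>U) = ennreal (1 / A) * (\<integral>\<^sup>+x. G x \<partial>lborel)"
proof -
  have "G \<in> borel_measurable (lebesgue_on \<Omega>)"
    by (intro measurable_restrict_space1 measurable_completion) simp
  then have "(\<integral>\<^sup>+x. G x \<partial>U) = (\<integral>\<^sup>+x. G x * indicator \<Omega> x \<partial>lebesgue_on \<Omega>) / ennreal A"
    unfolding unif_def by (subst nn_integral_uniform_measure) (auto simp: emeasure_on sets_restrict_space \<Omega>_lebesgue)
  also have "(\<integral>\<^sup>+x. G x * indicator \<Omega> x \<partial>lebesgue_on \<Omega>) = (\<integral>\<^sup>+x. G x * indicator \<Omega> x * indicator \<Omega> x \<partial>lebesgue)"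
    using \<Omega>_lebesgue by (subst nn_integral_restrict_space) auto
  also have "\<dots> = (\<integral>\<^sup>+x. G x \<partial>lebesgue)"
    using G0 by (intro nn_integral_cong) (auto simp: indicator_def)
  also have "\<dots> = (\<integral>\<^sup>+x. G x \<partial>lborel)" by (rule nn_integral_completion)
  finally show ?thesis
    using area_pos by (simp add: divide_ennreal_def inverse_ennreal mult.commute inverse_eq_divide)
qed

lemma AE_U:
  assumes "AE x in lborel. x \<in> \<Omega> \<longrightarrow> P x"
  shows "AE x in U. P x"
proof -
  have "AE x in lebesgue_on \<Omega>. P x"
    using AE_completion[OF assms] \<Omega>_lebesgue by (subst AE_restrict_space_iff) auto
  then show ?thesis
    unfolding unif_def by (intro AE_uniform_measureI) (auto simp: sets_restrict_space \<Omega>_lebesgue)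
qed

text \<open>A null set for \<open>U\<close> is a Lebesgue null set inside \<Omega>. Completeness
  makes almost every section of the original weight measurable, so that the inner integral of
  \<open>edge_density\<close> is a genuine one.\<close>

lemma complete_U: "complete_measure U"
proof
  fix B N assume BN: "B \<subseteq> N" and N: "N \<in> null_sets U"
  then have Ns: "N \<in> sets (lebesgue_on \<Omega>)" and N0: "emeasure U N = 0" by (auto simp: sets_U)
  have N\<Omega>: "N \<subseteq> \<Omega>" using sets.sets_into_space[OF Ns] by (simp add: space_restrict_space)
  have "emeasure (lebesgue_on \<Omega>) (\<Omega> \<inter> N) / ennreal A = 0"
    using N0 Ns unfolding unif_def by (subst (asm) emeasure_uniform_measure) (auto simp: emeasure_on sets_restrict_space \<Omega>_lebesgue)
  then have "emeasure (lebesgue_on \<Omega>) N = 0" using N\<Omega> by (simp add: ennreal_divide_eq_0_iff Int_absorb1)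
  then have "N \<in> null_sets (lebesgue_on \<Omega>)" using Ns by auto
  then have "N \<in> null_sets lebesgue" using \<Omega>_lebesgue by (simp add: null_sets_restrict_space)
  then have "B \<in> sets lebesgue" using BN completion.complete by blast
  moreover have "B \<subseteq> \<Omega>" using BN N\<Omega> by blast
  ultimately show "B \<in> sets U" using \<Omega>_lebesgue by (simp add: sets_U sets_restrict_space_iff)
qed

sublocale U: finite_measure U by (rule finite_U)
sublocale U: complete_measure U by (rule complete_U)
sublocale U2: pair_sigma_finite U U ..
sublocale U3: pair_sigma_finite U "U \<Otimes>\<^sub>M U" ..
sublocale U4: pair_sigma_finite U "U \<Otimes>\<^sub>M U \<Otimes>\<^sub>M U" ..

end

section \<open>Borel weights extended by zero, and normalisation of their integrals\<close>

locale plane_weight = plane_body +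
  fixes w :: "(real^2) \<times> (real^2) \<Rightarrow> real"
  assumes w_meas: "w \<in> borel_measurable borel"
    and w_nonneg: "\<And>z. 0 \<le> w z" and w_le_1: "\<And>z. w z \<le> 1"
    and w_supp: "\<And>x y. x \<notin> \<Omega> \<or> y \<notin> \<Omega> \<Longrightarrow> w (x, y) = 0"
begin

lemma w_meas'[measurable]: "w \<in> borel_measurable (borel \<Otimes>\<^sub>M borel)"
  using w_meas by (simp add: borel_prod)

lemma w_U[measurable]: "w \<in> borel_measurable (U \<Otimes>\<^sub>M U)"
proof -
  have "(\<lambda>z. (fst z, snd z)) \<in> U \<Otimes>\<^sub>M U \<rightarrow>\<^sub>M borel \<Otimes>\<^sub>M borel" by measurable
  from measurable_compose[OF this w_meas'] show ?thesis by simp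
qed

lemma ennreal_edge_integral:
  "ennreal (\<integral>x. (\<integral>y. w (x, y) \<partial>U) \<partial>U) =
    ennreal (1 / A\<^sup>2) * (\<integral>\<^sup>+x. (\<integral>\<^sup>+y. ennreal (w (x, y)) \<partial>lborel) \<partial>lborel)"
proof -
  have sec: "integrable U (\<lambda>y. w (x, y))" if "x \<in> \<Omega>" for x
  proof (rule U.integrable_const_bound[where B = 1])
    show "(\<lambda>y. w (x, y)) \<in> borel_measurable U"
      by (rule measurable_compose[OF id_U]) measurable
  qed (use w_nonneg w_le_1 in auto)
  have "integrable U (\<lambda>x. \<integral>y. w (x, y) \<partial>U)"
  proof (rule U.integrable_const_bound[where B = "measure U (space U)"])
    show "AE x in U. norm (\<integral>y. w (x, y) \<partial>U) \<le> measure U (space U)"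
    proof (rule AE_I2)
      fix x assume "x \<in> space U"
      then have "(\<integral>y. w (x, y) \<partial>U) \<le> (\<integral>y. 1 \<partial>U)"
        using w_le_1 by (intro integral_mono sec) auto
      moreover have "0 \<le> (\<integral>y. w (x, y) \<partial>U)" using w_nonneg by (intro Bochner_Integration.integral_nonneg) auto
      ultimately show "norm (\<integral>y. w (x, y) \<partial>U) \<le> measure U (space U)" by simp
    qed
  qed measurable
  then have "ennreal (\<integral>x. (\<integral>y. w (x, y) \<partial>U) \<partial>U) = (\<integral>\<^sup>+x. ennreal (\<integral>y. w (x, y) \<partial>U) \<partial>U)"
    using w_nonneg by (intro nn_integral_eq_integral[symmetric] AE_I2 Bochner_Integration.integral_nonneg) auto
  also have "\<dots> = (\<integral>\<^sup>+x. (\<integral>\<^sup>+y. ennreal (w (x, y)) \<partial>U) \<partial>U)"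
    using sec w_nonneg by (intro nn_integral_cong nn_integral_eq_integral[symmetric]) auto
  also have "\<dots> = (\<integral>\<^sup>+x. ennreal (1 / A) * (\<integral>\<^sup>+y. ennreal (w (x, y)) \<partial>lborel) \<partial>U)"
    by (intro nn_integral_cong nn_integral_U) (auto simp: w_supp)
  also have "\<dots> = ennreal (1 / A) * (\<integral>\<^sup>+x. ennreal (1 / A) * (\<integral>\<^sup>+y. ennreal (w (x, y)) \<partial>lborel) \<partial>lborel)"
    by (intro nn_integral_U) (auto simp: w_supp)
  also have "\<dots> = ennreal (1 / A) * (ennreal (1 / A) * (\<integral>\<^sup>+x. (\<integral>\<^sup>+y. ennreal (w (x, y)) \<partial>lborel) \<partial>lborel))"
    by (intro arg_cong2[where f = times] refl nn_integral_cmult) measurable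
  also have "\<dots> = ennreal (1 / A\<^sup>2) * (\<integral>\<^sup>+x. (\<integral>\<^sup>+y. ennreal (w (x, y)) \<partial>lborel) \<partial>lborel)"
    using area_pos by (simp add: mult.assoc[symmetric] power2_eq_square flip: ennreal_mult)
  finally show ?thesis .
qed

definition cross_fun :: "(real^2) \<times> (real^2) \<times> (real^2) \<times> (real^2) \<Rightarrow> real" where
  "cross_fun = (\<lambda>(x1, x2, x3, x4). w (x1, x2) * w (x3, x4) * of_bool (crosses x1 x2 x3 x4))"

lemma cross_fun_borel[measurable]:
  "cross_fun \<in> borel_measurable (borel \<Otimes>\<^sub>M borel \<Otimes>\<^sub>M borel \<Otimes>\<^sub>M borel)"
proof -
  note crosses_measurable[measurable]
  have "cross_fun = (\<lambda>x. w (fst x, fst (snd x)) * w (fst (snd (snd x)), snd (snd (snd x))) *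
      (\<lambda>(a, b, c, d). of_bool (crosses a b c d)) x)"
    by (auto simp: cross_fun_def fun_eq_iff)
  also have "\<dots> \<in> borel_measurable (borel \<Otimes>\<^sub>M borel \<Otimes>\<^sub>M borel \<Otimes>\<^sub>M borel)" by measurable
  finally show ?thesis .
qed

lemma cross_fun_U[measurable]: "cross_fun \<in> borel_measurable (U \<Otimes>\<^sub>M U \<Otimes>\<^sub>M U \<Otimes>\<^sub>M U)"
proof -
  have "(\<lambda>z. (fst z, fst (snd z), fst (snd (snd z)), snd (snd (snd z)))) \<in>
      U \<Otimes>\<^sub>M U \<Otimes>\<^sub>M U \<Otimes>\<^sub>M U \<rightarrow>\<^sub>M borel \<Otimes>\<^sub>M borel \<Otimes>\<^sub>M borel \<Otimes>\<^sub>M borel" by measurable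
  from measurable_compose[OF this cross_fun_borel] show ?thesis by simp
qed

lemma cross_fun_nonneg: "0 \<le> cross_fun z"
  by (auto simp: cross_fun_def w_nonneg split: prod.splits)

lemma cross_fun_le_1: "cross_fun z \<le> 1"
  by (auto simp: cross_fun_def w_nonneg w_le_1 mult_le_one split: prod.splits)

lemma cross_fun_supp:
  "x1 \<notin> \<Omega> \<or> x2 \<notin> \<Omega> \<or> x3 \<notin> \<Omega> \<or> x4 \<notin> \<Omega> \<Longrightarrow> cross_fun (x1, x2, x3, x4) = 0"
  using w_supp[of x1 x2] w_supp[of x3 x4] by (auto simp: cross_fun_def)

lemma ennreal_crossing_integral:
  "ennreal (integral\<^sup>L (U \<Otimes>\<^sub>M U \<Otimes>\<^sub>M U \<Otimes>\<^sub>M U) cross_fun) = ennreal (1 / A ^ 4) *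
    (\<integral>\<^sup>+x1. (\<integral>\<^sup>+x2. (\<integral>\<^sup>+x3. (\<integral>\<^sup>+x4. ennreal (cross_fun (x1, x2, x3, x4)) \<partial>lborel) \<partial>lborel) \<partial>lborel) \<partial>lborel)"
proof -
  let ?M = "U \<Otimes>\<^sub>M U \<Otimes>\<^sub>M U \<Otimes>\<^sub>M U"
  have s2: "sigma_finite_measure (U \<Otimes>\<^sub>M U)" and s3: "sigma_finite_measure (U \<Otimes>\<^sub>M U \<Otimes>\<^sub>M U)"
    by unfold_locales
  interpret P4: finite_measure ?M by (intro finite_measure_pair_measure finite_U)
  have "integrable ?M cross_fun"
    using cross_fun_nonneg cross_fun_le_1 by (intro P4.integrable_const_bound[where B = 1]) auto
  then have "ennreal (integral\<^sup>L ?M cross_fun) = (\<integral>\<^sup>+z. ennreal (cross_fun z) \<partial>?M)"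
    using cross_fun_nonneg by (intro nn_integral_eq_integral[symmetric]) auto
  also have "\<dots> = (\<integral>\<^sup>+x1. (\<integral>\<^sup>+z. ennreal (cross_fun (x1, z)) \<partial>(U \<Otimes>\<^sub>M U \<Otimes>\<^sub>M U)) \<partial>U)"
    by (rule sigma_finite_measure.nn_integral_fst[OF s3, symmetric]) measurable
  also have "\<dots> = (\<integral>\<^sup>+x1. (\<integral>\<^sup>+x2. (\<integral>\<^sup>+z. ennreal (cross_fun (x1, x2, z)) \<partial>(U \<Otimes>\<^sub>M U)) \<partial>U) \<partial>U)"
    by (intro nn_integral_cong sigma_finite_measure.nn_integral_fst[OF s2, symmetric]) measurable
  also have "\<dots> = (\<integral>\<^sup>+x1. (\<integral>\<^sup>+x2. (\<integral>\<^sup>+x3. (\<integral>\<^sup>+x4. ennreal (cross_fun (x1, x2, x3, x4)) \<partial>U) \<partial>U) \<partial>U) \<partial>U)"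
    by (intro nn_integral_cong U.nn_integral_fst[symmetric]) measurable
  also have "\<dots> = (\<integral>\<^sup>+x1. (\<integral>\<^sup>+x2. (\<integral>\<^sup>+x3. ennreal (1 / A) * (\<integral>\<^sup>+x4. ennreal (cross_fun (x1, x2, x3, x4)) \<partial>lborel) \<partial>U) \<partial>U) \<partial>U)"
    by (intro nn_integral_cong nn_integral_U) (auto simp: cross_fun_supp)
  also have "\<dots> = (\<integral>\<^sup>+x1. (\<integral>\<^sup>+x2. ennreal (1 / A) * (\<integral>\<^sup>+x3. ennreal (1 / A) * (\<integral>\<^sup>+x4. ennreal (cross_fun (x1, x2, x3, x4)) \<partial>lborel) \<partial>lborel) \<partial>U) \<partial>U)"
    by (intro nn_integral_cong nn_integral_U) (auto simp: cross_fun_supp)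
  also have "\<dots> = (\<integral>\<^sup>+x1. ennreal (1 / A) * (\<integral>\<^sup>+x2. ennreal (1 / A) * (\<integral>\<^sup>+x3. ennreal (1 / A) * (\<integral>\<^sup>+x4. ennreal (cross_fun (x1, x2, x3, x4)) \<partial>lborel) \<partial>lborel) \<partial>lborel) \<partial>U)"
    by (intro nn_integral_cong nn_integral_U) (auto simp: cross_fun_supp)
  also have "\<dots> = ennreal (1 / A) * (\<integral>\<^sup>+x1. ennreal (1 / A) * (\<integral>\<^sup>+x2. ennreal (1 / A) * (\<integral>\<^sup>+x3. ennreal (1 / A) * (\<integral>\<^sup>+x4. ennreal (cross_fun (x1, x2, x3, x4)) \<partial>lborel) \<partial>lborel) \<partial>lborel) \<partial>lborel)"
    by (intro nn_integral_U) (auto simp: cross_fun_supp)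
  also have "\<dots> = ennreal (1 / A) * (ennreal (1 / A) * (ennreal (1 / A) * (ennreal (1 / A) *
    (\<integral>\<^sup>+x1. (\<integral>\<^sup>+x2. (\<integral>\<^sup>+x3. (\<integral>\<^sup>+x4. ennreal (cross_fun (x1, x2, x3, x4)) \<partial>lborel) \<partial>lborel) \<partial>lborel) \<partial>lborel))))"
    by (simp add: nn_integral_cmult)
  also have "\<dots> = ennreal (1 / A ^ 4) *
    (\<integral>\<^sup>+x1. (\<integral>\<^sup>+x2. (\<integral>\<^sup>+x3. (\<integral>\<^sup>+x4. ennreal (cross_fun (x1, x2, x3, x4)) \<partial>lborel) \<partial>lborel) \<partial>lborel) \<partial>lborel)"
    using area_pos by (simp add: mult.assoc[symmetric] power4_eq_xxxx flip: ennreal_mult)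
  finally show ?thesis .
qed

text \<open>The powers of the area balance: the cubed edge density carries A^(-6), the crossing
  density A^(-4), and Jensen's inequality over \<Omega> accounts for A^2.\<close>

lemma normalized_crossing_bound:
  assumes conv: "convex \<Omega>"
  shows "8 / (9 * pi\<^sup>2) * (\<integral>x. (\<integral>y. w (x, y) \<partial>U) \<partial>U) ^ 3 \<le>
    integral\<^sup>L (U \<Otimes>\<^sub>M U \<Otimes>\<^sub>M U \<Otimes>\<^sub>M U) cross_fun"
proof -
  define e where "e = (\<integral>x. (\<integral>y. w (x, y) \<partial>U) \<partial>U)"
  define c where "c = integral\<^sup>L (U \<Otimes>\<^sub>M U \<Otimes>\<^sub>M U \<Otimes>\<^sub>M U) cross_fun"
  define E where "E = (\<integral>\<^sup>+x. (\<integral>\<^sup>+y. ennreal (w (x, y)) \<partial>lborel) \<partial>lborel)"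
  define X where "X = (\<integral>\<^sup>+x1. (\<integral>\<^sup>+x2. (\<integral>\<^sup>+x3. (\<integral>\<^sup>+x4. ennreal (cross_fun (x1, x2, x3, x4)) \<partial>lborel) \<partial>lborel) \<partial>lborel) \<partial>lborel)"
  have e0: "0 \<le> e" unfolding e_def using w_nonneg by (intro Bochner_Integration.integral_nonneg) auto
  have c0: "0 \<le> c" unfolding c_def using cross_fun_nonneg by (intro Bochner_Integration.integral_nonneg) auto
  have e: "ennreal e = ennreal (1 / A\<^sup>2) * E" unfolding e_def E_def by (rule ennreal_edge_integral)
  have c: "ennreal c = ennreal (1 / A ^ 4) * X" unfolding c_def X_def by (rule ennreal_crossing_integral)
  have main: "ennreal (8 / (9 * pi\<^sup>2)) * E ^ 3 \<le> ennreal (A\<^sup>2) * X"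
    using crossing_integral_bound[OF w_meas w_nonneg w_le_1 w_supp comp conv area area_pos]
    by (simp add: E_def X_def cross_fun_def)
  have "ennreal (8 / (9 * pi\<^sup>2) * e ^ 3) = ennreal (8 / (9 * pi\<^sup>2)) * ennreal e ^ 3"
    unfolding ennreal_power[OF e0] by (rule ennreal_mult) (use e0 in auto)
  also have "\<dots> = ennreal ((1 / A\<^sup>2) ^ 3) * (ennreal (8 / (9 * pi\<^sup>2)) * E ^ 3)"
    unfolding e using area_pos by (simp add: power_mult_distrib ennreal_power mult_ac)
  also have "\<dots> \<le> ennreal ((1 / A\<^sup>2) ^ 3) * (ennreal (A\<^sup>2) * X)" using main by (rule mult_left_mono) simp
  also have "\<dots> = ennreal ((1 / A\<^sup>2) ^ 3 * A\<^sup>2) * X"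
    using area_pos by (simp add: mult.assoc[symmetric] flip: ennreal_mult)
  also have "(1 / A\<^sup>2) ^ 3 * A\<^sup>2 = 1 / A ^ 4"
    using area_pos by (simp add: field_simps power2_eq_square power3_eq_cube power4_eq_xxxx)
  finally have "ennreal (8 / (9 * pi\<^sup>2) * e ^ 3) \<le> ennreal c" unfolding c .
  then show ?thesis using c0 by (simp add: e_def c_def ennreal_le_iff)
qed

end

theorem theorem2p9:
  fixes \<Omega> :: "(real^2) set"
    and w :: "(real^2) \<times> (real^2) \<Rightarrow> real"
  assumes "compact \<Omega>" and "convex \<Omega>" and "interior \<Omega> \<noteq> {}"
    and "w \<in> borel_measurable (lebesgue_on (\<Omega> \<times> \<Omega>))"
    and "\<And>x y. x \<in> \<Omega> \<Longrightarrow> y \<in> \<Omega> \<Longrightarrow> w (x, y) \<in> {0..1}"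
    and "\<And>x y. x \<in> \<Omega> \<Longrightarrow> y \<in> \<Omega> \<Longrightarrow> w (x, y) = w (y, x)"
  shows "crossing_density \<Omega> w \<ge> 8 / (9 * pi\<^sup>2) * (edge_density \<Omega> w) ^ 3"
proof -
  have fin: "emeasure lborel \<Omega> < \<infinity>" using emeasure_compact_finite[OF assms(1)] by simp
  have "emeasure lborel \<Omega> \<noteq> 0"
  proof
    assume 0: "emeasure lborel \<Omega> = 0"
    then have "\<Omega> \<in> null_sets lebesgue"
      using assms(1) by (intro null_sets_completionI) (auto simp: borel_compact)
    then show False
      using negligible_convex_interior[OF assms(2)] assms(3) by (simp add: negligible_iff_null_sets)
  qed
  then obtain A where A: "emeasure lborel \<Omega> = ennreal A" "0 < A"
    using fin by (cases "emeasure lborel \<Omega>") (auto simp: ennreal_eq_0_iff not_le)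
  interpret plane_body \<Omega> A using assms(1) A by unfold_locales
  have sq: "\<Omega> \<times> \<Omega> \<in> sets lebesgue"
    using assms(1) by (intro lmeasurable_compact[THEN fmeasurableD] compact_Times)
  have "(\<lambda>z. if z \<in> \<Omega> \<times> \<Omega> then w z else 0) \<in> borel_measurable lebesgue"
    by (rule borel_measurable_if_I[OF assms(4) sq])
  from completion_ex_borel_measurable_real[OF this]
  obtain v where "v \<in> borel_measurable lborel"
    and ae_v: "AE z in lborel. (if z \<in> \<Omega> \<times> \<Omega> then w z else 0) = v z" by blast
  then have v[measurable]: "v \<in> borel_measurable borel" by simp
  \<comment> \<open>The Borel version \<open>v\<close> may leave [0, 1] on a null set and need not
    vanish off the square, hence the clipping and the cut-off. Where \<open>v\<close> agrees with
    \<open>w\<close> on the square, neither changes its value.\<close>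
  define w' where "w' z = (if z \<in> \<Omega> \<times> \<Omega> then min 1 (max 0 (v z)) else 0)" for z
  have sqb[measurable]: "\<Omega> \<times> \<Omega> \<in> sets borel"
    using assms(1) by (intro borel_compact compact_Times)
  interpret plane_weight \<Omega> A w'
  proof
    show "w' \<in> borel_measurable borel" unfolding w'_def by measurable
  qed (auto simp: w'_def)
  have "AE z in lborel. z \<in> \<Omega> \<times> \<Omega> \<longrightarrow> w z = w' z"
    using ae_v
  proof eventually_elim
    fix z assume "(if z \<in> \<Omega> \<times> \<Omega> then w z else 0) = v z"
    then show "z \<in> \<Omega> \<times> \<Omega> \<longrightarrow> w z = w' z"
      using assms(5)[of "fst z" "snd z"] by (auto simp: w'_def)
  qed
  then obtain Z where Z0: "{z \<in> space lborel. \<not> (z \<in> \<Omega> \<times> \<Omega> \<longrightarrow> w z = w' z)} \<subseteq> Z"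
    and Z1: "emeasure lborel Z = 0" "Z \<in> sets lborel" by (rule AE_E)
  have Z: "Z \<in> null_sets lborel" using Z1 by (auto simp: null_sets_def)
  have eqZ: "\<And>z. z \<in> \<Omega> \<times> \<Omega> \<Longrightarrow> z \<notin> Z \<Longrightarrow> w z = w' z" using Z0 by auto
  have Zb: "Z \<in> sets (borel \<Otimes>\<^sub>M borel)" using Z1(2) unfolding borel_prod by simp
  then have notZ[measurable]: "Measurable.pred (borel \<Otimes>\<^sub>M borel) (\<lambda>z. z \<notin> Z)" by measurable
  \<comment> \<open>The exceptional set is null in four dimensions; Fubini passes to its sections,
    which is the form that iterated integrals can use.\<close>
  have "AE z in lborel \<Otimes>\<^sub>M lborel. z \<notin> Z" unfolding lborel_prod using Z by (rule AE_not_in)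
  then have "AE x in lborel. AE y in lborel. (x, y) \<notin> Z" by (rule lborel_pair.AE_pair)
  then have "AE x in lborel. AE y in U. (x, y) \<notin> Z"
    by eventually_elim (auto intro: AE_U)
  then have aeU: "AE x in U. AE y in U. (x, y) \<notin> Z" by (intro AE_U) auto
  have edge: "edge_density \<Omega> w = (\<integral>x. (\<integral>y. w' (x, y) \<partial>U) \<partial>U)"
  proof -
    \<comment> \<open>The definition integrates over the first argument innermost. Symmetry swaps
      the arguments so that the outer variable comes first, in agreement with the sections in
      \<open>aeU\<close>.\<close>
    have "edge_density \<Omega> w = (\<integral>x. (\<integral>y. w (x, y) \<partial>U) \<partial>U)"
      unfolding edge_density_def using assms(6) by (intro Bochner_Integration.integral_cong refl) auto
    also have "\<dots> = (\<integral>x. (\<integral>y. w' (x, y) \<partial>U) \<partial>U)"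
    proof (rule U.integral_AE_eq)
      show "AE x in U. (\<integral>y. w (x, y) \<partial>U) = (\<integral>y. w' (x, y) \<partial>U)"
        using aeU AE_space
      proof eventually_elim
        fix x assume ae: "AE y in U. (x, y) \<notin> Z" and x: "x \<in> space U"
        show "(\<integral>y. w (x, y) \<partial>U) = (\<integral>y. w' (x, y) \<partial>U)"
        proof (rule U.integral_AE_eq)
          show "(\<lambda>y. w' (x, y)) \<in> borel_measurable U" by (rule measurable_compose[OF id_U]) measurable
          show "AE y in U. w (x, y) = w' (x, y)"
            using ae AE_space by eventually_elim (use x eqZ in auto)
        qed
      qed
    qed measurable
    finally show ?thesis .
  qed
  have crossing: "crossing_density \<Omega> w = integral\<^sup>L (U \<Otimes>\<^sub>M U \<Otimes>\<^sub>M U \<Otimes>\<^sub>M U) cross_fun"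
  proof -
    let ?M = "U \<Otimes>\<^sub>M U \<Otimes>\<^sub>M U \<Otimes>\<^sub>M U"
    let ?f = "\<lambda>(x1, x2, x3, x4). w (x1, x2) * w (x3, x4) * of_bool (crosses x1 x2 x3 x4)"
    have ae34: "AE q in U \<Otimes>\<^sub>M U. q \<notin> Z"
    proof (rule U2.AE_pair_measure[OF _ aeU])
      have "Measurable.pred (U \<Otimes>\<^sub>M U) (\<lambda>z. (fst z, snd z) \<notin> Z)" by measurable
      then show "{q \<in> space (U \<Otimes>\<^sub>M U). q \<notin> Z} \<in> sets (U \<Otimes>\<^sub>M U)" by (simp add: pred_def)
    qed
    \<comment> \<open>Both edges must avoid \<open>Z\<close>. The second one does so almost surely
      whatever the first one is, by \<open>ae34\<close>; the first one is handled through its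
      sections.\<close>
    have "AE x in ?M. (fst x, fst (snd x)) \<notin> Z \<and> snd (snd x) \<notin> Z"
    proof (rule U4.AE_pair_measure)
      have "Measurable.pred ?M (\<lambda>x. (fst x, fst (snd x)) \<notin> Z \<and> (fst (snd (snd x)), snd (snd (snd x))) \<notin> Z)"
        by measurable
      then show "{x \<in> space ?M. (fst x, fst (snd x)) \<notin> Z \<and> snd (snd x) \<notin> Z} \<in> sets ?M" by (simp add: pred_def)
      show "AE x in U. AE y in U \<Otimes>\<^sub>M U \<Otimes>\<^sub>M U. (fst (x, y), fst (snd (x, y))) \<notin> Z \<and> snd (snd (x, y)) \<notin> Z"
        using aeU AE_space
      proof eventually_elim
        fix x assume ae: "AE y in U. (x, y) \<notin> Z" and x: "x \<in> space U"
        show "AE y in U \<Otimes>\<^sub>M U \<Otimes>\<^sub>M U. (fst (x, y), fst (snd (x, y))) \<notin> Z \<and> snd (snd (x, y)) \<notin> Z"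
        proof (rule U3.AE_pair_measure)
          have "Measurable.pred (U \<Otimes>\<^sub>M U \<Otimes>\<^sub>M U) (\<lambda>y. (x, fst y) \<notin> Z \<and> (fst (snd y), snd (snd y)) \<notin> Z)"
            by measurable
          then show "{y \<in> space (U \<Otimes>\<^sub>M U \<Otimes>\<^sub>M U). (fst (x, y), fst (snd (x, y))) \<notin> Z \<and> snd (snd (x, y)) \<notin> Z}
              \<in> sets (U \<Otimes>\<^sub>M U \<Otimes>\<^sub>M U)" by (simp add: pred_def)
          show "AE y in U. AE q in U \<Otimes>\<^sub>M U. (fst (x, (y, q)), fst (snd (x, (y, q)))) \<notin> Z \<and> snd (snd (x, (y, q))) \<notin> Z"
            using ae by eventually_elim (use ae34 in auto)
        qed
      qed
    qed
    then have "AE x in ?M. ?f x = cross_fun x"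
      using AE_space
    proof eventually_elim
      fix x assume "(fst x, fst (snd x)) \<notin> Z \<and> snd (snd x) \<notin> Z" "x \<in> space ?M"
      then show "?f x = cross_fun x"
        by (auto simp: cross_fun_def space_pair_measure eqZ split: prod.splits)
    qed
    \<comment> \<open>Only in the completed product does equality almost everywhere with the Borel
      integrand make the original integrand measurable; for \<open>cross_fun\<close> the completed
      and uncompleted integrals agree.\<close>
    then have "AE x in completion ?M. ?f x = cross_fun x" by (rule AE_completion)
    then have "integral\<^sup>L (completion ?M) ?f = integral\<^sup>L (completion ?M) cross_fun"
      by (intro completion.integral_AE_eq measurable_completion cross_fun_U)
    also have "\<dots> = integral\<^sup>L ?M cross_fun" by (rule integral_completion[OF cross_fun_U])
    finally show ?thesis unfolding crossing_density_def .
  qed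
  show ?thesis using normalized_crossing_bound[OF assms(2)] unfolding edge crossing .
qed

end
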